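(* Let $\ell\in[n]$. For all non-zero entries of the Boolean matrix product of two Boolean $n\times n$ matrices, witnesses of rank not exceeding $\ell$ can be reported in time $\tilde{O}((n/\ell)\,n^{\omega(1,\log_n\ell,1)})$.
   Context: This is in the standard (classical) computational model. For Boolean $n\times n$ matrices $A,B$ with Boolean product $C$, a witness for a non-zero entry $C[i,j]$ is an index $k\in[n]$ with $A[i,k]=B[k,j]=1$. A witness $k$ for $C[i,j]$ has rank $h$ if there are exactly $h-1$ witnesses for $C[i,j]$ greater than $k$ (so the maximum witness has rank 1). $\omega(1,r,1)$ denotes the exponent of multiplication of an $n\times n^r$ matrix by an $n^r\times n$ matrix. $\tilde{O}(\cdot)$ suppresses factors polylogarithmic in $n$. *)

theory Defs
  imports Complex_Main "Jordan_Normal_Form.Matrix"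
begin

section \<open>Witnesses of Boolean matrix products\<close>

text \<open>Indices run over \<open>{..<n}\<close>, as in the matrix library, instead of \<open>{1..n}\<close>.\<close>

definition bool_mult :: "bool mat \<Rightarrow> bool mat \<Rightarrow> bool mat" where
  "bool_mult A B =
     mat (dim_row A) (dim_col B) (\<lambda>(i, j). \<exists>k<dim_col A. A $$ (i, k) \<and> B $$ (k, j))"

definition witnesses :: "bool mat \<Rightarrow> bool mat \<Rightarrow> nat \<Rightarrow> nat \<Rightarrow> nat set" where
  "witnesses A B i j = {k. k < dim_col A \<and> A $$ (i, k) \<and> B $$ (k, j)}"

definition witness_rank :: "bool mat \<Rightarrow> bool mat \<Rightarrow> nat \<Rightarrow> nat \<Rightarrow> nat \<Rightarrow> nat" where
  "witness_rank A B i j k = card {k' \<in> witnesses A B i j. k' > k} + 1"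


section \<open>A unit-cost random access machine\<close>

text \<open>
  Programs are structured; a program mentions finitely many registers (numbered by naturals) and
  finitely many random access memories (numbered by naturals, with integer addresses). Every
  elementary instruction and every test costs one time unit.

  To exclude packing much information into one word, a constant or the result of an arithmetic
  operation must have absolute value at most the word bound \<open>w\<close>; otherwise the execution is stuck.
  The bound will be polynomial in \<open>n\<close>, that is, words have \<open>O(log n)\<close> bits.
\<close>

datatype arith = Add | Sub | Mul | Div | Mod

fun arith_val :: "arith \<Rightarrow> int \<Rightarrow> int \<Rightarrow> int" where
  "arith_val Add x y = x + y"
| "arith_val Sub x y = x - y"
| "arith_val Mul x y = x * y"
| "arith_val Div x y = x div y"
| "arith_val Mod x y = x mod y"

datatype com =
    Skip
  | Const nat int            \<comment> \<open>\<open>r := c\<close>\<close>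
  | Arith nat arith nat nat  \<comment> \<open>\<open>r := x op y\<close>\<close>
  | Load nat nat nat         \<comment> \<open>\<open>r := a[x]\<close>\<close>
  | Store nat nat nat        \<comment> \<open>\<open>a[x] := y\<close>\<close>
  | Seq com com
  | If_less nat nat com com  \<comment> \<open>\<open>if x < y then _ else _\<close>\<close>
  | While_less nat nat com   \<comment> \<open>\<open>while x < y do _\<close>\<close>

record state =
  reg :: "nat \<Rightarrow> int"
  mem :: "nat \<Rightarrow> int \<Rightarrow> int"

definition set_reg :: "state \<Rightarrow> nat \<Rightarrow> int \<Rightarrow> state" where
  "set_reg s r v = s\<lparr>reg := (reg s)(r := v)\<rparr>"

definition set_mem :: "state \<Rightarrow> nat \<Rightarrow> int \<Rightarrow> int \<Rightarrow> state" where
  "set_mem s a x v = s\<lparr>mem := (mem s)(a := (mem s a)(x := v))\<rparr>"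

text \<open>\<open>exec w p s t s'\<close>: started in \<open>s\<close>, program \<open>p\<close> halts in \<open>s'\<close> after \<open>t\<close> time units.\<close>

inductive exec :: "int \<Rightarrow> com \<Rightarrow> state \<Rightarrow> nat \<Rightarrow> state \<Rightarrow> bool" for w :: int where
  Skip: "exec w Skip s 1 s"
| Const: "\<bar>c\<bar> \<le> w \<Longrightarrow> exec w (Const r c) s 1 (set_reg s r c)"
| Arith: "v = arith_val f (reg s x) (reg s y) \<Longrightarrow> \<bar>v\<bar> \<le> w \<Longrightarrow>
    exec w (Arith r f x y) s 1 (set_reg s r v)"
| Load: "exec w (Load r a x) s 1 (set_reg s r (mem s a (reg s x)))"
| Store: "exec w (Store a x y) s 1 (set_mem s a (reg s x) (reg s y))"
| Seq: "exec w p s t s' \<Longrightarrow> exec w q s' u s'' \<Longrightarrow> exec w (Seq p q) s (t + u) s''"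
| If_true: "reg s x < reg s y \<Longrightarrow> exec w p s t s' \<Longrightarrow> exec w (If_less x y p q) s (t + 1) s'"
| If_false: "\<not> reg s x < reg s y \<Longrightarrow> exec w q s t s' \<Longrightarrow> exec w (If_less x y p q) s (t + 1) s'"
| While_false: "\<not> reg s x < reg s y \<Longrightarrow> exec w (While_less x y p) s 1 s"
| While_true: "reg s x < reg s y \<Longrightarrow> exec w p s t s' \<Longrightarrow> exec w (While_less x y p) s' u s'' \<Longrightarrow>
    exec w (While_less x y p) s (t + u + 1) s''"

lemma exec_deterministic:
  "exec w p s t s' \<Longrightarrow> exec w p s u s'' \<Longrightarrow> t = u \<and> s' = s''"
proof (induction arbitrary: u s'' rule: exec.induct)
  case (Seq p s t s' q u' s2)
  from Seq.prems show ?case by cases (use Seq.IH in blast)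
next
  case (While_true s x y p t s' u' s2)
  from While_true.prems show ?case by cases (use While_true in blast)+
next
  case (If_true s x y p t s' q)
  from If_true.prems show ?case by cases (use If_true in blast)+
next
  case (If_false s x y q t s' p)
  from If_false.prems show ?case by cases (use If_false in blast)+
qed (auto elim: exec.cases)

text \<open>Row-major storage of a matrix, with entries encoded by \<open>f\<close>.\<close>

definition stored :: "('a \<Rightarrow> int) \<Rightarrow> 'a mat \<Rightarrow> (int \<Rightarrow> int) \<Rightarrow> bool" where
  "stored f M h \<longleftrightarrow>
     (\<forall>i<dim_row M. \<forall>j<dim_col M. h (int (i * dim_col M + j)) = f (M $$ (i, j)))"


section \<open>Rectangular matrix multiplication and its exponent\<close>

text \<open>
  The program multiplies integer \<open>n \<times> m\<close> by \<open>m \<times> n\<close> matrices with entries of \<open>O(log n)\<close> bits.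
  The initial state is constrained only by the input: all other memory contents are arbitrary.
\<close>

definition multiplies :: "com \<Rightarrow> nat \<Rightarrow> nat \<Rightarrow> nat \<Rightarrow> real \<Rightarrow> bool" where
  "multiplies p c n m T \<longleftrightarrow>
     (\<forall>A B s. A \<in> carrier_mat n m \<and> B \<in> carrier_mat m n \<and>
        (\<forall>i<n. \<forall>k<m. \<bar>A $$ (i, k)\<bar> \<le> int n \<and> \<bar>B $$ (k, i)\<bar> \<le> int n) \<and>
        reg s 0 = int n \<and> reg s 1 = int m \<and>
        stored id A (mem s 0) \<and> stored id B (mem s 1) \<longrightarrow>
        (\<exists>t s'. exec ((int n + 1) ^ c) p s t s' \<and> real t \<le> T \<and> stored id (A * B) (mem s' 2)))"

text \<open>
  \<open>omega r\<close> is the exponent \<open>\<omega>(1,r,1)\<close>. As \<open>n powr r\<close> need not be an integer, the inner dimension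
  ranges over all \<open>m\<close> up to \<open>n powr r\<close>. The infimum need not be attained: a bound
  \<open>n powr omega r\<close> is usually meant as \<open>n powr (omega r + \<epsilon>)\<close> for every \<open>\<epsilon> > 0\<close>, or else presupposes
  multiplication in time \<open>n powr omega r\<close> up to polylogarithmic factors.
\<close>

definition omega :: "real \<Rightarrow> real" where
  "omega r = Inf {\<tau>. \<exists>p c C. \<forall>n\<ge>1. \<forall>m\<ge>1. real m \<le> real n powr r \<longrightarrow>
                        multiplies p c n m (C * real n powr \<tau>)}"


section \<open>Time bounds up to polylogarithmic factors\<close>

text \<open>
  Bounds depend on \<open>n\<close> and on \<open>l \<in> {1..n}\<close>; constants are uniform in both.
  The summand 1 only serves to cover \<open>n = 1\<close>.
\<close>

definition soft_O :: "(nat \<Rightarrow> nat \<Rightarrow> real) \<Rightarrow> (nat \<Rightarrow> nat \<Rightarrow> real) set" where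
  "soft_O f = {T. \<exists>C d. \<forall>n\<ge>1. \<forall>l\<in>{1..n}. T n l \<le> C * (1 + ln (real n)) ^ d * f n l}"

definition multiplication_in_time :: "(nat \<Rightarrow> nat \<Rightarrow> real) \<Rightarrow> bool" where
  "multiplication_in_time f \<longleftrightarrow>
     (\<exists>p c. \<exists>T\<in>soft_O f. \<forall>n\<ge>1. \<forall>l\<in>{1..n}. multiplies p c n l (T n l))"

text \<open>
  For every non-zero entry of the product, one witness of rank at most \<open>l\<close> is output; for a zero
  entry, \<open>-1\<close> is output.
\<close>

definition reports_witnesses :: "com \<Rightarrow> nat \<Rightarrow> nat \<Rightarrow> nat \<Rightarrow> real \<Rightarrow> bool" where
  "reports_witnesses p c n l T \<longleftrightarrow>
     (\<forall>A B s. A \<in> carrier_mat n n \<and> B \<in> carrier_mat n n \<and>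
        reg s 0 = int n \<and> reg s 1 = int l \<and>
        stored of_bool A (mem s 0) \<and> stored of_bool B (mem s 1) \<longrightarrow>
        (\<exists>t s'. exec ((int n + 1) ^ c) p s t s' \<and> real t \<le> T \<and>
           (\<forall>i<n. \<forall>j<n.
              if bool_mult A B $$ (i, j)
              then \<exists>k\<in>witnesses A B i j.
                     mem s' 2 (int (i * n + j)) = int k \<and> witness_rank A B i j k \<le> l
              else mem s' 2 (int (i * n + j)) = - 1)))"

definition witnesses_reportable_in_time :: "(nat \<Rightarrow> nat \<Rightarrow> real) \<Rightarrow> bool" where
  "witnesses_reportable_in_time f \<longleftrightarrow>
     (\<exists>p c. \<exists>T\<in>soft_O f. \<forall>n\<ge>1. \<forall>l\<in>{1..n}. reports_witnesses p c n l (T n l))"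

end

theory Submission
  imports Defs "HOL-Computational_Algebra.Primes" "HOL-Number_Theory.Cong"
begin

text \<open>
  The inner dimension is cut into blocks of \<open>l\<close> consecutive indices. A witness from the last block
  that contains one has rank at most \<open>l\<close>, so it suffices to find witnesses of \<open>n \<times> l\<close> by
  \<open>l \<times> n\<close> Boolean products with polylogarithmically many integer products of this format.

  If a subset \<open>S\<close> of the block contains exactly one witness of an entry, then the product in which
  column \<open>k\<close> is weighted by \<open>k\<close> if \<open>k \<in> S\<close> and by 0 otherwise reveals it. For the entries with between
  \<open>2 ^ s\<close> and \<open>2 ^ (s + 1)\<close> witnesses, such a set \<open>S\<close> is obtained by halving the block \<open>s + 3\<close> times, each
  time with the best of the polylogarithmically many sets \<open>{k. 2 * ((a * k + b) mod q) \<le> q}\<close>. For prime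
  \<open>q\<close> these are pairwise independent on indices that are distinct modulo \<open>q\<close>, and two indices agree
  modulo few primes; hence some choice does not decrease a potential which bounds the number of isolated
  entries from below. So a constant fraction of the entries is resolved in each round, and logarithmically
  many rounds suffice. Enough primes are provided by the bound \<open>2 ^ (N - 1) \<le> N ^ \<pi>(N)\<close>, which follows
  from the Leibniz harmonic triangle.

  As every multiplication program needs \<open>n\<^sup>2\<close> steps to overwrite its output memory, the overhead of
  \<open>O(n\<^sup>2)\<close> per product is harmless.
\<close>

section \<open>Primes\<close>

text \<open>A pairwise independent family of unbiased samples of \<open>l\<close> indices has more
  than \<open>l\<close> members, too many to try one after another. Small prime moduli keep the
  family polylogarithmic at the price of collisions. As a nonempty set of residues modulo
  \<open>q\<close> has density at least 1/q, low sampling rates are reached only by repeated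
  halving. Each halving is fixed by exhaustive search before the next one, as in the method of
  conditional expectations.

  The quantity that guides the search is a truncated inclusion-exclusion. If \<open>d\<close>
  witnesses of an entry survive, then d - d(d - 1) is 1 for d = 1 and at most 0 otherwise. It
  involves only single indices and pairs, so pairwise independence controls its average, and it is
  computable from the witness counts that one integer product delivers for all entries at once.
  Hence one choice serves all unresolved entries together, without having to be good for each of
  them.\<close>

lemma leibniz_triangle_dvd:
  fixes L :: nat
  assumes L: "\<And>k. 1 \<le> k \<Longrightarrow> k \<le> N \<Longrightarrow> k dvd L" and "L > 0"
  shows "1 \<le> n \<Longrightarrow> n \<le> N \<Longrightarrow> k < n \<Longrightarrow> n * ((n - 1) choose k) dvd L"
proof (induction k arbitrary: n)
  case 0
  then show ?case using L by simp
next
  case (Suc k)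
  define u v w where "u = n * ((n - 1) choose Suc k)" and "v = n * ((n - 1) choose k)"
    and "w = (n - 1) * ((n - 2) choose k)"
  obtain m where m: "n = Suc (Suc m)" using Suc.prems by (metis Suc_lessE less_imp_Suc_add)
  have v: "v dvd L" unfolding v_def using Suc by auto
  have w: "w dvd L" unfolding w_def using Suc.IH[of "n - 1"] Suc.prems by (simp add: numeral_2_eq_2)
  have k: "k \<le> m" using Suc.prems m by simp
  \<comment> \<open>An entry of the Leibniz triangle is the sum of the two below it, so the
    reciprocals satisfy 1/u = 1/w - 1/v. Thus L/u = L/w - L/v, a difference of two integers because
    \<open>v\<close> and \<open>w\<close> divide \<open>L\<close> by induction.\<close>
  have uvw: "u * (v - w) = v * w" and vw: "w \<le> v"
  proof -
    have c1: "Suc m choose Suc k = (m choose k) + (m choose Suc k)" by simp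
    have c2: "Suc k * (Suc m choose Suc k) = Suc m * (m choose k)"
      by (metis Suc_times_binomial_eq mult.commute)
    have c3: "(Suc m - k) * (Suc m choose k) = Suc m * (m choose k)"
      by (metis binomial_absorb_comp diff_Suc_1)
    have u: "u = Suc (Suc m) * (Suc m choose Suc k)" "v = Suc (Suc m) * (Suc m choose k)"
      "w = Suc m * (m choose k)" by (auto simp: u_def v_def w_def m numeral_2_eq_2)
    have w2: "w = (Suc m - k) * (Suc m choose k)" "w = Suc k * (Suc m choose Suc k)"
      using u c2 c3 by simp_all
    have d: "v - w = Suc k * (Suc m choose k)"
      using k unfolding u(2) w2(1) by (simp add: diff_mult_distrib[symmetric] del: mult_Suc)
    show "u * (v - w) = v * w" 
      by (simp only: d) (simp only: u(1,2) w2(2) mult_ac)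
    show "w \<le> v" unfolding w2 u(2) by (metis w2(1) diff_le_self le_SucI mult_le_mono1)
  qed
  have pos: "u > 0" "v > 0" "w > 0" using Suc.prems by (auto simp: u_def v_def w_def m zero_less_binomial_iff)
  from v obtain x where x: "L = v * x" by (elim dvdE)
  from w obtain y where y: "L = w * y" by (elim dvdE)
  have "u * (v - w) * (y - x) = v * w * (y - x)" using uvw by simp
  also have "\<dots> = (w * y) * v - (v * x) * w" by (simp add: algebra_simps diff_mult_distrib2)
  also have "\<dots> = L * (v - w)" using x y by (simp add: diff_mult_distrib2)
  finally have "(v - w) * (u * (y - x)) = (v - w) * L" by (metis mult.assoc mult.commute)
  moreover have "v - w > 0" using uvw pos by (metis mult_0_right mult_pos_pos not_gr0)
  ultimately have "L = u * (y - x)" by (metis mult_left_cancel neq0_conv)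
  then show ?case unfolding u_def by simp
qed

text \<open>The entries \<open>N * ((N - 1) choose k)\<close> of one row divide the least common
  multiple of the numbers up to \<open>N\<close>, so none exceeds it, while the \<open>N\<close>
  entries sum to \<open>N * 2 ^ (N - 1)\<close>. The common multiple \<open>L\<close> has one prime
  power for each prime up to \<open>N\<close>, and each of these is at most
  \<open>N\<close>.\<close>

lemma power_le_power_card_primes:
  assumes "N \<ge> 1"
  shows "2 ^ (N - 1) \<le> N ^ card {p. prime p \<and> p \<le> N}"
proof -
  define P where "P = {p::nat. prime p \<and> p \<le> N}"
  have fin: "finite P" by (auto simp: P_def)
  define e where "e = (\<lambda>p. Max {i. p ^ i \<le> N})"
  have e: "p ^ e p \<le> N" "\<And>i. p ^ i \<le> N \<Longrightarrow> i \<le> e p" if "p \<in> P" for p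
  proof -
    have p: "p \<ge> 2" using that by (auto simp: P_def dest: prime_ge_2_nat)
    have f: "finite {i. p ^ i \<le> N}"
    proof (rule finite_subset)
      show "{i. p ^ i \<le> N} \<subseteq> {..N}"
      proof safe
        fix i assume "p ^ i \<le> N"
        moreover have "i < p ^ i" using p by (meson less_exp less_le_trans power_mono zero_le)
        ultimately show "i \<le> N" by simp
      qed
    qed simp
    have "0 \<in> {i. p ^ i \<le> N}" using assms by simp
    then have "e p \<in> {i. p ^ i \<le> N}" unfolding e_def using f Max_in by blast
    then show "p ^ e p \<le> N" by simp
    show "\<And>i. p ^ i \<le> N \<Longrightarrow> i \<le> e p" unfolding e_def using f by (auto intro: Max_ge)
  qed
  define L where "L = (\<Prod>p\<in>P. p ^ e p)"
  have Lpos: "L > 0" unfolding L_def by (auto intro!: prod_pos simp: P_def prime_gt_0_nat)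
  have dvd: "k dvd L" if k: "1 \<le> k" "k \<le> N" for k
  proof -
    have "k = (\<Prod>p\<in>prime_factors k. p ^ multiplicity p k)"
      using k by (metis not_one_le_zero prime_factorization_nat neq0_conv)
    also have "\<dots> dvd (\<Prod>p\<in>prime_factors k. p ^ e p)"
    proof (rule prod_dvd_prod)
      fix p assume p: "p \<in> prime_factors k"
      then have "p \<in> P" using k by (auto simp: P_def prime_factors_dvd dest: dvd_imp_le)
      moreover have "p ^ multiplicity p k \<le> N" using k dvd_imp_le[OF multiplicity_dvd[of p k]] by simp
      ultimately show "p ^ multiplicity p k dvd p ^ e p" using e by (simp add: le_imp_power_dvd)
    qed
    also have "\<dots> dvd L" unfolding L_def
    proof (rule prod_dvd_prod_subset)
      show "prime_factors k \<subseteq> P" using k by (auto simp: P_def prime_factors_dvd dest: dvd_imp_le)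
    qed (use fin in auto)
    finally show ?thesis .
  qed
  have "N * 2 ^ (N - 1) = (\<Sum>k\<le>N - 1. N * ((N - 1) choose k))"
    by (simp add: sum_distrib_left[symmetric] choose_row_sum)
  also have "\<dots> \<le> (\<Sum>k\<le>N - 1. L)"
  proof (rule sum_mono)
    fix k assume "k \<in> {..N - 1}"
    then have "N * ((N - 1) choose k) dvd L"
      using assms by (intro leibniz_triangle_dvd[where N = N] dvd Lpos) auto
    then show "N * ((N - 1) choose k) \<le> L" using Lpos by (rule dvd_imp_le)
  qed
  also have "\<dots> = N * L" using assms by simp
  finally have "2 ^ (N - 1) \<le> L" using assms by simp
  also have "L \<le> (\<Prod>p\<in>P. N)" unfolding L_def by (intro prod_mono) (auto simp: e)
  finally show ?thesis by (simp add: P_def)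
qed

text \<open>Taking a cube as the bound makes the crude estimate Z < 2^Z good enough for the base
  \<open>Z ^ 3\<close>. No logarithm enters, and about Z^2/3 primes are still guaranteed.\<close>

lemma many_primes_le_cube:
  assumes "Z \<ge> 1"
  shows "Z ^ 3 \<le> 1 + 3 * Z * card {p::nat. prime p \<and> p \<le> Z ^ 3}"
proof -
  let ?c = "card {p::nat. prime p \<and> p \<le> Z ^ 3}"
  have "(2::nat) ^ (Z ^ 3 - 1) \<le> (Z ^ 3) ^ ?c" using assms by (intro power_le_power_card_primes) simp
  also have "\<dots> \<le> ((2 ^ Z) ^ 3) ^ ?c" by (intro power_mono) (auto simp: less_exp less_imp_le)
  also have "\<dots> = 2 ^ (3 * Z * ?c)" by (simp add: power_mult[symmetric] algebra_simps)
  finally show ?thesis by (simp add: power_increasing_iff)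
qed

text \<open>The product of the distinct prime divisors divides \<open>m\<close>, and each of them is
  at least 2.\<close>

lemma card_prime_divisors_le:
  fixes m :: nat
  assumes "m > 0" "m < 2 ^ L" "finite P" "\<And>p. p \<in> P \<Longrightarrow> prime p"
  shows "card {p \<in> P. p dvd m} \<le> L"
proof -
  let ?D = "{p \<in> P. p dvd m}"
  have "2 ^ card ?D = (\<Prod>p\<in>?D. 2::nat)" by simp
  also have "\<dots> \<le> \<Prod>?D" using assms by (intro prod_mono) (auto dest: prime_ge_2_nat)
  also have "\<Prod>D dvd m" if "finite D" "D \<subseteq> ?D" for D
    using that
  proof (induction D rule: finite_induct)
    case (insert p D)
    moreover have "coprime p (\<Prod>D)"
      using insert assms(4) by (intro prod_coprime_right primes_coprime) auto
    ultimately show ?case by (simp add: divides_mult)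
  qed simp
  from this[of ?D] have "\<Prod>?D \<le> m" using assms by (auto dest: dvd_imp_le)
  finally have "(2::nat) ^ card ?D < 2 ^ L" using assms by linarith
  then show ?thesis by (simp add: power_less_imp_less_exp less_imp_le)
qed

section \<open>Sampling with affine hash functions\<close>

text \<open>For odd \<open>q\<close> this selects (q + 1)/2 of the \<open>q\<close> residues,
  slightly more than half. The excess helps the linear term of the potential, so only the quadratic
  term needs an allowance for it.\<close>

definition pick :: "nat \<Rightarrow> nat \<Rightarrow> nat \<Rightarrow> nat set" where
  "pick q a b = {k. 2 * ((a * k + b) mod q) \<le> q}"

lemma mod_eq_iff_int_dvd_diff:
  fixes a b q :: nat
  shows "a mod q = b mod q \<longleftrightarrow> int q dvd int a - int b"
proof -
  have "a mod q = b mod q \<longleftrightarrow> int (a mod q) = int (b mod q)" by (simp only: of_nat_eq_iff)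
  then show ?thesis by (simp only: zmod_int mod_eq_dvd_iff)
qed

text \<open>For fixed \<open>a\<close> and \<open>k\<close> the shift \<open>b\<close> alone makes
  the residue uniform, whether or not the modulus is prime.\<close>

lemma card_pick_single:
  fixes q :: nat
  assumes "q > 0"
  shows "card {b \<in> {..<q}. 2 * ((c + b) mod q) \<le> q} = card {x \<in> {..<q}. 2 * x \<le> q}"
proof (rule bij_betw_same_card)
  have inj: "inj_on (\<lambda>b. (c + b) mod q) {..<q}"
  proof (rule inj_onI)
    fix x y assume "x \<in> {..<q}" "y \<in> {..<q}" "(c + x) mod q = (c + y) mod q"
    then show "x = y" using cong_add_lcancel_nat[of c x y q] by (simp add: cong_def)
  qed
  have im: "(\<lambda>b. (c + b) mod q) ` {..<q} = {..<q}"
    using assms by (intro card_subset_eq) (auto simp: card_image[OF inj])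
  show "bij_betw (\<lambda>b. (c + b) mod q) {b \<in> {..<q}. 2 * ((c + b) mod q) \<le> q}
     {x \<in> {..<q}. 2 * x \<le> q}"
    unfolding bij_betw_def
  proof
    show "inj_on (\<lambda>b. (c + b) mod q) {b \<in> {..<q}. 2 * ((c + b) mod q) \<le> q}"
      by (rule inj_on_subset[OF inj]) auto
    show "(\<lambda>b. (c + b) mod q) ` {b \<in> {..<q}. 2 * ((c + b) mod q) \<le> q} = {x \<in> {..<q}. 2 * x \<le> q}"
    proof (intro equalityI subsetI)
      fix x assume x: "x \<in> {x \<in> {..<q}. 2 * x \<le> q}"
      then have "x \<in> (\<lambda>b. (c + b) mod q) ` {..<q}" unfolding im by simp
      with x show "x \<in> (\<lambda>b. (c + b) mod q) ` {b \<in> {..<q}. 2 * ((c + b) mod q) \<le> q}" by blast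
    qed (use assms in auto)
  qed
qed

text \<open>Subtracting the two congruences eliminates \<open>b\<close> and leaves (a - a')(k - k')
  divisible by the prime \<open>q\<close>. This forces \<open>a = a'\<close>, and then
  \<open>b = b'\<close>.\<close>

lemma affine_pair_inj:
  fixes q :: nat
  assumes q: "prime q" and k: "k mod q \<noteq> k' mod q"
  shows "inj_on (\<lambda>(a, b). ((a * k + b) mod q, (a * k' + b) mod q)) ({..<q} \<times> {..<q})"
proof (rule inj_onI, clarify)
  fix a b a' b'
  assume lt: "a < q" "b < q" "a' < q" "b' < q"
    and e1: "(a * k + b) mod q = (a' * k + b') mod q"
    and e2: "(a * k' + b) mod q = (a' * k' + b') mod q"
  have "int q dvd int (a * k + b) - int (a' * k + b')" "int q dvd int (a * k' + b) - int (a' * k' + b')"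
    using e1 e2 by (simp_all only: mod_eq_iff_int_dvd_diff)
  then have "int q dvd (int (a * k + b) - int (a' * k + b')) - (int (a * k' + b) - int (a' * k' + b'))"
    by (rule dvd_diff)
  also have "\<dots> = (int a - int a') * (int k - int k')" by (simp add: algebra_simps)
  finally have "int q dvd int a - int a' \<or> int q dvd int k - int k'"
    using q by (simp add: prime_dvd_mult_iff)
  moreover have "\<not> int q dvd int k - int k'"
    using k by (simp add: mod_eq_iff_int_dvd_diff)
  ultimately have "a mod q = a' mod q" by (simp add: mod_eq_iff_int_dvd_diff)
  then have a: "a = a'" using lt by simp
  then have "[a * k + b = a * k + b'] (mod q)" using e1 by (simp add: cong_def)
  then have "b = b'" using lt cong_add_lcancel_nat by (simp add: cong_def)
  with a show "a = a' \<and> b = b'" by simp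
qed

text \<open>An injective map of the square of residues into itself is a bijection, so the choices
  that pick both indices correspond to the square of the selected half.\<close>

lemma card_pick_pair:
  fixes q :: nat
  assumes q: "prime q" and k: "k mod q \<noteq> k' mod q"
  shows "card {(a, b) \<in> {..<q} \<times> {..<q}. k \<in> pick q a b \<and> k' \<in> pick q a b} =
         card {x \<in> {..<q}. 2 * x \<le> q} ^ 2"
proof -
  let ?f = "\<lambda>(a, b). ((a * k + b) mod q, (a * k' + b) mod q)"
  let ?H = "{x \<in> {..<q}. 2 * x \<le> q}"
  have "q > 0" using q by (simp add: prime_gt_0_nat)
  have inj: "inj_on ?f ({..<q} \<times> {..<q})" using affine_pair_inj[OF assms] .
  have im: "?f ` ({..<q} \<times> {..<q}) = {..<q} \<times> {..<q}"
    using \<open>q > 0\<close> by (intro card_subset_eq) (auto simp: card_image[OF inj])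
  have "bij_betw ?f {(a, b) \<in> {..<q} \<times> {..<q}. k \<in> pick q a b \<and> k' \<in> pick q a b} (?H \<times> ?H)"
    unfolding bij_betw_def
  proof
    show "inj_on ?f {(a, b) \<in> {..<q} \<times> {..<q}. k \<in> pick q a b \<and> k' \<in> pick q a b}"
      by (rule inj_on_subset[OF inj]) auto
    show "?f ` {(a, b) \<in> {..<q} \<times> {..<q}. k \<in> pick q a b \<and> k' \<in> pick q a b} = ?H \<times> ?H"
    proof (intro equalityI subsetI)
      fix z assume z: "z \<in> ?H \<times> ?H"
      then have "z \<in> ?f ` ({..<q} \<times> {..<q})" unfolding im by auto
      then obtain a b where ab: "(a, b) \<in> {..<q} \<times> {..<q}" "z = ?f (a, b)" by auto
      with z have "(a, b) \<in> {(a, b) \<in> {..<q} \<times> {..<q}. k \<in> pick q a b \<and> k' \<in> pick q a b}"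
        by (auto simp: pick_def)
      with ab show "z \<in> ?f ` {(a, b) \<in> {..<q} \<times> {..<q}. k \<in> pick q a b \<and> k' \<in> pick q a b}"
        by blast
    qed (use \<open>q > 0\<close> in \<open>auto simp: pick_def\<close>)
  qed
  then have "card {(a, b) \<in> {..<q} \<times> {..<q}. k \<in> pick q a b \<and> k' \<in> pick q a b} = card (?H \<times> ?H)"
    by (rule bij_betw_same_card)
  then show ?thesis by (simp add: card_cartesian_product power2_eq_square)
qed

section \<open>First and second moments of the sample sizes\<close>

lemma real_card_half:
  fixes q :: nat
  assumes "odd q"
  shows "real (card {x \<in> {..<q}. 2 * x \<le> q}) = (real q + 1) / 2"
proof -
  obtain m where m: "q = 2 * m + 1" using assms by (elim oddE)
  have "{x \<in> {..<q}. 2 * x \<le> q} = {..m}" using m by auto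
  then show ?thesis using m by simp
qed

text \<open>On these ordered pairs membership of the two indices coincides instead of being
  independent. They are the price for a modulus smaller than the range of the indices.\<close>

definition collisions :: "nat set \<Rightarrow> nat \<Rightarrow> nat" where
  "collisions X q = card {(k, k') \<in> X \<times> X. k \<noteq> k' \<and> k mod q = k' mod q}"

lemma real_card_filter: "finite A \<Longrightarrow> real (card {x \<in> A. P x}) = (\<Sum>x\<in>A. of_bool (P x))"
  by (simp add: of_bool_def sum.If_cases Int_def)

lemma card_off_diagonal:
  assumes "finite Y"
  shows "real (card {(k, k') \<in> Y \<times> Y. k \<noteq> k'}) = real (card Y) * (real (card Y) - 1)"
proof -
  have "{(k, k') \<in> Y \<times> Y. k \<noteq> k'} = Y \<times> Y - (\<lambda>k. (k, k)) ` Y" by auto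
  moreover have "card (Y \<times> Y - (\<lambda>k. (k, k)) ` Y) = card (Y \<times> Y) - card ((\<lambda>k. (k, k)) ` Y)"
    using assms by (intro card_Diff_subset) auto
  moreover have "card ((\<lambda>k. (k, k)) ` Y) = card Y" by (intro card_image) (auto simp: inj_on_def)
  moreover have "card Y \<le> card Y * card Y" by (cases "card Y") auto
  ultimately show ?thesis by (simp add: card_cartesian_product of_nat_diff algebra_simps)
qed

lemma sum_card_pick:
  assumes "prime q" "odd q" "finite X"
  shows "(\<Sum>ab\<in>{..<q} \<times> {..<q}. real (card (X \<inter> pick q (fst ab) (snd ab)))) =
    real q * (real q + 1) / 2 * real (card X)"
proof -
  let ?h = "card {x \<in> {..<q}. 2 * x \<le> q}"
  have q: "q > 0" using assms by (simp add: prime_gt_0_nat)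
  have h: "real ?h = (real q + 1) / 2" 
    by (rule real_card_half[OF assms(2)])
  have *: "(\<Sum>ab\<in>{..<q} \<times> {..<q}. of_bool (k \<in> pick q (fst ab) (snd ab))) = real q * real ?h" for k
  proof -
    have "(\<Sum>ab\<in>{..<q} \<times> {..<q}. of_bool (k \<in> pick q (fst ab) (snd ab))) =
      (\<Sum>a<q. \<Sum>b<q. of_bool (k \<in> pick q a b) :: real)"
      unfolding sum.cartesian_product case_prod_beta ..
    also have "\<dots> = (\<Sum>a<q. real (card {b \<in> {..<q}. 2 * ((a * k + b) mod q) \<le> q}))"
      by (simp only: real_card_filter[OF finite_lessThan] pick_def mem_Collect_eq)
    also have "\<dots> = real q * real ?h" 
      by (simp only: card_pick_single[OF q] sum_constant card_lessThan)
    finally show ?thesis .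
  qed
  have "(\<Sum>ab\<in>{..<q} \<times> {..<q}. real (card (X \<inter> pick q (fst ab) (snd ab)))) =
     (\<Sum>ab\<in>{..<q} \<times> {..<q}. \<Sum>k\<in>X. of_bool (k \<in> pick q (fst ab) (snd ab)))"
    using assms(3) by (simp add: real_card_filter[symmetric] Int_def)
  also have "\<dots> = (\<Sum>k\<in>X. \<Sum>ab\<in>{..<q} \<times> {..<q}. of_bool (k \<in> pick q (fst ab) (snd ab)))"
    by (rule sum.swap)
  also have "\<dots> = real (card X) * (real q * real ?h)" by (simp add: *)
  finally show ?thesis
    unfolding h by (simp only: mult_ac times_divide_eq_right times_divide_eq_left)
qed

text \<open>The summand counts ordered pairs of distinct indices in the sample, so the sum can be
  taken pair by pair. A pair that is distinct modulo \<open>q\<close> survives for exactly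
  \<open>\<theta>\<close> squared choices. A colliding pair is charged as if only its first index
  mattered, which gives \<open>q * \<theta>\<close>.\<close>

lemma sum_card_pick_pairs:
  assumes "prime q" "odd q" "finite X"
  defines "\<theta> \<equiv> (real q + 1) / 2"
  shows "(\<Sum>ab\<in>{..<q} \<times> {..<q}. real (card (X \<inter> pick q (fst ab) (snd ab))) *
       (real (card (X \<inter> pick q (fst ab) (snd ab))) - 1))
    \<le> \<theta>\<^sup>2 * (real (card X) * (real (card X) - 1)) + real q * \<theta> * real (collisions X q)"
proof -
  let ?h = "card {x \<in> {..<q}. 2 * x \<le> q}"
  let ?I = "{..<q} \<times> {..<q}"
  let ?R = "\<lambda>ab. pick q (fst ab) (snd ab)"
  define V where "V = {(k, k') \<in> X \<times> X. k \<noteq> k'}"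
  have fO: "finite V" unfolding V_def by (rule finite_subset[of _ "X \<times> X"]) (use assms in auto)
  have h: "real ?h = \<theta>" unfolding \<theta>_def 
    by (rule real_card_half[OF assms(2)])
  have *: "(\<Sum>ab\<in>?I. of_bool (fst z \<in> ?R ab \<and> snd z \<in> ?R ab)) \<le>
      \<theta>\<^sup>2 + real q * \<theta> * of_bool (fst z mod q = snd z mod q)" for z
  proof (cases "fst z mod q = snd z mod q")
    case True
    have "(\<Sum>ab\<in>?I. of_bool (fst z \<in> ?R ab \<and> snd z \<in> ?R ab)) \<le> (\<Sum>ab\<in>?I. of_bool (fst z \<in> ?R ab) :: real)"
      by (intro sum_mono) auto
    also have "\<dots> = (\<Sum>ab\<in>?I. real (card ({fst z} \<inter> ?R ab)))" by (intro sum.cong) auto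
    also have "\<dots> = real q * \<theta>" using sum_card_pick[OF assms(1,2), of "{fst z}"] by (simp add: \<theta>_def)
    also have "\<dots> \<le> \<theta>\<^sup>2 + real q * \<theta> * of_bool (fst z mod q = snd z mod q)"
      using True by simp
    finally show ?thesis .
  next
    case False
    have "(\<Sum>ab\<in>?I. of_bool (fst z \<in> ?R ab \<and> snd z \<in> ?R ab)) =
        real (card {ab \<in> ?I. fst z \<in> ?R ab \<and> snd z \<in> ?R ab})"
      by (simp add: real_card_filter)
    also have "{ab \<in> ?I. fst z \<in> ?R ab \<and> snd z \<in> ?R ab} =
        {(a, b) \<in> ?I. fst z \<in> pick q a b \<and> snd z \<in> pick q a b}" by auto
    also have "real (card \<dots>) = \<theta>\<^sup>2" 
      by (simp only: card_pick_pair[OF assms(1) False] of_nat_power h)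
    also have "\<dots> = \<theta>\<^sup>2 + real q * \<theta> * of_bool (fst z mod q = snd z mod q)"
      using False by simp
    finally show ?thesis by (rule eq_refl)
  qed
  have "(\<Sum>ab\<in>?I. real (card (X \<inter> ?R ab)) * (real (card (X \<inter> ?R ab)) - 1)) =
     (\<Sum>ab\<in>?I. real (card {z \<in> V. fst z \<in> ?R ab \<and> snd z \<in> ?R ab}))"
  proof (rule sum.cong[OF refl])
    fix ab
    have "{(k, k') \<in> (X \<inter> ?R ab) \<times> (X \<inter> ?R ab). k \<noteq> k'} = {z \<in> V. fst z \<in> ?R ab \<and> snd z \<in> ?R ab}"
      by (auto simp: V_def)
    then show "real (card (X \<inter> ?R ab)) * (real (card (X \<inter> ?R ab)) - 1) =
       real (card {z \<in> V. fst z \<in> ?R ab \<and> snd z \<in> ?R ab})"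
      using card_off_diagonal[of "X \<inter> ?R ab"] assms(3) by simp
  qed
  also have "\<dots> = (\<Sum>ab\<in>?I. \<Sum>z\<in>V. of_bool (fst z \<in> ?R ab \<and> snd z \<in> ?R ab))"
    by (simp only: real_card_filter[OF fO])
  also have "\<dots> = (\<Sum>z\<in>V. \<Sum>ab\<in>?I. of_bool (fst z \<in> ?R ab \<and> snd z \<in> ?R ab))"
    by (rule sum.swap)
  also have "\<dots> \<le> (\<Sum>z\<in>V. \<theta>\<^sup>2 + real q * \<theta> * of_bool (fst z mod q = snd z mod q))"
    by (rule sum_mono) (rule *)
  also have "\<dots> = real (card V) * \<theta>\<^sup>2 + real q * \<theta> * real (card {z \<in> V. fst z mod q = snd z mod q})"
    by (simp add: sum.distrib sum_distrib_left[symmetric] real_card_filter[OF fO])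
  also have "{z \<in> V. fst z mod q = snd z mod q} = {(k, k') \<in> X \<times> X. k \<noteq> k' \<and> k mod q = k' mod q}"
    by (auto simp: V_def)
  also have "real (card V) = real (card X) * (real (card X) - 1)"
    unfolding V_def by (rule card_off_diagonal[OF assms(3)])
  finally show ?thesis by (simp add: collisions_def mult.commute)
qed

text \<open>Double counting: a fixed pair collides modulo exactly those primes of \<open>P\<close>
  that divide its difference, and this difference is nonzero with absolute value below
  \<open>2 ^ L\<close>.\<close>

lemma sum_collisions_le:
  assumes P: "finite P" "\<And>p. p \<in> P \<Longrightarrow> prime p" and X: "X \<subseteq> {..<2 ^ L}"
  shows "(\<Sum>q\<in>P. real (collisions X q)) \<le> real L * (real (card X) * (real (card X) - 1))"
proof -
  define V where "V = {(k, k') \<in> X \<times> X. k \<noteq> k'}"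
  have fX: "finite X" using X by (rule finite_subset) simp
  then have fO: "finite V" unfolding V_def by (auto intro: finite_subset[of _ "X \<times> X"])
  have "(\<Sum>q\<in>P. real (collisions X q)) = (\<Sum>q\<in>P. \<Sum>z\<in>V. of_bool (fst z mod q = snd z mod q))"
  proof (rule sum.cong[OF refl])
    fix q
    have "{(k, k') \<in> X \<times> X. k \<noteq> k' \<and> k mod q = k' mod q} = {z \<in> V. fst z mod q = snd z mod q}"
      by (auto simp: V_def)
    then show "real (collisions X q) = (\<Sum>z\<in>V. of_bool (fst z mod q = snd z mod q))"
      
      unfolding collisions_def by (simp only: real_card_filter[OF fO])
  qed
  also have "\<dots> = (\<Sum>z\<in>V. \<Sum>q\<in>P. of_bool (fst z mod q = snd z mod q))" by (rule sum.swap)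
  also have "\<dots> \<le> (\<Sum>z\<in>V. real L)"
  proof (rule sum_mono)
    fix z assume z: "z \<in> V"
    define m where "m = nat \<bar>int (fst z) - int (snd z)\<bar>"
    have m: "m > 0" "m < 2 ^ L"
    proof -
      have "fst z < 2 ^ L" "snd z < 2 ^ L" "fst z \<noteq> snd z" using z X by (auto simp: V_def)
      then show "m > 0" "m < 2 ^ L" unfolding m_def by linarith+
    qed
    have "(\<Sum>q\<in>P. of_bool (fst z mod q = snd z mod q)) = real (card {q \<in> P. fst z mod q = snd z mod q})"
      by (simp add: real_card_filter[OF P(1)])
    also have "{q \<in> P. fst z mod q = snd z mod q} = {q \<in> P. q dvd m}"
    proof -
      have "fst z mod q = snd z mod q \<longleftrightarrow> q dvd m" for q
      proof -
        have "int m = \<bar>int (fst z) - int (snd z)\<bar>" by (simp add: m_def)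
        then have "int q dvd int (fst z) - int (snd z) \<longleftrightarrow> q dvd m"
          by (metis dvd_abs_iff of_nat_dvd_iff)
        then show ?thesis by (simp add: mod_eq_iff_int_dvd_diff)
      qed
      then show ?thesis by simp
    qed
    also have "real (card \<dots>) \<le> real L" using card_prime_divisors_le[OF m P] by simp
    finally show "(\<Sum>q\<in>P. of_bool (fst z mod q = snd z mod q)) \<le> real L" .
  qed
  also have "\<dots> = real L * real (card V)" by simp
  also have "real (card V) = real (card X) * (real (card X) - 1)"
    unfolding V_def by (rule card_off_diagonal[OF fX])
  finally show ?thesis .
qed

section \<open>The isolation potential\<close>

text \<open>
  The coefficient \<open>s + j\<close> decreases by one with each halving; this absorbs the deviation of the hash
  functions from pairwise independence.
\<close>

definition isolation_potential :: "nat \<Rightarrow> nat \<Rightarrow> 'e set \<Rightarrow> ('e \<Rightarrow> nat set) \<Rightarrow> nat set \<Rightarrow> int" where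
  "isolation_potential s j E W S = (\<Sum>e\<in>E.
     int s * 2 ^ j * int (card (W e \<inter> S)) - int (s + j) * (int (card (W e \<inter> S)) * (int (card (W e \<inter> S)) - 1)))"

text \<open>A halving divides the linear term by about 2 and the quadratic term by about 4; this
  explains the factor 4 and the passage from \<open>2 ^ Suc j\<close> to \<open>2 ^ j\<close>. The
  mean is over a uniform prime and then over uniform coefficients, hence the division by the square
  of \<open>q\<close>. Assumption \<open>v\<close> says that two errors, the excess over one half
  and the collisions, fit into the unit by which the quadratic coefficient changes.\<close>

lemma potential_average_single:
  fixes s j L :: nat and M :: real
  assumes P: "finite P" "\<And>p. p \<in> P \<Longrightarrow> prime p \<and> odd p \<and> M \<le> real p" and M: "M \<ge> 1"
    and X: "X \<subseteq> {..<2 ^ L}"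
    and v: "real v * ((1 + 1 / M)\<^sup>2 * real (card P) + 2 * (1 + 1 / M) * real L) \<le> (real v + 1) * real (card P)"
  defines "d \<equiv> real (card X)"
    and "D \<equiv> (\<lambda>q ab. real (card (X \<inter> pick q (fst ab) (snd ab))))"
  shows "real (card P) * (real s * 2 ^ Suc j * d - (real v + 1) * (d * (d - 1))) \<le>
    (\<Sum>q\<in>P. (\<Sum>ab\<in>{..<q} \<times> {..<q}. 4 * (real s * 2 ^ j * D q ab - real v * (D q ab * (D q ab - 1)))) / (real q)\<^sup>2)"
proof -
  define c where "c = d * (d - 1)"
  have c0: "c \<ge> 0" unfolding c_def d_def by (cases "card X") auto
  have fX: "finite X" using X by (rule finite_subset) simp
  have each: "real s * 2 ^ Suc j * d - real v * ((1 + 1 / M)\<^sup>2 * c + 2 * (1 + 1 / M) * real (collisions X q))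
     \<le> (\<Sum>ab\<in>{..<q} \<times> {..<q}. 4 * (real s * 2 ^ j * D q ab - real v * (D q ab * (D q ab - 1)))) / (real q)\<^sup>2"
    if q: "q \<in> P" for q
  proof -
    have pq: "prime q" "odd q" "M \<le> real q" using P q by auto
    have q1: "real q \<ge> 1" using pq M by linarith
    have q2: "(real q)\<^sup>2 > 0" using q1 by simp
    define \<theta> where "\<theta> = (real q + 1) / 2"
    have "1 / real q \<le> 1 / M" using pq M by (intro divide_left_mono) auto
    moreover have "2 * \<theta> / real q = 1 + 1 / real q" "1 / real q \<ge> 0"
      using q1 by (auto simp: \<theta>_def field_simps)
    ultimately have t: "2 * \<theta> / real q \<le> 1 + 1 / M" "1 \<le> 2 * \<theta> / real q" by linarith+
    have t2: "4 * \<theta>\<^sup>2 / (real q)\<^sup>2 \<le> (1 + 1 / M)\<^sup>2"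
    proof -
      have "4 * \<theta>\<^sup>2 / (real q)\<^sup>2 = (2 * \<theta> / real q)\<^sup>2" by (simp add: power_divide power_mult_distrib)
      also have "\<dots> \<le> (1 + 1 / M)\<^sup>2" using t by (intro power_mono) auto
      finally show ?thesis .
    qed
    have S1: "(\<Sum>ab\<in>{..<q} \<times> {..<q}. D q ab) = real q * \<theta> * d"
      unfolding D_def \<theta>_def d_def using sum_card_pick[OF pq(1,2) fX] by simp
    have S2: "(\<Sum>ab\<in>{..<q} \<times> {..<q}. D q ab * (D q ab - 1)) \<le> \<theta>\<^sup>2 * c + real q * \<theta> * real (collisions X q)"
      unfolding D_def \<theta>_def d_def c_def using sum_card_pick_pairs[OF pq(1,2) fX] by simp
    have "(\<Sum>ab\<in>{..<q} \<times> {..<q}. 4 * (real s * 2 ^ j * D q ab - real v * (D q ab * (D q ab - 1)))) =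
      4 * (real s * 2 ^ j * (\<Sum>ab\<in>{..<q} \<times> {..<q}. D q ab) - real v * (\<Sum>ab\<in>{..<q} \<times> {..<q}. D q ab * (D q ab - 1)))"
      by (simp only: sum_distrib_left sum_subtractf[symmetric])
    also have "\<dots> \<ge> 4 * (real s * 2 ^ j * (real q * \<theta> * d) - real v * (\<theta>\<^sup>2 * c + real q * \<theta> * real (collisions X q)))"
      unfolding S1 using S2 by (intro mult_left_mono diff_left_mono) auto
    finally have "4 * (real s * 2 ^ j * (real q * \<theta> * d) - real v * (\<theta>\<^sup>2 * c + real q * \<theta> * real (collisions X q))) / (real q)\<^sup>2
       \<le> (\<Sum>ab\<in>{..<q} \<times> {..<q}. 4 * (real s * 2 ^ j * D q ab - real v * (D q ab * (D q ab - 1)))) / (real q)\<^sup>2"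
      by (rule divide_right_mono) simp
    moreover have "4 * (real s * 2 ^ j * (real q * \<theta> * d) - real v * (\<theta>\<^sup>2 * c + real q * \<theta> * real (collisions X q))) / (real q)\<^sup>2
      = real s * 2 ^ Suc j * d * (2 * \<theta> / real q) - real v * (4 * \<theta>\<^sup>2 / (real q)\<^sup>2 * c + 2 * (2 * \<theta> / real q) * real (collisions X q))"
      using q1 by (simp add: field_simps power2_eq_square)
    moreover have "real s * 2 ^ Suc j * d * 1 \<le> real s * 2 ^ Suc j * d * (2 * \<theta> / real q)"
      using t by (intro mult_left_mono) (auto simp: d_def)
    moreover have "real v * (4 * \<theta>\<^sup>2 / (real q)\<^sup>2 * c + 2 * (2 * \<theta> / real q) * real (collisions X q))
       \<le> real v * ((1 + 1 / M)\<^sup>2 * c + 2 * (1 + 1 / M) * real (collisions X q))"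
      using t t2 c0 by (intro mult_left_mono add_mono mult_right_mono) auto
    ultimately show ?thesis by linarith
  qed
  \<comment> \<open>Only the total over all primes is known to be small; a single prime may collide
    on every pair of \<open>X\<close>.\<close>
  have "(\<Sum>q\<in>P. real (collisions X q)) \<le> real L * c"
    unfolding c_def d_def using P X by (intro sum_collisions_le) auto
  then have "real v * ((1 + 1 / M)\<^sup>2 * c * real (card P) + 2 * (1 + 1 / M) * (\<Sum>q\<in>P. real (collisions X q)))
     \<le> real v * ((1 + 1 / M)\<^sup>2 * c * real (card P) + 2 * (1 + 1 / M) * (real L * c))"
    using M by (intro mult_left_mono add_left_mono) auto
  also have "\<dots> = c * (real v * ((1 + 1 / M)\<^sup>2 * real (card P) + 2 * (1 + 1 / M) * real L))"
    by (simp add: algebra_simps)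
  also have "\<dots> \<le> c * ((real v + 1) * real (card P))" using v c0 by (rule mult_left_mono)
  finally have "real (card P) * (real s * 2 ^ Suc j * d - (real v + 1) * c) \<le>
     real (card P) * (real s * 2 ^ Suc j * d)
     - real v * ((1 + 1 / M)\<^sup>2 * c * real (card P) + 2 * (1 + 1 / M) * (\<Sum>q\<in>P. real (collisions X q)))"
    by (simp add: algebra_simps)
  also have "\<dots> = (\<Sum>q\<in>P. real s * 2 ^ Suc j * d - real v * ((1 + 1 / M)\<^sup>2 * c + 2 * (1 + 1 / M) * real (collisions X q)))"
    by (simp only: sum_subtractf sum_distrib_left[symmetric] sum.distrib sum_constant) (simp add: algebra_simps)
  also have "\<dots> \<le> (\<Sum>q\<in>P. (\<Sum>ab\<in>{..<q} \<times> {..<q}. 4 * (real s * 2 ^ j * D q ab - real v * (D q ab * (D q ab - 1)))) / (real q)\<^sup>2)"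
    by (rule sum_mono) (rule each)
  finally show ?thesis unfolding c_def .
qed

text \<open>First-moment argument: if every choice lost potential, so would the average, contrary to
  \<open>potential_average_single\<close> summed over the entries. As the sum over \<open>E\<close>
  is taken before a choice is singled out, the same choice works for all entries.\<close>

lemma potential_step:
  fixes s j L :: nat and M :: real
  assumes P: "finite P" "P \<noteq> {}" "\<And>p. p \<in> P \<Longrightarrow> prime p \<and> odd p \<and> M \<le> real p" and M: "M \<ge> 1"
    and E: "finite E" and W: "\<And>e. e \<in> E \<Longrightarrow> W e \<inter> S \<subseteq> {..<2 ^ L}"
    and v: "real (s + j) * ((1 + 1 / M)\<^sup>2 * real (card P) + 2 * (1 + 1 / M) * real L) \<le> (real (s + j) + 1) * real (card P)"
  shows "\<exists>q\<in>P. \<exists>a<q. \<exists>b<q. isolation_potential s (Suc j) E W S \<le> 4 * isolation_potential s j E W (S \<inter> pick q a b)"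
proof (rule ccontr)
  assume neg: "\<not> ?thesis"
  let ?d = "\<lambda>e. real (card (W e \<inter> S))"
  let ?D = "\<lambda>e q ab. real (card (W e \<inter> S \<inter> pick q (fst ab) (snd ab)))"
  let ?F = "\<lambda>e q ab. 4 * (real s * 2 ^ j * ?D e q ab - real (s + j) * (?D e q ab * (?D e q ab - 1)))"
  define \<Psi> where "\<Psi> = real_of_int (isolation_potential s (Suc j) E W S)"
  have Psi: "\<Psi> = (\<Sum>e\<in>E. real s * 2 ^ Suc j * ?d e - (real (s + j) + 1) * (?d e * (?d e - 1)))"
    by (simp add: \<Psi>_def isolation_potential_def add_ac)
  have lt: "(\<Sum>e\<in>E. ?F e q ab) < \<Psi>" if "q \<in> P" "ab \<in> {..<q} \<times> {..<q}" for q ab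
  proof -
    have "4 * isolation_potential s j E W (S \<inter> pick q (fst ab) (snd ab)) < isolation_potential s (Suc j) E W S"
      using neg that by (force simp: not_le)
    then have "real_of_int (4 * isolation_potential s j E W (S \<inter> pick q (fst ab) (snd ab))) < \<Psi>"
      unfolding \<Psi>_def by (simp only: of_int_less_iff)
    also have "real_of_int (4 * isolation_potential s j E W (S \<inter> pick q (fst ab) (snd ab))) = (\<Sum>e\<in>E. ?F e q ab)"
      by (simp add: isolation_potential_def sum_distrib_left Int_assoc)
    finally show ?thesis .
  qed
  have q0: "q > 0" if "q \<in> P" for q using P(3) that by (auto simp: prime_gt_0_nat)
  have "real (card P) * \<Psi> = (\<Sum>e\<in>E. real (card P) * (real s * 2 ^ Suc j * ?d e - (real (s + j) + 1) * (?d e * (?d e - 1))))"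
    unfolding Psi by (rule sum_distrib_left)
  also have "\<dots> \<le> (\<Sum>e\<in>E. \<Sum>q\<in>P. (\<Sum>ab\<in>{..<q} \<times> {..<q}. ?F e q ab) / (real q)\<^sup>2)"
    by (rule sum_mono) (use potential_average_single[OF P(1,3) M W v] in auto)
  also have "\<dots> = (\<Sum>q\<in>P. \<Sum>e\<in>E. (\<Sum>ab\<in>{..<q} \<times> {..<q}. ?F e q ab) / (real q)\<^sup>2)"
    by (rule sum.swap)
  also have "\<dots> = (\<Sum>q\<in>P. (\<Sum>ab\<in>{..<q} \<times> {..<q}. \<Sum>e\<in>E. ?F e q ab) / (real q)\<^sup>2)"
    by (rule sum.cong[OF refl]) (subst sum.swap, rule sum_divide_distrib[symmetric])
  also have "\<dots> < (\<Sum>q\<in>P. \<Psi>)"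
  proof (rule sum_strict_mono[OF P(1,2)])
    fix q assume q: "q \<in> P"
    have "(\<Sum>ab\<in>{..<q} \<times> {..<q}. \<Sum>e\<in>E. ?F e q ab) < (\<Sum>ab\<in>{..<q} \<times> {..<q}. \<Psi>)"
      using q0[OF q] by (intro sum_strict_mono lt q) auto
    also have "\<dots> = (real q)\<^sup>2 * \<Psi>" by (simp add: card_cartesian_product power2_eq_square)
    finally show "(\<Sum>ab\<in>{..<q} \<times> {..<q}. \<Sum>e\<in>E. ?F e q ab) / (real q)\<^sup>2 < \<Psi>"
      using q0[OF q] by (simp add: divide_less_eq mult.commute)
  qed
  also have "\<dots> = real (card P) * \<Psi>" by simp
  finally show False by simp
qed

text \<open>The relative error, multiplied by \<open>s + j\<close>, must not exceed 1. Restricting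
  to primes from \<open>32 * L\<close> on bounds the error of the excess by 3/(32 L), and having 32
  L^2 such primes bounds that of the collisions by the same amount. With
  \<open>s + j \<le> 5 * L\<close> the total is at most 30/32. The range up to
  \<open>(16 * L) ^ 3\<close> is large enough to contain that many primes.\<close>

lemma exists_pick:
  fixes s j L :: nat
  assumes L: "L \<ge> 1" and sj: "s + j \<le> 5 * L"
    and E: "finite E" and W: "\<And>e. e \<in> E \<Longrightarrow> W e \<inter> S \<subseteq> {..<2 ^ L}"
  shows "\<exists>q\<le>(16 * L) ^ 3. \<exists>a<q. \<exists>b<q. isolation_potential s (Suc j) E W S \<le> 4 * isolation_potential s j E W (S \<inter> pick q a b)"
proof -
  define Q where "Q = (16 * L) ^ 3"
  define A where "A = {p::nat. prime p \<and> p \<le> Q}"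
  define P where "P = {p \<in> A. 32 * L \<le> p}"
  have fA: "finite A" by (auto simp: A_def)
  then have fP: "finite P" by (auto simp: P_def)
  have "Q \<le> 1 + 3 * (16 * L) * card A"
    unfolding Q_def A_def using L by (intro many_primes_le_cube) auto
  moreover have "card A \<le> card P + 32 * L"
  proof -
    have "A \<subseteq> P \<union> {..<32 * L}" by (auto simp: P_def)
    then have "card A \<le> card (P \<union> {..<32 * L})" by (intro card_mono) (auto simp: fP)
    also have "\<dots> \<le> card P + 32 * L" using card_Un_le[of P "{..<32 * L}"] by simp
    finally show ?thesis .
  qed
  \<comment> \<open>The prime count up to \<open>Q = 4096 * L ^ 3\<close>, with at most
    \<open>32 * L\<close> primes given up for being too small.\<close>
  ultimately have "4096 * L ^ 3 \<le> 1 + 48 * L * (card P + 32 * L)"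
    unfolding Q_def by (simp add: power_mult_distrib) (meson add_left_mono le_trans mult_le_mono2 Suc_le_mono)
  then have "48 * L * (32 * L\<^sup>2) \<le> 48 * L * card P"
  proof -
    have "L\<^sup>2 \<le> L ^ 3" "1 \<le> L ^ 3" using L by (auto intro: power_increasing)
    moreover have "48 * L * (32 * L) = 1536 * L\<^sup>2" "48 * L * (32 * L\<^sup>2) = 1536 * L ^ 3"
      by (simp_all add: power2_eq_square power3_eq_cube)
    ultimately have "1 + 48 * L * (32 * L) + 48 * L * (32 * L\<^sup>2) \<le> 4096 * L ^ 3" by linarith
    with \<open>4096 * L ^ 3 \<le> _\<close> show ?thesis unfolding distrib_left by linarith
  qed
  then have cP: "32 * L\<^sup>2 \<le> card P" using L by simp
  have neP: "P \<noteq> {}" using cP L by auto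
  define M where "M = 32 * real L"
  have M: "M \<ge> 32" unfolding M_def using L by simp
  have prP: "prime p \<and> odd p \<and> M \<le> real p" if "p \<in> P" for p
  proof -
    have p: "prime p" "32 * L \<le> p" using that by (auto simp: P_def A_def)
    then have "p > 2" using L by linarith
    with p show ?thesis unfolding M_def using prime_odd_nat by (auto simp flip: of_nat_mult)
  qed
  have v: "real (s + j) * ((1 + 1 / M)\<^sup>2 * real (card P) + 2 * (1 + 1 / M) * real L) \<le> (real (s + j) + 1) * real (card P)"
  proof -
    define c where "c = real (card P)"
    have c: "32 * (real L)\<^sup>2 \<le> c" unfolding c_def using cP by (simp flip: of_nat_power of_nat_mult)
    have L1: "real L \<ge> 1" using L by simp
    have c0: "c \<ge> 0" by (simp add: c_def)
    have iM: "1 / M \<le> 1 / 32" "1 / M > 0" using M by (auto simp: field_simps)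
    have a: "(1 + 1 / M)\<^sup>2 \<le> 1 + 3 * (1 / M)"
    proof -
      have "(1 / M) * (1 / M) \<le> 1 * (1 / M)" using iM by (intro mult_right_mono) auto
      then show ?thesis by (simp add: power2_eq_square algebra_simps)
    qed
    have b: "2 * (1 + 1 / M) * real L \<le> 3 * (1 / M) * c"
    proof -
      have "2 * (1 + 1 / M) * real L \<le> 3 * real L" using iM by (intro mult_right_mono) auto
      also have "\<dots> = 3 * (1 / M) * (32 * (real L)\<^sup>2)" using L1 by (simp add: M_def power2_eq_square)
      also have "\<dots> \<le> 3 * (1 / M) * c" using c iM by (intro mult_left_mono) auto
      finally show ?thesis .
    qed
    have "real (s + j) * ((1 + 1 / M)\<^sup>2 * c + 2 * (1 + 1 / M) * real L)
      \<le> real (s + j) * ((1 + 3 * (1 / M)) * c + 3 * (1 / M) * c)"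
      using a b c0 by (intro mult_left_mono add_mono mult_right_mono) auto
    also have "\<dots> = real (s + j) * c + real (s + j) * (6 * (1 / M)) * c" by (simp add: algebra_simps)
    also have "real (s + j) * (6 * (1 / M)) \<le> real (5 * L) * (6 * (1 / M))"
      using sj iM by (intro mult_right_mono) auto
    also have "\<dots> \<le> 1" using L1 by (simp add: M_def)
    finally have "real (s + j) * ((1 + 1 / M)\<^sup>2 * c + 2 * (1 + 1 / M) * real L) \<le> real (s + j) * c + 1 * c"
      using c0 by (simp add: mult_right_mono)
    then show ?thesis by (simp add: c_def algebra_simps)
  qed
  have M1: "M \<ge> 1" using M by simp
  have "\<exists>q\<in>P. \<exists>a<q. \<exists>b<q. isolation_potential s (Suc j) E W S \<le> 4 * isolation_potential s j E W (S \<inter> pick q a b)"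
    by (rule potential_step[where M = M and L = L]; fact fP neP prP M1 E W v)
  then obtain q a b where q: "q \<in> P" "a < q" "b < q"
    "isolation_potential s (Suc j) E W S \<le> 4 * isolation_potential s j E W (S \<inter> pick q a b)"
    by blast
  moreover have "q \<le> (16 * L) ^ 3" using q(1) by (auto simp: P_def A_def Q_def)
  ultimately show ?thesis by blast
qed

text \<open>Let \<mu> be the number of witnesses of an entry divided by \<open>2 ^ (s + 3)\<close>;
  it lies between 1/8 and 1/4. The entry contributes at least (s + 3) 4^(s + 3) times \<mu> - 2
  \<mu>^2, and the minimum of this parabola on the interval is 3/32, at \<mu> = 1/8. The three extra
  halvings are due to the quadratic coefficient, which starts at twice the linear one: near \<mu> =
  1/2 the bound would vanish.\<close>

lemma isolation_potential_initial:
  fixes s :: nat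
  assumes E: "\<And>e. e \<in> E \<Longrightarrow> 2 ^ s \<le> card (W e) \<and> card (W e) < 2 ^ Suc s" and S: "\<And>e. e \<in> E \<Longrightarrow> W e \<subseteq> S"
  shows "3 * int (s + 3) * 4 ^ (s + 3) * int (card E) \<le> 32 * isolation_potential (s + 3) (s + 3) E W S"
proof -
  have "3 * int (s + 3) * 4 ^ (s + 3) \<le> 32 * (int (s + 3) * 2 ^ (s + 3) * int (card (W e \<inter> S))
     - int (s + 3 + (s + 3)) * (int (card (W e \<inter> S)) * (int (card (W e \<inter> S)) - 1)))" if e: "e \<in> E" for e
  proof -
    define d where "d = int (card (W e \<inter> S))"
    define p :: int where "p = 2 ^ s"
    have WS: "W e \<inter> S = W e" using S[OF e] by blast
    have "p = int (2 ^ s)" "2 * p = int (2 ^ Suc s)" by (simp_all add: p_def)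
    then have d: "p \<le> d" "d < 2 * p" unfolding d_def WS using E[OF e] by (simp_all only: of_nat_le_iff of_nat_less_iff)
    have p0: "p \<ge> 1" by (simp add: p_def)
    \<comment> \<open>On the interval from \<open>p\<close> to \<open>2 * p\<close> the square of
      \<open>d\<close> lies below its chord, which is linear in \<open>d\<close>.\<close>
    have "0 \<le> (d - p) * (2 * p - d)" using d by (intro mult_nonneg_nonneg) auto
    then have dd: "d * d \<le> 3 * p * d - 2 * p * p" by (simp add: algebra_simps)
    have "192 * (p * p) \<le> 256 * (p * d) - 64 * (d * (d - 1))"
    proof -
      have "64 * (d * (d - 1)) \<le> 64 * (3 * p * d - 2 * p * p)" using dd d p0 by (simp add: algebra_simps)
      moreover have "p * p \<le> p * d" using d p0 by (intro mult_left_mono) auto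
      ultimately show ?thesis by (simp add: algebra_simps)
    qed
    then have "int (s + 3) * (192 * (p * p)) \<le> int (s + 3) * (256 * (p * d) - 64 * (d * (d - 1)))"
      by (intro mult_left_mono) auto
    moreover have "(4::int) ^ (s + 3) = 64 * (p * p)"
      by (simp add: p_def power_add flip: power_mult_distrib)
    moreover have "(2::int) ^ (s + 3) = 8 * p" by (simp add: p_def power_add)
    ultimately show ?thesis unfolding d_def[symmetric] by (simp add: algebra_simps)
  qed
  then have "(\<Sum>e\<in>E. 3 * int (s + 3) * 4 ^ (s + 3)) \<le> (\<Sum>e\<in>E. 32 * (int (s + 3) * 2 ^ (s + 3) * int (card (W e \<inter> S))
     - int (s + 3 + (s + 3)) * (int (card (W e \<inter> S)) * (int (card (W e \<inter> S)) - 1))))"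
    by (rule sum_mono)
  then show ?thesis unfolding isolation_potential_def sum_distrib_left by (simp add: mult_ac)
qed

text \<open>At \<open>j = 0\<close> the linear and the quadratic coefficient are both
  \<open>s\<close>, so dividing by \<open>s\<close> leaves the truncated inclusion-exclusion for the
  number of isolated entries.\<close>

lemma isolation_potential_final:
  assumes "finite E" "s > 0" and "3 * int s * int (card E) \<le> 32 * isolation_potential s 0 E W S"
  shows "3 * card E \<le> 32 * card {e \<in> E. card (W e \<inter> S) = 1}"
proof -
  have "isolation_potential s 0 E W S \<le> (\<Sum>e\<in>E. int s * of_bool (card (W e \<inter> S) = 1))"
    unfolding isolation_potential_def
  proof (rule sum_mono)
    fix e
    define d where "d = int (card (W e \<inter> S))"
    have "d - d * (d - 1) \<le> of_bool (d = 1)"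
    proof (cases "d \<le> 1")
      case True
      then have "d = 0 \<or> d = 1" unfolding d_def by linarith
      then show ?thesis by auto
    next
      case False
      then have "d * 1 \<le> d * (d - 1)" by (intro mult_left_mono) auto
      then show ?thesis by simp
    qed
    then have "int s * (d - d * (d - 1)) \<le> int s * of_bool (d = 1)" by (intro mult_left_mono) auto
    then show "int s * 2 ^ 0 * int (card (W e \<inter> S)) - int (s + 0) * (int (card (W e \<inter> S)) * (int (card (W e \<inter> S)) - 1))
      \<le> int s * of_bool (card (W e \<inter> S) = 1)"
      unfolding d_def by (simp add: right_diff_distrib)
  qed
  also have "\<dots> = int s * int (card {e \<in> E. card (W e \<inter> S) = 1})"
    using assms(1) by (simp add: sum_distrib_left[symmetric] Int_def)
  finally have "int s * (3 * int (card E)) \<le> int s * (32 * int (card {e \<in> E. card (W e \<inter> S) = 1}))"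
    using assms(3) by simp
  then show ?thesis using assms(2) by simp
qed

section \<open>A program logic with running times\<close>

declare One_nat_def [simp del]

text \<open>Allows a multiplication program with its own word bound to run inside a program that
  uses longer words.\<close>

lemma exec_mono: "exec w p s t s' \<Longrightarrow> w \<le> w' \<Longrightarrow> exec w' p s t s'"
  by (induction rule: exec.induct) (auto intro: exec.intros)

lemma reg_set_reg [simp]: "reg (set_reg s r v) r' = (if r' = r then v else reg s r')"
  and mem_set_reg [simp]: "mem (set_reg s r v) = mem s"
  and reg_set_mem [simp]: "reg (set_mem s a x v) = reg s"
  and mem_set_mem [simp]: "mem (set_mem s a x v) a' = (if a' = a then (mem s a)(x := v) else mem s a')"
  by (auto simp: set_reg_def set_mem_def)

text \<open>
  Registers below 50 and memories below 13 are the variables of a program. Higher registers hold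
  intermediate values, and a shifted multiplication program uses registers from 100 on and
  memories from 10 on, so that 10, 11 and 12 pass its arguments and its result.
\<close>

definition low :: "state \<Rightarrow> state" where
  "low s = \<lparr>reg = (\<lambda>r. if r < 50 then reg s r else 0), mem = (\<lambda>a. if a < 13 then mem s a else (\<lambda>_. 0))\<rparr>"

lemma reg_low [simp]: "reg (low s) r = (if r < 50 then reg s r else 0)"
  and mem_low [simp]: "mem (low s) a = (if a < 13 then mem s a else (\<lambda>_. 0))"
  by (simp_all add: low_def)

lemma low_eqI: "(\<And>r. r < 50 \<Longrightarrow> reg s r = reg s' r) \<Longrightarrow> (\<And>a. a < 13 \<Longrightarrow> mem s a = mem s' a) \<Longrightarrow> low s = low s'"
  by (simp add: low_def fun_eq_iff)

lemma low_set_reg: "r < 50 \<Longrightarrow> low (set_reg s r v) = set_reg (low s) r v"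
  by (auto simp: low_def set_reg_def fun_eq_iff)

lemma low_set_mem: "a < 13 \<Longrightarrow> low (set_mem s a x v) = set_mem (low s) a x v"
  by (auto simp: low_def set_mem_def fun_eq_iff)

lemma low_set_reg_high: "50 \<le> r \<Longrightarrow> low (set_reg s r v) = low s"
  by (rule low_eqI) auto

text \<open>The number \<open>t\<close> is a clock reading at the start, and \<open>Q\<close>
  receives the reading at the end, so time bounds compose along with the assertions. Quantifying
  over all states with the given \<open>low\<close> part makes every rule independent of the
  contents of scratch registers.\<close>

definition wp :: "int \<Rightarrow> com \<Rightarrow> (state \<Rightarrow> nat \<Rightarrow> bool) \<Rightarrow> state \<Rightarrow> nat \<Rightarrow> bool" where
  "wp w p Q \<sigma> t \<longleftrightarrow> (\<forall>s. low s = \<sigma> \<longrightarrow> (\<exists>u s'. exec w p s u s' \<and> Q (low s') (t + u)))"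

lemma wp_Skip: "Q \<sigma> (t + 1) \<Longrightarrow> wp w Skip Q \<sigma> t"
  unfolding wp_def by (blast intro: exec.intros)

lemma wp_Seq: "wp w p (wp w q Q) \<sigma> t \<Longrightarrow> wp w (Seq p q) Q \<sigma> t"
  unfolding wp_def by (metis add.assoc exec.Seq)

subsection \<open>Expressions\<close>

datatype expr = V nat | N int | Op arith expr expr | Rd nat expr

fun ev :: "expr \<Rightarrow> state \<Rightarrow> int" where
  "ev (V r) s = reg s r"
| "ev (N c) s = c"
| "ev (Op f a b) s = arith_val f (ev a s) (ev b s)"
| "ev (Rd a e) s = mem s a (ev e s)"

text \<open>Mirrors where the machine can get stuck: constants and arithmetic results must be words,
  whereas values that are read are not checked. The restriction to variables makes evaluation a
  function of the \<open>low\<close> part.\<close>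

fun defined :: "int \<Rightarrow> expr \<Rightarrow> state \<Rightarrow> bool" where
  "defined w (V r) s \<longleftrightarrow> r < 50"
| "defined w (N c) s \<longleftrightarrow> \<bar>c\<bar> \<le> w"
| "defined w (Op f a b) s \<longleftrightarrow> defined w a s \<and> defined w b s \<and> \<bar>arith_val f (ev a s) (ev b s)\<bar> \<le> w"
| "defined w (Rd a e) s \<longleftrightarrow> a < 13 \<and> defined w e s"

fun cost :: "expr \<Rightarrow> nat" where
  "cost (V r) = 1"
| "cost (N c) = 1"
| "cost (Op f a b) = cost a + (cost b + 1)"
| "cost (Rd a e) = cost e + 1"

text \<open>The second component names the register that holds the value, either a variable, which
  is not copied, or \<open>t\<close>. A right operand is evaluated in scratch registers above
  \<open>t\<close>.\<close>

fun compile :: "expr \<Rightarrow> nat \<Rightarrow> com \<times> nat" where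
  "compile (V r) t = (Skip, r)"
| "compile (N c) t = (Const t c, t)"
| "compile (Op f a b) t =
    (Seq (fst (compile a t)) (Seq (fst (compile b (Suc t))) (Arith t f (snd (compile a t)) (snd (compile b (Suc t))))), t)"
| "compile (Rd a e) t = (Seq (fst (compile e t)) (Load t a (snd (compile e t))), t)"

lemma compile_result: "defined w e s \<Longrightarrow> snd (compile e t) < 50 \<or> snd (compile e t) = t"
  by (cases e) auto

lemma exec_compile:
  assumes "defined w e (low s)" "50 \<le> t"
  shows "\<exists>s'. exec w (fst (compile e t)) s (cost e) s' \<and> reg s' (snd (compile e t)) = ev e (low s) \<and>
    (\<forall>r<t. reg s' r = reg s r) \<and> mem s' = mem s"
  using assms
proof (induction e arbitrary: s t)
  case (V r)
  then show ?case by (auto intro: exec.intros)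
next
  case (N c)
  then have "exec w (Const t c) s 1 (set_reg s t c)" by (auto intro: exec.intros)
  then show ?case by fastforce
next
  case (Op f a b)
  from Op.IH(1)[of s t] Op.prems obtain s1 where
    s1: "exec w (fst (compile a t)) s (cost a) s1" "reg s1 (snd (compile a t)) = ev a (low s)"
      "\<forall>r<t. reg s1 r = reg s r" "mem s1 = mem s" by auto
  have l1: "low s1 = low s" using s1 Op.prems by (intro low_eqI) auto
  from Op.IH(2)[of s1 "Suc t"] Op.prems l1 obtain s2 where
    s2: "exec w (fst (compile b (Suc t))) s1 (cost b) s2" "reg s2 (snd (compile b (Suc t))) = ev b (low s)"
      "\<forall>r<Suc t. reg s2 r = reg s1 r" "mem s2 = mem s1" by auto
  \<comment> \<open>The value of \<open>a\<close> sits below \<open>Suc t\<close>, so the evaluation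
    of \<open>b\<close>, which starts at \<open>Suc t\<close>, preserves it.\<close>
  have "snd (compile a t) < Suc t" using compile_result[of w a "low s" t] Op.prems by auto
  then have r: "reg s2 (snd (compile a t)) = ev a (low s)" using s1 s2 by simp
  have "exec w (Arith t f (snd (compile a t)) (snd (compile b (Suc t)))) s2 1
    (set_reg s2 t (arith_val f (ev a (low s)) (ev b (low s))))"
    using Op.prems r s2 by (intro exec.Arith) auto
  then have "exec w (fst (compile (Op f a b) t)) s (cost (Op f a b)) (set_reg s2 t (arith_val f (ev a (low s)) (ev b (low s))))"
    using s1 s2 by (auto intro!: exec.Seq)
  then show ?case using s1 s2
    by (intro exI[of _ "set_reg s2 t (arith_val f (ev a (low s)) (ev b (low s)))"] conjI) auto
next
  case (Rd a e)
  have "defined w e (low s)" using Rd.prems by simp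
  from Rd.IH[OF this Rd.prems(2)] obtain s1 where
    s1: "exec w (fst (compile e t)) s (cost e) s1" "reg s1 (snd (compile e t)) = ev e (low s)"
      "\<forall>r<t. reg s1 r = reg s r" "mem s1 = mem s" by auto
  have "exec w (fst (compile (Rd a e) t)) s (cost (Rd a e)) (set_reg s1 t (mem s1 a (reg s1 (snd (compile e t)))))"
    using exec.Seq[OF s1(1) exec.Load] by simp
  then show ?case using s1 Rd.prems
    by (intro exI[of _ "set_reg s1 t (mem s1 a (reg s1 (snd (compile e t))))"] conjI) auto
qed

lemma exec_compile2:
  assumes "defined w a (low s)" "defined w b (low s)"
  shows "\<exists>s'. exec w (Seq (fst (compile a 50)) (fst (compile b 51))) s (cost a + cost b) s' \<and>
    reg s' (snd (compile a 50)) = ev a (low s) \<and> reg s' (snd (compile b 51)) = ev b (low s) \<and>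
    low s' = low s"
proof -
  from exec_compile[OF assms(1), of 50] obtain s1 where
    s1: "exec w (fst (compile a 50)) s (cost a) s1" "reg s1 (snd (compile a 50)) = ev a (low s)"
      "\<forall>r<50. reg s1 r = reg s r" "mem s1 = mem s" by auto
  have l1: "low s1 = low s" using s1 by (intro low_eqI) auto
  from exec_compile[of w b s1 51] assms l1 obtain s2 where
    s2: "exec w (fst (compile b 51)) s1 (cost b) s2" "reg s2 (snd (compile b 51)) = ev b (low s)"
      "\<forall>r<51. reg s2 r = reg s1 r" "mem s2 = mem s1" by auto
  have "low s2 = low s1" using s2 by (intro low_eqI) auto
  moreover have "snd (compile a 50) < 51" using compile_result[OF assms(1), of 50] by auto
  then have "reg s2 (snd (compile a 50)) = ev a (low s)" using s1 s2 by simp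
  moreover have "exec w (Seq (fst (compile a 50)) (fst (compile b 51))) s (cost a + cost b) s2"
    using s1(1) s2(1) by (rule exec.Seq)
  ultimately show ?thesis using s2(2) l1 by metis
qed

text \<open>The machine has no move instruction, so the value is copied by adding a zero held in
  register 51. An assignment therefore gets stuck unless its value is a word. This is the origin of
  the extra bound in \<open>wp_Asg\<close>, which matters for values read from memory.\<close>

definition Asg :: "nat \<Rightarrow> expr \<Rightarrow> com" where
  "Asg r e = Seq (fst (compile e 50)) (Seq (Const 51 0) (Arith r Add (snd (compile e 50)) 51))"

definition Wr :: "nat \<Rightarrow> expr \<Rightarrow> expr \<Rightarrow> com" where
  "Wr a x e = Seq (Seq (fst (compile x 50)) (fst (compile e 51))) (Store a (snd (compile x 50)) (snd (compile e 51)))"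

definition Cond :: "expr \<Rightarrow> expr \<Rightarrow> com \<Rightarrow> com \<Rightarrow> com" where
  "Cond x y p q = Seq (Seq (fst (compile x 50)) (fst (compile y 51)))
     (If_less (snd (compile x 50)) (snd (compile y 51)) p q)"

definition For :: "nat \<Rightarrow> nat \<Rightarrow> com \<Rightarrow> com" where
  "For v b p = Seq (Const v 0) (While_less v b (Seq p (Seq (Const 50 1) (Arith v Add v 50))))"

lemma wp_Asg:
  assumes "r < 50" "defined w e \<sigma>" "\<bar>ev e \<sigma>\<bar> \<le> w" "Q (set_reg \<sigma> r (ev e \<sigma>)) (t + (cost e + 2))"
  shows "wp w (Asg r e) Q \<sigma> t"
  unfolding wp_def
proof (intro allI impI)
  fix s assume s: "low s = \<sigma>"
  from exec_compile[of w e s 50] assms s obtain s1 where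
    s1: "exec w (fst (compile e 50)) s (cost e) s1" "reg s1 (snd (compile e 50)) = ev e \<sigma>"
      "\<forall>r<50. reg s1 r = reg s r" "mem s1 = mem s" by auto
  have w: "0 \<le> w" using assms(3) by linarith
  define s2 where "s2 = set_reg s1 51 0"
  have "snd (compile e 50) \<noteq> 51" using compile_result[OF assms(2), of 50] by auto
  then have "exec w (Arith r Add (snd (compile e 50)) 51) s2 1 (set_reg s2 r (ev e \<sigma>))"
    using assms s1 w by (intro exec.Arith) (auto simp: s2_def)
  moreover have "exec w (Const 51 0) s1 1 s2"
    unfolding s2_def using w by (intro exec.Const) auto
  ultimately have "exec w (Seq (Const 51 0) (Arith r Add (snd (compile e 50)) 51)) s1 (1 + 1) (set_reg s2 r (ev e \<sigma>))"
    by (intro exec.Seq)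
  with s1(1) have "exec w (Asg r e) s (cost e + (1 + 1)) (set_reg s2 r (ev e \<sigma>))"
    unfolding Asg_def by (rule exec.Seq)
  moreover have "low (set_reg s2 r (ev e \<sigma>)) = set_reg \<sigma> r (ev e \<sigma>)"
    unfolding s[symmetric] low_set_reg[OF assms(1)] using s1 by (auto simp: s2_def intro!: arg_cong[where f = "\<lambda>s. set_reg s r _"] low_eqI)
  ultimately show "\<exists>u s'. exec w (Asg r e) s u s' \<and> Q (low s') (t + u)"
    using assms(4) by (metis one_add_one)
qed

lemma wp_Wr:
  assumes "a < 13" "defined w x \<sigma>" "defined w e \<sigma>"
    "Q (set_mem \<sigma> a (ev x \<sigma>) (ev e \<sigma>)) (t + (cost x + cost e + 1))"
  shows "wp w (Wr a x e) Q \<sigma> t"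
  unfolding wp_def
proof (intro allI impI)
  fix s assume s: "low s = \<sigma>"
  from exec_compile2[of w x s e] assms s obtain s1 where
    s1: "exec w (Seq (fst (compile x 50)) (fst (compile e 51))) s (cost x + cost e) s1"
      "reg s1 (snd (compile x 50)) = ev x \<sigma>" "reg s1 (snd (compile e 51)) = ev e \<sigma>" "low s1 = \<sigma>" by auto
  have "exec w (Wr a x e) s (cost x + cost e + 1) (set_mem s1 a (ev x \<sigma>) (ev e \<sigma>))"
    unfolding Wr_def using s1 by (metis exec.Seq exec.Store)
  then show "\<exists>u s'. exec w (Wr a x e) s u s' \<and> Q (low s') (t + u)"
    using assms(1,4) s1(4) low_set_mem by metis
qed

lemma wp_Cond:
  assumes "defined w x \<sigma>" "defined w y \<sigma>"
    "ev x \<sigma> < ev y \<sigma> \<Longrightarrow> wp w p Q \<sigma> (t + (cost x + cost y + 1))"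
    "\<not> ev x \<sigma> < ev y \<sigma> \<Longrightarrow> wp w q Q \<sigma> (t + (cost x + cost y + 1))"
  shows "wp w (Cond x y p q) Q \<sigma> t"
  unfolding wp_def
proof (intro allI impI)
  fix s assume s: "low s = \<sigma>"
  from exec_compile2[of w x s y] assms s obtain s1 where
    s1: "exec w (Seq (fst (compile x 50)) (fst (compile y 51))) s (cost x + cost y) s1"
      "reg s1 (snd (compile x 50)) = ev x \<sigma>" "reg s1 (snd (compile y 51)) = ev y \<sigma>" "low s1 = \<sigma>" by auto
  have "\<exists>u s'. exec w (If_less (snd (compile x 50)) (snd (compile y 51)) p q) s1 (u + 1) s' \<and>
      Q (low s') (t + (cost x + cost y + 1) + u)"
  proof (cases "ev x \<sigma> < ev y \<sigma>")
    case True
    with assms(3) s1(4) obtain u s' where "exec w p s1 u s'" "Q (low s') (t + (cost x + cost y + 1) + u)"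
      unfolding wp_def by blast
    then show ?thesis using True s1 by (metis exec.If_true)
  next
    case False
    with assms(4) s1(4) obtain u s' where "exec w q s1 u s'" "Q (low s') (t + (cost x + cost y + 1) + u)"
      unfolding wp_def by blast
    then show ?thesis using False s1 by (metis exec.If_false)
  qed
  then obtain u s' where us: "exec w (If_less (snd (compile x 50)) (snd (compile y 51)) p q) s1 (u + 1) s'"
      "Q (low s') (t + (cost x + cost y + 1) + u)" by blast
  have "exec w (Cond x y p q) s (cost x + cost y + (u + 1)) s'"
    unfolding Cond_def using s1(1) us(1) by (rule exec.Seq)
  moreover have "t + (cost x + cost y + 1) + u = t + (cost x + cost y + (u + 1))" by simp
  ultimately show "\<exists>u s'. exec w (Cond x y p q) s u s' \<and> Q (low s') (t + u)"
    using us(2) by metis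
qed

subsection \<open>Loops\<close>

definition agree :: "nat set \<Rightarrow> nat set \<Rightarrow> state \<Rightarrow> state \<Rightarrow> bool" where
  "agree Rs Ms s s' \<longleftrightarrow> (\<forall>r. r \<notin> Rs \<longrightarrow> reg s' r = reg s r) \<and> (\<forall>a. a \<notin> Ms \<longrightarrow> mem s' a = mem s a)"

lemma agree_refl [simp]: "agree Rs Ms s s"
  by (simp add: agree_def)

lemma agree_reg: "agree Rs Ms s s' \<Longrightarrow> r \<notin> Rs \<Longrightarrow> reg s' r = reg s r"
  and agree_mem: "agree Rs Ms s s' \<Longrightarrow> a \<notin> Ms \<Longrightarrow> mem s' a = mem s a"
  by (simp_all add: agree_def)

lemma agree_set_reg: "agree Rs Ms s s' \<Longrightarrow> r \<in> Rs \<Longrightarrow> agree Rs Ms s (set_reg s' r v)"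
  and agree_set_mem: "agree Rs Ms s s' \<Longrightarrow> a \<in> Ms \<Longrightarrow> agree Rs Ms s (set_mem s' a x v)"
  by (auto simp: agree_def)

lemma agree_trans: "agree Rs Ms s s' \<Longrightarrow> agree Rs' Ms' s' s'' \<Longrightarrow> Rs' \<subseteq> Rs \<Longrightarrow> Ms' \<subseteq> Ms \<Longrightarrow> agree Rs Ms s s''"
  by (auto simp: agree_def subset_iff)

lemma agree_weaken: "agree Rs' Ms' s s' \<Longrightarrow> Rs' \<subseteq> Rs \<Longrightarrow> Ms' \<subseteq> Ms \<Longrightarrow> agree Rs Ms s s'"
  by (auto simp: agree_def subset_iff)

text \<open>The frame condition relative to the state before the loop is built in, so an invariant
  mentions only what the loop is about. \<open>J k\<close> speaks of the state whose counter already
  is \<open>k\<close>. Test and increment cost 3 per iteration; initialisation and the last test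
  cost 2.\<close>

lemma wp_For:
  assumes v: "v < 50" "v \<in> Rs" and b: "b < 50" "b \<notin> Rs" "reg \<sigma> b = int m" and w: "1 \<le> w" "int m \<le> w"
    and init: "J 0 (set_reg \<sigma> v 0)"
    and step: "\<And>k \<sigma>' t'. k < m \<Longrightarrow> agree Rs Ms \<sigma> \<sigma>' \<Longrightarrow> reg \<sigma>' v = int k \<Longrightarrow> J k \<sigma>' \<Longrightarrow>
      wp w p (\<lambda>\<sigma>'' t''. t'' \<le> t' + C \<and> agree Rs Ms \<sigma> \<sigma>'' \<and> reg \<sigma>'' v = int k \<and> J (Suc k) (set_reg \<sigma>'' v (int k + 1))) \<sigma>' t'"
    and final: "\<And>\<sigma>' t'. agree Rs Ms \<sigma> \<sigma>' \<Longrightarrow> reg \<sigma>' v = int m \<Longrightarrow> J m \<sigma>' \<Longrightarrow> t' \<le> t + m * (C + 3) + 2 \<Longrightarrow> Q \<sigma>' t'"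
  shows "wp w (For v b p) Q \<sigma> t"
  unfolding wp_def
proof (intro allI impI)
  let ?body = "Seq p (Seq (Const 50 1) (Arith v Add v 50))"
  fix s assume s: "low s = \<sigma>"
  have loop: "\<exists>u s''. exec w (While_less v b ?body) s' u s'' \<and> agree Rs Ms \<sigma> (low s'') \<and>
      reg (low s'') v = int m \<and> J m (low s'') \<and> u \<le> (m - k) * (C + 3) + 1"
    if "k \<le> m" "agree Rs Ms \<sigma> (low s')" "reg (low s') v = int k" "J k (low s')" for k s'
    using that
  proof (induction "m - k" arbitrary: k s')
    case 0
    then have "k = m" by simp
    moreover have "reg s' b = int m" "reg s' v = int m"
      using 0 b v \<open>k = m\<close> by (auto simp: agree_def)
    ultimately show ?case using 0 by (auto intro!: exI[of _ 1] exI[of _ s'] exec.While_false)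
  next
    case (Suc x)
    then have k: "k < m" by simp
    from step[OF k Suc.prems(2-4), of 0] obtain u s1 where
      s1: "exec w p s' u s1" "u \<le> C" "agree Rs Ms \<sigma> (low s1)" "reg (low s1) v = int k"
        "J (Suc k) (set_reg (low s1) v (int k + 1))"
      unfolding wp_def by auto
    have rv: "reg s1 v = int k" using s1 v by simp
    define s2 where "s2 = set_reg (set_reg s1 50 1) v (int k + 1)"
    have "exec w (Const 50 1) s1 1 (set_reg s1 50 1)" using w by (intro exec.Const) auto
    moreover have "exec w (Arith v Add v 50) (set_reg s1 50 1) 1 s2"
      unfolding s2_def using w k rv v by (intro exec.Arith) auto
    ultimately have "exec w (Seq (Const 50 1) (Arith v Add v 50)) s1 (1 + 1) s2" by (rule exec.Seq)
    then have e: "exec w ?body s' (u + (1 + 1)) s2" using s1(1) by (rule exec.Seq[rotated])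
    have l2: "low s2 = set_reg (low s1) v (int k + 1)"
      unfolding s2_def low_set_reg[OF v(1)] by (simp add: low_set_reg_high)
    have "x = m - Suc k" "Suc k \<le> m" using Suc k by auto
    moreover have "agree Rs Ms \<sigma> (low s2)" unfolding l2 using s1 v by (intro agree_set_reg)
    moreover have "reg (low s2) v = int (Suc k)" "J (Suc k) (low s2)" unfolding l2 using s1 by auto
    ultimately obtain u' s'' where
      s'': "exec w (While_less v b ?body) s2 u' s''" "agree Rs Ms \<sigma> (low s'')" "reg (low s'') v = int m" "J m (low s'')"
        "u' \<le> (m - Suc k) * (C + 3) + 1" using Suc.hyps(1)[of "Suc k" s2] by blast
    have "reg s' b = int m" "reg s' v = int k"
      using Suc.prems b v by (auto simp: agree_def)
    then have "reg s' v < reg s' b" using k by simp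
    then have "exec w (While_less v b ?body) s' (u + (1 + 1) + u' + 1) s''"
      using e s''(1) by (rule exec.While_true)
    moreover have "(m - k) * (C + 3) = (m - Suc k) * (C + 3) + (C + 3)"
    proof -
      have "m - k = Suc (m - Suc k)" using k by simp
      then show ?thesis by (simp only: mult_Suc)
    qed
    then have "u + (1 + 1) + u' + 1 \<le> (m - k) * (C + 3) + 1" using s''(5) s1(2) by linarith
    ultimately show ?case using s'' by blast
  qed
  have "exec w (Const v 0) s 1 (set_reg s v 0)" using w by (intro exec.Const) auto
  moreover
  have l: "low (set_reg s v 0) = set_reg \<sigma> v 0" using s v by (simp add: low_set_reg)
  have "agree Rs Ms \<sigma> (set_reg \<sigma> v 0)" using v by (simp add: agree_set_reg)
  then obtain u s'' where u: "exec w (While_less v b ?body) (set_reg s v 0) u s''" "agree Rs Ms \<sigma> (low s'')"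
      "reg (low s'') v = int m" "J m (low s'')" "u \<le> m * (C + 3) + 1"
    using loop[of 0 "set_reg s v 0"] init v unfolding l by auto
  ultimately have "exec w (For v b p) s (1 + u) s''" unfolding For_def by (auto intro: exec.Seq)
  moreover have "Q (low s'') (t + (1 + u))" using u(5) by (intro final u) linarith
  ultimately show "\<exists>u s'. exec w (For v b p) s u s' \<and> Q (low s') (t + u)" by blast
qed

subsection \<open>Calling a multiplication program\<close>

fun shift :: "com \<Rightarrow> com" where
  "shift Skip = Skip"
| "shift (Const r c) = Const (r + 100) c"
| "shift (Arith r f x y) = Arith (r + 100) f (x + 100) (y + 100)"
| "shift (Load r a x) = Load (r + 100) (a + 10) (x + 100)"
| "shift (Store a x y) = Store (a + 10) (x + 100) (y + 100)"
| "shift (Seq p q) = Seq (shift p) (shift q)"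
| "shift (If_less x y p q) = If_less (x + 100) (y + 100) (shift p) (shift q)"
| "shift (While_less x y p) = While_less (x + 100) (y + 100) (shift p)"

definition shifted :: "state \<Rightarrow> state \<Rightarrow> bool" where
  "shifted s s' \<longleftrightarrow> (\<forall>r. reg s' (r + 100) = reg s r) \<and> (\<forall>a. mem s' (a + 10) = mem s a)"

lemma shifted_set_reg: "shifted s s' \<Longrightarrow> shifted (set_reg s r v) (set_reg s' (r + 100) v)"
  and shifted_set_mem: "shifted s s' \<Longrightarrow> shifted (set_mem s a x v) (set_mem s' (a + 10) x v)"
  and shifted_reg: "shifted s s' \<Longrightarrow> reg s' (r + 100) = reg s r"
  and shifted_mem: "shifted s s' \<Longrightarrow> mem s' (a + 10) = mem s a"
  by (auto simp: shifted_def)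

text \<open>A simulation: \<open>\<sigma>\<close> contains a renamed copy of the state of the
  program, and the \<open>agree\<close> clause records that the rest of the caller's state
  survives.\<close>

lemma exec_shift:
  assumes "exec w p s t s'" "shifted s \<sigma>"
  shows "\<exists>\<sigma>'. exec w (shift p) \<sigma> t \<sigma>' \<and> shifted s' \<sigma>' \<and> agree {100..} {10..} \<sigma> \<sigma>'"
  using assms
proof (induction arbitrary: \<sigma> rule: exec.induct)
  case (Skip s)
  then show ?case by (auto intro: exec.intros)
next
  case (Const c r s)
  then show ?case
    by (auto intro!: exI[of _ "set_reg \<sigma> (r + 100) c"] exec.Const shifted_set_reg agree_set_reg)
next
  case (Arith v f s x y r)
  then show ?case
    by (auto intro!: exI[of _ "set_reg \<sigma> (r + 100) v"] exec.Arith shifted_set_reg agree_set_reg simp: shifted_reg)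
next
  case (Load r a x s)
  have "exec w (shift (Load r a x)) \<sigma> 1 (set_reg \<sigma> (r + 100) (mem \<sigma> (a + 10) (reg \<sigma> (x + 100))))"
    by (simp add: exec.Load)
  then have "exec w (shift (Load r a x)) \<sigma> 1 (set_reg \<sigma> (r + 100) (mem s a (reg s x)))"
    using Load by (simp only: shifted_reg shifted_mem)
  then show ?case using Load by (intro exI conjI) (auto intro!: shifted_set_reg agree_set_reg)
next
  case (Store a x y s)
  have "exec w (shift (Store a x y)) \<sigma> 1 (set_mem \<sigma> (a + 10) (reg \<sigma> (x + 100)) (reg \<sigma> (y + 100)))"
    by (simp add: exec.Store)
  then have "exec w (shift (Store a x y)) \<sigma> 1 (set_mem \<sigma> (a + 10) (reg s x) (reg s y))"
    using Store by (simp only: shifted_reg)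
  then show ?case using Store by (intro exI conjI) (auto intro!: shifted_set_mem agree_set_mem)
next
  case (Seq p s t s' q u s'')
  from Seq.IH(1)[OF Seq.prems] obtain \<sigma>1 where
    1: "exec w (shift p) \<sigma> t \<sigma>1" "shifted s' \<sigma>1" "agree {100..} {10..} \<sigma> \<sigma>1" by blast
  from Seq.IH(2)[OF 1(2)] obtain \<sigma>2 where
    2: "exec w (shift q) \<sigma>1 u \<sigma>2" "shifted s'' \<sigma>2" "agree {100..} {10..} \<sigma>1 \<sigma>2" by blast
  have "exec w (shift (Seq p q)) \<sigma> (t + u) \<sigma>2" using 1(1) 2(1) by (simp add: exec.Seq)
  moreover have "agree {100..} {10..} \<sigma> \<sigma>2" by (rule agree_trans[OF 1(3) 2(3)]) auto
  ultimately show ?case using 2 by auto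
next
  case (If_true s x y p t s' q)
  from If_true.IH[OF If_true.prems] obtain \<sigma>1 where
    1: "exec w (shift p) \<sigma> t \<sigma>1" "shifted s' \<sigma>1" "agree {100..} {10..} \<sigma> \<sigma>1" by blast
  have "reg \<sigma> (x + 100) < reg \<sigma> (y + 100)" using If_true by (simp add: shifted_reg)
  then have "exec w (shift (If_less x y p q)) \<sigma> (t + 1) \<sigma>1" using 1(1) by (simp add: exec.If_true)
  then show ?case using 1 by auto
next
  case (If_false s x y q t s' p)
  from If_false.IH[OF If_false.prems] obtain \<sigma>1 where
    1: "exec w (shift q) \<sigma> t \<sigma>1" "shifted s' \<sigma>1" "agree {100..} {10..} \<sigma> \<sigma>1" by blast
  have "\<not> reg \<sigma> (x + 100) < reg \<sigma> (y + 100)" using If_false by (simp add: shifted_reg)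
  then have "exec w (shift (If_less x y p q)) \<sigma> (t + 1) \<sigma>1" using 1(1) by (simp add: exec.If_false)
  then show ?case using 1 by auto
next
  case (While_false s x y p)
  then have "\<not> reg \<sigma> (x + 100) < reg \<sigma> (y + 100)" by (simp add: shifted_reg)
  then have "exec w (shift (While_less x y p)) \<sigma> 1 \<sigma>" by (simp add: exec.While_false)
  then show ?case using While_false by auto
next
  case (While_true s x y p t s' u s'')
  from While_true.IH(1)[OF While_true.prems] obtain \<sigma>1 where
    1: "exec w (shift p) \<sigma> t \<sigma>1" "shifted s' \<sigma>1" "agree {100..} {10..} \<sigma> \<sigma>1" by blast
  from While_true.IH(2)[OF 1(2)] obtain \<sigma>2 where
    2: "exec w (shift (While_less x y p)) \<sigma>1 u \<sigma>2" "shifted s'' \<sigma>2" "agree {100..} {10..} \<sigma>1 \<sigma>2" by blast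
  have "reg \<sigma> (x + 100) < reg \<sigma> (y + 100)" using While_true by (simp add: shifted_reg)
  then have "exec w (While_less (x + 100) (y + 100) (shift p)) \<sigma> (t + u + 1) \<sigma>2"
    using 1(1) 2(1) by (simp add: exec.While_true)
  moreover have "agree {100..} {10..} \<sigma> \<sigma>2" by (rule agree_trans[OF 1(3) 2(3)]) auto
  ultimately show ?case using 2 by auto
qed

definition call :: "com \<Rightarrow> com" where
  "call p = Seq (Const 98 0) (Seq (Arith 100 Add 0 98) (Seq (Arith 101 Add 1 98) (shift p)))"

text \<open>Calls can be repeated without clearing anything: \<open>multiplies\<close> admits
  arbitrary contents besides its inputs, so leftovers of earlier calls do no harm. The operands may
  be destroyed, which is why only memory 12 is described afterwards.\<close>

lemma wp_call:
  assumes p: "multiplies p c n m T" and w: "(int n + 1) ^ c \<le> w" "int n \<le> w" "int m \<le> w"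
    and r: "reg \<sigma> 0 = int n" "reg \<sigma> 1 = int m"
    and A: "A \<in> carrier_mat n m" "B \<in> carrier_mat m n" "stored id A (mem \<sigma> 10)" "stored id B (mem \<sigma> 11)"
      "\<And>i k. i < n \<Longrightarrow> k < m \<Longrightarrow> \<bar>A $$ (i, k)\<bar> \<le> int n \<and> \<bar>B $$ (k, i)\<bar> \<le> int n"
    and Q: "\<And>\<sigma>' t'. agree {} {10, 11, 12} \<sigma> \<sigma>' \<Longrightarrow> stored id (A * B) (mem \<sigma>' 12) \<Longrightarrow> t' \<le> t + nat \<lfloor>T\<rfloor> + 3 \<Longrightarrow> Q \<sigma>' t'"
  shows "wp w (call p) Q \<sigma> t"
  unfolding wp_def
proof (intro allI impI)
  fix s assume s: "low s = \<sigma>"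
  have rs: "reg s 0 = int n" "reg s 1 = int m" using r s by (auto dest!: arg_cong[where f = reg])
  define sa where "sa = set_reg s 98 0"
  define sb where "sb = set_reg sa 100 (int n)"
  define s1 where "s1 = set_reg sb 101 (int m)"
  define s0 where "s0 = \<lparr>reg = (\<lambda>r. reg s1 (r + 100)), mem = (\<lambda>a. mem s1 (a + 10))\<rparr>"
  have sh: "shifted s0 s1" by (simp add: s0_def shifted_def)
  have "reg s0 0 = int n" "reg s0 1 = int m" by (simp_all add: s0_def s1_def sb_def)
  moreover have "mem s0 0 = mem \<sigma> 10" "mem s0 1 = mem \<sigma> 11" using s by (auto simp: s0_def s1_def sb_def sa_def)
  ultimately obtain u s' where u: "exec ((int n + 1) ^ c) p s0 u s'" "real u \<le> T" "stored id (A * B) (mem s' 2)"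
    using p A unfolding multiplies_def by metis
  from exec_shift[OF exec_mono[OF u(1) w(1)] sh] obtain s2 where
    s2: "exec w (shift p) s1 u s2" "shifted s' s2" "agree {100..} {10..} s1 s2" by blast
  have "exec w (Const 98 0) s 1 sa" unfolding sa_def using w by (intro exec.Const) auto
  moreover have "exec w (Arith 100 Add 0 98) sa 1 sb"
    unfolding sb_def using w rs by (intro exec.Arith) (auto simp: sa_def)
  moreover have "exec w (Arith 101 Add 1 98) sb 1 s1"
    unfolding s1_def using w rs by (intro exec.Arith) (auto simp: sb_def sa_def)
  ultimately have "exec w (call p) s (1 + (1 + (1 + u))) s2"
    unfolding call_def using s2(1) by (intro exec.Seq)
  moreover have "Q (low s2) (t + (1 + (1 + (1 + u))))"
  proof (rule Q)
    show "agree {} {10, 11, 12} \<sigma> (low s2)"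
      using s2(3) unfolding s[symmetric] agree_def by (auto simp: s1_def sb_def sa_def)
    have "mem s2 12 = mem s' 2" using shifted_mem[OF s2(2), of 2] by simp
    then show "stored id (A * B) (mem (low s2) 12)" using u(3) by simp
    have "u \<le> nat \<lfloor>T\<rfloor>" using u(2) by (simp add: le_nat_floor)
    then show "t + (1 + (1 + (1 + u))) \<le> t + nat \<lfloor>T\<rfloor> + 3" by simp
  qed
  ultimately show "\<exists>u s'. exec w (call p) s u s' \<and> Q (low s') (t + u)" by blast
qed

section \<open>Finding witnesses in one block\<close>

abbreviation plus_expr (infixl "[+]" 65) where "a [+] b \<equiv> Op Add a b"
abbreviation minus_expr (infixl "[-]" 65) where "a [-] b \<equiv> Op Sub a b"
abbreviation times_expr (infixl "[*]" 70) where "a [*] b \<equiv> Op Mul a b"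
abbreviation div_expr (infixl "[div]" 70) where "a [div] b \<equiv> Op Div a b"
abbreviation mod_expr (infixl "[mod]" 70) where "a [mod] b \<equiv> Op Mod a b"
abbreviation seq_com (infixr ";;" 60) where "p ;; q \<equiv> Seq p q"

lemmas wp_intros = wp_Seq wp_Asg wp_Wr wp_Cond

lemma div_mod_less: "x < n * m \<Longrightarrow> x div m < n \<and> x mod m < (m::nat)"
  by (cases "m = 0") (auto simp: less_mult_imp_div_less mult.commute)

text \<open>The loops run over flat indices, so entries are addressed through \<open>x div m\<close>
  and \<open>x mod m\<close> from here on.\<close>

lemma stored_flat:
  assumes "M \<in> carrier_mat n m"
  shows "stored f M h \<longleftrightarrow> (\<forall>x<n * m. h (int x) = f (M $$ (x div m, x mod m)))"
proof
  assume s: "stored f M h"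
  show "\<forall>x<n * m. h (int x) = f (M $$ (x div m, x mod m))"
  proof (intro allI impI)
    fix x assume "x < n * m"
    note dm = div_mod_less[OF this]
    have "\<forall>i<n. \<forall>j<m. h (int (i * m + j)) = f (M $$ (i, j))"
      using s assms unfolding stored_def by (simp only: carrier_matD)
    with dm have "h (int (x div m * m + x mod m)) = f (M $$ (x div m, x mod m))" by blast
    then show "h (int x) = f (M $$ (x div m, x mod m))" by (simp only: div_mult_mod_eq)
  qed
next
  assume h: "\<forall>x<n * m. h (int x) = f (M $$ (x div m, x mod m))"
  show "stored f M h"
    unfolding stored_def
  proof (intro allI impI)
    fix i j assume "i < dim_row M" "j < dim_col M"
    then have ij: "i < n" "j < m" using assms by auto
    then have "i * m + j < n * m"
      by (metis add.commute less_add_same_cancel1 mult.commute mult_Suc_right nat_add_left_cancel_less less_le_trans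
          mult_le_mono2 Suc_leI)
    with h have "h (int (i * m + j)) = f (M $$ ((i * m + j) div m, (i * m + j) mod m))" by blast
    then show "h (int (i * dim_col M + j)) = f (M $$ (i, j))" using ij assms by simp
  qed
qed

text \<open>
  Registers: 0 and 1 hold \<open>n\<close> and \<open>l\<close>; 6 is the first column of the current block. Memory 3 holds
  weights of the columns of the block.
\<close>

definition fill_left :: com where
  "fill_left = For 2 33
    (Asg 3 (V 2 [mod] V 1) ;;
     Asg 7 (V 6 [+] V 3) ;;
     Cond (V 7) (V 0)
       (Wr 10 (V 2) (Rd 0 (V 2 [div] V 1 [*] V 0 [+] V 7) [*] Rd 3 (V 3)))
       (Wr 10 (V 2) (N 0)))"

text \<open>If \<open>l\<close> does not divide \<open>n\<close>, the last block sticks out of the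
  matrix. The missing rows are padded by zeros, as are the missing columns in
  \<open>fill_left\<close>, so that every product has the same format.\<close>

definition fill_right :: com where
  "fill_right = For 2 33
    (Asg 7 (V 6 [+] V 2 [div] V 0) ;;
     Cond (V 7) (V 0)
       (Wr 11 (V 2) (Rd 1 (V 7 [*] V 0 [+] V 2 [mod] V 0)))
       (Wr 11 (V 2) (N 0)))"

text \<open>The two conditions on \<open>lam\<close> make it the bit length of \<open>n\<close>. Of
  the word bounds, \<open>w4\<close> is sized for potentials, which are of order lam n^4, and
  \<open>wQ\<close> for the codes and the arithmetic of the hash functions.\<close>

locale block_algorithm =
  fixes n l lam :: nat and w :: int and A B :: "bool mat" and p :: com and cw :: nat and T :: real
  assumes n: "1 \<le> n" and l: "1 \<le> l" "l \<le> n" and lam: "n < 2 ^ lam" "2 ^ lam \<le> 2 * n"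
    and A: "A \<in> carrier_mat n n" and B: "B \<in> carrier_mat n n"
    and p: "multiplies p cw n l T" and wc: "(int n + 1) ^ cw \<le> w"
    and w4: "int (100 * (lam + 3) * (n + 1) ^ 4) \<le> w"
    and wQ: "int (4 * ((16 * lam) ^ 3) ^ 3 * (n + 1)) \<le> w"
begin

definition H :: nat where "H = (16 * lam) ^ 3"
definition Tm :: nat where "Tm = nat \<lfloor>T\<rfloor>"

lemma lam_pos: "1 \<le> lam"
  using n lam by (cases lam) auto

lemma le_w: "k \<le> 100 * (lam + 3) * (n + 1) ^ 4 \<Longrightarrow> int k \<le> w"
  using w4 by linarith

lemma sq_le_w: "int (100 * ((n + 1) * (n + 1))) \<le> w"
proof (rule le_w)
  have "(n + 1) * (n + 1) \<le> (lam + 3) * (n + 1) ^ 4"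
  proof -
    have "(n + 1) * (n + 1) = 1 * (n + 1) ^ 2" by (simp add: power2_eq_square)
    also have "\<dots> \<le> (lam + 3) * (n + 1) ^ 4" by (intro mult_mono power_increasing) auto
    finally show ?thesis .
  qed
  then show "100 * ((n + 1) * (n + 1)) \<le> 100 * (lam + 3) * (n + 1) ^ 4"
    unfolding mult.assoc[of "100::nat"] by (rule mult_le_mono2)
qed

lemma small: "k \<le> 100 * ((n + 1) * (n + 1)) \<Longrightarrow> int k \<le> w"
  using sq_le_w by linarith

lemma small1: "k \<le> 100 * (n + 1) \<Longrightarrow> int k \<le> w"
  by (rule small) (auto simp: algebra_simps)

lemma small_trans: "k \<le> m \<Longrightarrow> m \<le> 100 * (n + 1) \<Longrightarrow> int k \<le> w"
  by (rule small1) (rule order_trans)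

lemma w_ge_1: "1 \<le> w"
  using small1[of 1] by simp

text \<open>Collects what is constant throughout: inputs and precomputed numbers. The registers and
  memories involved stay outside the frames of all commands run on a block, so
  \<open>env_agree\<close> carries the predicate along.\<close>

definition env :: "state \<Rightarrow> bool" where
  "env \<sigma> \<longleftrightarrow> reg \<sigma> 0 = int n \<and> reg \<sigma> 1 = int l \<and> reg \<sigma> 9 = int (n * n) \<and> reg \<sigma> 10 = int lam \<and>
    reg \<sigma> 11 = int H \<and> reg \<sigma> 12 = int (H * H * H) \<and> reg \<sigma> 27 = int (16 * lam) \<and> reg \<sigma> 33 = int (n * l) \<and>
    stored of_bool A (mem \<sigma> 0) \<and> stored of_bool B (mem \<sigma> 1)"

lemma env_agree:
  assumes "agree Rs Ms \<sigma> \<sigma>'" "env \<sigma>" "Rs \<inter> {0, 1, 9, 10, 11, 12, 27, 33} = {}" "Ms \<inter> {0, 1} = {}"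
  shows "env \<sigma>'"
proof -
  have "r \<in> {0, 1, 9, 10, 11, 12, 27, 33} \<Longrightarrow> reg \<sigma>' r = reg \<sigma> r" for r
    using assms(1,3) by (intro agree_reg[OF assms(1)]) auto
  moreover have "a \<in> {0, 1} \<Longrightarrow> mem \<sigma>' a = mem \<sigma> a" for a
    using assms(1,4) by (intro agree_mem[OF assms(1)]) auto
  ultimately show ?thesis using assms(2) by (simp add: env_def)
qed

lemma envD:
  assumes "env \<sigma>"
  shows "reg \<sigma> 0 = int n" "reg \<sigma> 1 = int l" "reg \<sigma> 9 = int (n * n)" "reg \<sigma> 10 = int lam"
    "reg \<sigma> 11 = int H" "reg \<sigma> 12 = int (H * H * H)" "reg \<sigma> 27 = int (16 * lam)" "reg \<sigma> 33 = int (n * l)"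
    "i < n \<Longrightarrow> k < n \<Longrightarrow> mem \<sigma> 0 (int (i * n + k)) = of_bool (A $$ (i, k))"
    "k < n \<Longrightarrow> i < n \<Longrightarrow> mem \<sigma> 1 (int (k * n + i)) = of_bool (B $$ (k, i))"
  using assms A B by (auto simp: env_def stored_def)

text \<open>Entries are named by flat indices, but witnesses by their offset in the block that
  starts at \<open>\<beta>\<close>, since offsets are the column numbers of the products that are
  formed.\<close>

definition block_witnesses :: "nat \<Rightarrow> nat \<Rightarrow> nat set" where
  "block_witnesses \<beta> x = {k. k < l \<and> \<beta> + k < n \<and> A $$ (x div n, \<beta> + k) \<and> B $$ (\<beta> + k, x mod n)}"

lemma wp_fill_left:
  assumes env: "env \<sigma>" and b: "reg \<sigma> 6 = int \<beta>" "\<beta> \<le> 2 * n"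
    and V: "\<And>k. k < l \<Longrightarrow> \<bar>mem \<sigma> 3 (int k)\<bar> \<le> int n"
    and Q: "\<And>\<sigma>' t'. agree {2, 3, 7} {10} \<sigma> \<sigma>' \<Longrightarrow>
      (\<And>x. x < n * l \<Longrightarrow> mem \<sigma>' 10 (int x) =
        (if \<beta> + x mod l < n then of_bool (A $$ (x div l, \<beta> + x mod l)) * mem \<sigma> 3 (int (x mod l)) else 0)) \<Longrightarrow>
      t' \<le> t + n * l * 40 + 2 \<Longrightarrow> Q \<sigma>' t'"
  shows "wp w fill_left Q \<sigma> t"
  unfolding fill_left_def
proof (rule wp_For[where m = "n * l" and Rs = "{2, 3, 7}" and Ms = "{10}" and C = 37 and
      J = "\<lambda>x \<sigma>'. \<forall>y<x. mem \<sigma>' 10 (int y) =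
        (if \<beta> + y mod l < n then of_bool (A $$ (y div l, \<beta> + y mod l)) * mem \<sigma> 3 (int (y mod l)) else 0)"])
  show "reg \<sigma> 33 = int (n * l)" using env by (rule envD)
  have "n * l \<le> (n + 1) * (n + 1)" using l by (intro mult_mono) auto
  then show "int (n * l) \<le> w" by (intro small) auto
  fix x \<sigma>' t'
  assume x: "x < n * l" and ag: "agree {2, 3, 7} {10} \<sigma> \<sigma>'" and rx: "reg \<sigma>' 2 = int x"
    and J: "\<forall>y<x. mem \<sigma>' 10 (int y) =
        (if \<beta> + y mod l < n then of_bool (A $$ (y div l, \<beta> + y mod l)) * mem \<sigma> 3 (int (y mod l)) else 0)"
  have env': "env \<sigma>'" by (rule env_agree[OF ag env]) auto
  have b': "reg \<sigma>' 6 = int \<beta>" using agree_reg[OF ag, of 6] b by simp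
  have m3: "mem \<sigma>' 3 = mem \<sigma> 3" using agree_mem[OF ag, of 3] by simp
  have xl: "x div l < n" "x mod l < l" using div_mod_less[OF x] by auto
  have bounds: "int (x mod l) \<le> w" "int (\<beta> + x mod l) \<le> w" "int (x div l) \<le> w"
    by (rule small_trans[OF less_imp_le[OF xl(2)]], use l in simp)
      (rule small_trans[OF add_mono[OF b(2) less_imp_le[OF xl(2)]]], use l in simp,
       rule small_trans[OF less_imp_le[OF xl(1)]], simp)
  have "x div l * n \<le> n * n" using xl by (intro mult_right_mono) auto
  then have "x div l * n \<le> 100 * ((n + 1) * (n + 1))"
     "\<beta> + x mod l < n \<Longrightarrow> x div l * n + (\<beta> + x mod l) \<le> 100 * ((n + 1) * (n + 1))"
    unfolding distrib_left distrib_right by linarith+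
  note le = this
  have b4: "int (x div l * n) \<le> w" "\<beta> + x mod l < n \<Longrightarrow> int (x div l * n + (\<beta> + x mod l)) \<le> w"
    using small[OF le(1)] small[OF le(2)] by blast+
  have b5: "\<bar>of_bool P * mem \<sigma> 3 (int (x mod l))\<bar> \<le> w" for P
    using V[OF xl(2)] small1[of n] w_ge_1 by (auto simp: algebra_simps)
  have eqs: "int x mod int l = int (x mod l)" "int x div int l = int (x div l)"
    by (simp_all add: zmod_int zdiv_int)
  have r0: "reg \<sigma>' 0 = int n" "reg \<sigma>' 1 = int l" using env' by (simp_all add: env_def)
  have e0: "int (x div l) * int n + (int \<beta> + int (x mod l)) = int (x div l * n + (\<beta> + x mod l))"
     "int \<beta> + int (x mod l) = int (\<beta> + x mod l)" "int (x div l) * int n = int (x div l * n)"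
     "int (x div l * n) + int (\<beta> + x mod l) = int (x div l * n + (\<beta> + x mod l))" by simp_all
  show "wp w (Asg 3 (V 2 [mod] V 1) ;; Asg 7 (V 6 [+] V 3) ;;
     Cond (V 7) (V 0)
       (Wr 10 (V 2) (Rd 0 (V 2 [div] V 1 [*] V 0 [+] V 7) [*] Rd 3 (V 3)))
       (Wr 10 (V 2) (N 0)))
     (\<lambda>\<sigma>'' t''. t'' \<le> t' + 37 \<and> agree {2, 3, 7} {10} \<sigma> \<sigma>'' \<and> reg \<sigma>'' 2 = int x \<and>
      (\<forall>y<Suc x. mem (set_reg \<sigma>'' 2 (int x + 1)) 10 (int y) =
        (if \<beta> + y mod l < n then of_bool (A $$ (y div l, \<beta> + y mod l)) * mem \<sigma> 3 (int (y mod l)) else 0))) \<sigma>' t'"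
    apply (intro wp_intros)
    using bounds b4 b5 w_ge_1 xl ag J envD(9)[OF env' xl(1), of "\<beta> + x mod l"]
    by (simp_all add: rx b' m3 r0 eqs e0 agree_set_reg agree_set_mem less_Suc_eq split: if_splits del: of_nat_add of_nat_mult)
qed (use Q w_ge_1 in auto)

lemma wp_fill_right:
  assumes env: "env \<sigma>" and b: "reg \<sigma> 6 = int \<beta>" "\<beta> \<le> 2 * n"
    and Q: "\<And>\<sigma>' t'. agree {2, 7} {11} \<sigma> \<sigma>' \<Longrightarrow>
      (\<And>x. x < n * l \<Longrightarrow> mem \<sigma>' 11 (int x) =
        (if \<beta> + x div n < n then of_bool (B $$ (\<beta> + x div n, x mod n)) else 0)) \<Longrightarrow>
      t' \<le> t + n * l * 40 + 2 \<Longrightarrow> Q \<sigma>' t'"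
  shows "wp w fill_right Q \<sigma> t"
  unfolding fill_right_def
proof (rule wp_For[where m = "n * l" and Rs = "{2, 7}" and Ms = "{11}" and C = 37 and
      J = "\<lambda>x \<sigma>'. \<forall>y<x. mem \<sigma>' 11 (int y) =
        (if \<beta> + y div n < n then of_bool (B $$ (\<beta> + y div n, y mod n)) else 0)"])
  show "reg \<sigma> 33 = int (n * l)" using env by (rule envD)
  have "n * l \<le> (n + 1) * (n + 1)" using l by (intro mult_mono) auto
  then show "int (n * l) \<le> w" by (intro small) auto
  fix x \<sigma>' t'
  assume x: "x < n * l" and ag: "agree {2, 7} {11} \<sigma> \<sigma>'" and rx: "reg \<sigma>' 2 = int x"
    and J: "\<forall>y<x. mem \<sigma>' 11 (int y) =
        (if \<beta> + y div n < n then of_bool (B $$ (\<beta> + y div n, y mod n)) else 0)"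
  have env': "env \<sigma>'" by (rule env_agree[OF ag env]) auto
  have b': "reg \<sigma>' 6 = int \<beta>" using agree_reg[OF ag, of 6] b by simp
  have xl: "x div n < l" "x mod n < n" using div_mod_less[of x l n] x by (auto simp: mult.commute)
  have bounds: "int (x mod n) \<le> w" "int (\<beta> + x div n) \<le> w" "int (x div n) \<le> w"
    by (rule small_trans[OF less_imp_le[OF xl(2)]], simp)
      (rule small_trans[OF add_mono[OF b(2) less_imp_le[OF xl(1)]]], use l in simp,
       rule small_trans[OF less_imp_le[OF xl(1)]], use l in simp)
  have b4: "int ((\<beta> + x div n) * n) \<le> w \<and> int ((\<beta> + x div n) * n + x mod n) \<le> w" if "\<beta> + x div n < n"
  proof -
    have "(\<beta> + x div n) * n \<le> n * n" using that by (intro mult_right_mono) auto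
    then have "(\<beta> + x div n) * n + x mod n \<le> 100 * ((n + 1) * (n + 1))" "(\<beta> + x div n) * n \<le> 100 * ((n + 1) * (n + 1))"
      using xl unfolding distrib_left distrib_right by linarith+
    then show ?thesis by (intro conjI small)
  qed
  have eqs: "int x mod int n = int (x mod n)" "int x div int n = int (x div n)"
    by (simp_all add: zmod_int zdiv_int)
  have r0: "reg \<sigma>' 0 = int n" "reg \<sigma>' 1 = int l" using env' by (simp_all add: env_def)
  have e0: "int (\<beta> + x div n) * int n + int (x mod n) = int ((\<beta> + x div n) * n + x mod n)"
     "int \<beta> + int (x div n) = int (\<beta> + x div n)" "int (\<beta> + x div n) * int n = int ((\<beta> + x div n) * n)"
     "int ((\<beta> + x div n) * n) + int (x mod n) = int ((\<beta> + x div n) * n + x mod n)" by simp_all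
  show "wp w (Asg 7 (V 6 [+] V 2 [div] V 0) ;;
     Cond (V 7) (V 0)
       (Wr 11 (V 2) (Rd 1 (V 7 [*] V 0 [+] V 2 [mod] V 0)))
       (Wr 11 (V 2) (N 0)))
     (\<lambda>\<sigma>'' t''. t'' \<le> t' + 37 \<and> agree {2, 7} {11} \<sigma> \<sigma>'' \<and> reg \<sigma>'' 2 = int x \<and>
      (\<forall>y<Suc x. mem (set_reg \<sigma>'' 2 (int x + 1)) 11 (int y) =
        (if \<beta> + y div n < n then of_bool (B $$ (\<beta> + y div n, y mod n)) else 0))) \<sigma>' t'"
    apply (intro wp_intros)
    using bounds b4 w_ge_1 xl ag J envD(10)[OF env' _ xl(2), of "\<beta> + x div n"]
    by (simp_all add: rx b' r0 eqs e0 agree_set_reg agree_set_mem less_Suc_eq split: if_splits del: of_nat_add of_nat_mult)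
qed (use Q w_ge_1 in auto)

definition count :: com where
  "count = fill_left ;; fill_right ;; call p"

lemma finite_block_witnesses: "finite (block_witnesses \<beta> x)"
  unfolding block_witnesses_def by (rule finite_subset[of _ "{..<l}"]) auto

lemma block_witnesses_less: "k \<in> block_witnesses \<beta> x \<Longrightarrow> k < l"
  by (simp add: block_witnesses_def)

text \<open>One command serves three purposes, depending on the weights in memory 3: ones count all
  witnesses, an indicator counts those in a sample, and an indicator times the offset reveals a
  witness that is alone in the sample.\<close>

lemma wp_count:
  assumes env: "env \<sigma>" and b: "reg \<sigma> 6 = int \<beta>" "\<beta> \<le> 2 * n"
    and V: "\<And>k. k < l \<Longrightarrow> \<bar>mem \<sigma> 3 (int k)\<bar> \<le> int n"
    and Q: "\<And>\<sigma>' t'. agree {2, 3, 7} {10, 11, 12} \<sigma> \<sigma>' \<Longrightarrow>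
      (\<And>x. x < n * n \<Longrightarrow> mem \<sigma>' 12 (int x) = (\<Sum>k\<in>block_witnesses \<beta> x. mem \<sigma> 3 (int k))) \<Longrightarrow>
      t' \<le> t + (Tm + 90 * (n * n)) \<Longrightarrow> Q \<sigma>' t'"
  shows "wp w count Q \<sigma> t"
  unfolding count_def
proof (rule wp_Seq, rule wp_fill_left[OF env b V], assumption, rule wp_Seq)
  fix \<sigma>1 t1
  assume ag1: "agree {2, 3, 7} {10} \<sigma> \<sigma>1" and t1: "t1 \<le> t + n * l * 40 + 2" and
    L: "\<And>x. x < n * l \<Longrightarrow> mem \<sigma>1 10 (int x) =
        (if \<beta> + x mod l < n then of_bool (A $$ (x div l, \<beta> + x mod l)) * mem \<sigma> 3 (int (x mod l)) else 0)"
  have env1: "env \<sigma>1" by (rule env_agree[OF ag1 env]) auto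
  have b1: "reg \<sigma>1 6 = int \<beta>" using agree_reg[OF ag1, of 6] b by simp
  show "wp w fill_right (wp w (call p) Q) \<sigma>1 t1"
  proof (rule wp_fill_right[OF env1 b1 b(2)])
    fix \<sigma>2 t2
    assume ag2: "agree {2, 7} {11} \<sigma>1 \<sigma>2" and t2: "t2 \<le> t1 + n * l * 40 + 2" and
      R: "\<And>x. x < n * l \<Longrightarrow> mem \<sigma>2 11 (int x) =
        (if \<beta> + x div n < n then of_bool (B $$ (\<beta> + x div n, x mod n)) else 0)"
    have env2: "env \<sigma>2" by (rule env_agree[OF ag2 env1]) auto
    define A' where "A' = mat n l (\<lambda>(i, k). if \<beta> + k < n then of_bool (A $$ (i, \<beta> + k)) * mem \<sigma> 3 (int k) else 0)"
    define B' where "B' = mat l n (\<lambda>(k, j). if \<beta> + k < n then of_bool (B $$ (\<beta> + k, j)) else 0 :: int)"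
    have A': "A' \<in> carrier_mat n l" and B': "B' \<in> carrier_mat l n" by (simp_all add: A'_def B'_def)
    show "wp w (call p) Q \<sigma>2 t2"
    proof (rule wp_call[OF p wc _ _ _ _ A' B'])
      show "int n \<le> w" "int l \<le> w" using l by (auto intro!: small1)
      show "reg \<sigma>2 0 = int n" "reg \<sigma>2 1 = int l" using env2 by (rule envD)+
      have "mem \<sigma>2 10 = mem \<sigma>1 10" using agree_mem[OF ag2, of 10] by simp
      then show "stored id A' (mem \<sigma>2 10)"
        unfolding stored_flat[OF A'] using L div_mod_less by (auto simp: A'_def)
      show "stored id B' (mem \<sigma>2 11)"
        unfolding stored_flat[OF B'] using R div_mod_less[of _ l n] by (auto simp: B'_def mult.commute[of l n])
      fix i k assume "i < n" "k < l"
      then show "\<bar>A' $$ (i, k)\<bar> \<le> int n \<and> \<bar>B' $$ (k, i)\<bar> \<le> int n"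
        using V n by (auto simp: A'_def B'_def)
    next
      fix \<sigma>3 t3
      assume ag3: "agree {} {10, 11, 12} \<sigma>2 \<sigma>3" and st: "stored id (A' * B') (mem \<sigma>3 12)"
        and t3: "t3 \<le> t2 + nat \<lfloor>T\<rfloor> + 3"
      show "Q \<sigma>3 t3"
      proof (rule Q)
        have "agree {2, 3, 7} {10, 11, 12} \<sigma> \<sigma>2"
          by (rule agree_trans[OF agree_weaken[OF ag1] ag2]) auto
        then show "agree {2, 3, 7} {10, 11, 12} \<sigma> \<sigma>3" using ag3 by (rule agree_trans) auto
        have "n * l \<le> n * n" using l by simp
        moreover have "1 \<le> n * n" using mult_le_mono[OF n n] by simp
        ultimately show "t3 \<le> t + (Tm + 90 * (n * n))"
          using t1 t2 t3 unfolding Tm_def by linarith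
        fix x assume x: "x < n * n"
        note ij = div_mod_less[OF x]
        have AB: "A' * B' \<in> carrier_mat n n" using A' B' by simp
        have "mem \<sigma>3 12 (int x) = (A' * B') $$ (x div n, x mod n)"
          using st x unfolding stored_flat[OF AB] by simp
        also have "\<dots> = (\<Sum>k\<in>{0..<l}. A' $$ (x div n, k) * B' $$ (k, x mod n))"
          using ij A' B' by (subst index_mult_mat) (auto simp: scalar_prod_def)
        also have "\<dots> = (\<Sum>k\<in>{0..<l}. if k \<in> block_witnesses \<beta> x then mem \<sigma> 3 (int k) else 0)"
          using ij by (intro sum.cong) (auto simp: A'_def B'_def block_witnesses_def)
        also have "\<dots> = (\<Sum>k\<in>block_witnesses \<beta> x. mem \<sigma> 3 (int k))"
          by (subst sum.inter_restrict[symmetric]) (auto intro!: sum.cong simp: block_witnesses_def)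
        finally show "mem \<sigma>3 12 (int x) = (\<Sum>k\<in>block_witnesses \<beta> x. mem \<sigma> 3 (int k))" .
      qed
    qed
  qed
qed

end

section \<open>Choosing a halving by exhaustive search\<close>

text \<open>
  Memory 4 holds the indicator of the current sample of the block, register 16 the code of a hash
  function, and registers 13 to 15 its modulus and coefficients.
\<close>

definition set_weights :: com where
  "set_weights =
    Asg 13 (N 1 [+] V 16 [div] (V 11 [*] V 11)) ;;
    Asg 14 (V 16 [div] V 11 [mod] V 11) ;;
    Asg 15 (V 16 [mod] V 11) ;;
    For 3 1
     (Cond (N 2 [*] ((V 14 [*] V 3 [+] V 15) [mod] V 13)) (V 13 [+] N 1)
       (Wr 3 (V 3) (Rd 4 (V 3)))
       (Wr 3 (V 3) (N 0)))"

text \<open>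
  Memory 5 holds the number of witnesses of the unresolved entries, and 0 for all others. Registers
  21 to 24 hold \<open>s\<close>, the lower bound of the current scale, \<open>2 ^ j\<close> and \<open>j\<close>.
\<close>

definition score :: com where
  "score =
    Asg 20 (N 0) ;;
    For 5 9
     (Asg 8 (Rd 12 (V 5)) ;;
      Asg 7 (Rd 5 (V 5)) ;;
      Cond (V 7) (V 22) Skip
       (Cond (V 7) (N 2 [*] V 22)
         (Asg 20 (V 20 [+] (V 21 [*] V 23 [*] V 8 [-] (V 21 [+] V 24) [*] (V 8 [*] (V 8 [-] N 1)))))
         Skip))"

text \<open>Selects a hash function of maximal potential; registers 18 and 19 hold the maximum and its argument.\<close>

definition select :: "com \<Rightarrow> com" where
  "select cnt =
    Asg 18 (N 0) ;;
    Asg 19 (N 0) ;;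
    For 17 12
     (Asg 16 (V 17) ;;
      set_weights ;;
      cnt ;;
      score ;;
      Cond (V 18) (V 20) (Asg 18 (V 20) ;; Asg 19 (V 17)) Skip) ;;
    Asg 16 (V 19) ;;
    set_weights ;;
    For 3 1 (Wr 4 (V 3) (Rd 3 (V 3)))"

lemma isolation_potential_bound:
  assumes "finite E" and "\<And>e. e \<in> E \<Longrightarrow> card (W e \<inter> S) \<le> m"
  shows "\<bar>isolation_potential s j E W S\<bar> \<le> int (card E * (s * 2 ^ j * m + (s + j) * (m * m)))"
proof -
  have "\<bar>isolation_potential s j E W S\<bar> \<le> (\<Sum>e\<in>E. \<bar>int s * 2 ^ j * int (card (W e \<inter> S)) - int (s + j) * (int (card (W e \<inter> S)) * (int (card (W e \<inter> S)) - 1))\<bar>)"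
    unfolding isolation_potential_def by (rule sum_abs)
  also have "\<dots> \<le> (\<Sum>e\<in>E. int (s * 2 ^ j * m + (s + j) * (m * m)))"
  proof (rule sum_mono)
    fix e assume e: "e \<in> E"
    define d where "d = int (card (W e \<inter> S))"
    have d: "0 \<le> d" "d \<le> int m" using assms(2)[OF e] by (auto simp: d_def)
    have a: "0 \<le> d * (d - 1)" using d by (cases "d = 0") auto
    have b: "d * (d - 1) \<le> int m * int m" using d by (cases "d = 0") (auto intro!: mult_mono)
    have p1: "0 \<le> int s * 2 ^ j * d" using d by simp
    have p2: "0 \<le> int (s + j) * (d * (d - 1))" by (rule mult_nonneg_nonneg) (use a in auto)
    have "\<bar>int s * 2 ^ j * d - int (s + j) * (d * (d - 1))\<bar> \<le> \<bar>int s * 2 ^ j * d\<bar> + \<bar>int (s + j) * (d * (d - 1))\<bar>"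
      by (rule abs_triangle_ineq4)
    also have "\<dots> = int s * 2 ^ j * d + int (s + j) * (d * (d - 1))"
      by (simp only: abs_of_nonneg[OF p1] abs_of_nonneg[OF p2])
    also have "\<dots> \<le> int s * 2 ^ j * int m + int (s + j) * (int m * int m)"
      using d b by (intro add_mono mult_left_mono) auto
    finally show "\<bar>int s * 2 ^ j * d - int (s + j) * (d * (d - 1))\<bar> \<le> int (s * 2 ^ j * m + (s + j) * (m * m))"
      by simp
  qed
  finally show ?thesis by simp
qed

context block_algorithm
begin

lemma H_pos: "1 \<le> H"
proof -
  have "1 ^ 3 \<le> (16 * lam) ^ 3" by (rule power_mono) (use lam_pos in auto)
  then show ?thesis by (simp add: H_def)
qed

lemma hash_le_w: "k \<le> 4 * (H * H * H) * (n + 1) \<Longrightarrow> int k \<le> w"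
  using wQ unfolding H_def[symmetric] power3_eq_cube[of H] by linarith

lemma hash_le_w1: "k \<le> 4 * (H * H * H) \<Longrightarrow> int k \<le> w"
  by (rule hash_le_w) (erule order_trans, simp)

text \<open>A code has the digits \<open>q - 1\<close>, \<open>a\<close> and \<open>b\<close> in
  base \<open>H\<close>; storing \<open>q - 1\<close> excludes the modulus 0. All codes are tried,
  including those with composite modulus or unreduced coefficients. They cannot spoil a search for
  the best code, so the program never tests primality.\<close>

definition hash :: "nat \<Rightarrow> nat set" where
  "hash c = pick (1 + c div (H * H)) (c div H mod H) (c mod H)"

lemma hash_code:
  assumes "q \<le> H" "a < q" "b < q"
  shows "\<exists>c<H * H * H. hash c = pick q a b"
proof (intro exI conjI)
  let ?c = "(q - 1) * (H * H) + (a * H + b)"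
  have ab: "a < H" "b < H" using assms by auto
  have "a * H + b < a * H + H" using ab by simp
  also have "\<dots> = (a + 1) * H" by (simp only: distrib_right mult_1)
  also have "\<dots> \<le> H * H" using ab by (intro mult_right_mono) auto
  finally have lt: "a * H + b < H * H" .
  then have d1: "?c div (H * H) = q - 1" by (subst div_mult_self3) (use H_pos in auto)
  have eq: "?c = ((q - 1) * H + a) * H + b" by (simp add: algebra_simps)
  have d2: "?c div H = (q - 1) * H + a" "?c mod H = b"
    unfolding eq using ab by (subst div_mult_self3 mod_mult_self3; simp)+
  then have "?c div H mod H = a" using ab by simp
  then show "hash ?c = pick q a b" unfolding hash_def d1 using d2 assms by simp
  have "?c < (q - 1) * (H * H) + H * H" using lt by simp
  also have "\<dots> = q * (H * H)" using assms by (cases q) auto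
  also have "\<dots> \<le> H * (H * H)" using assms by (intro mult_right_mono) auto
  finally show "?c < H * H * H" by simp
qed

definition sample :: "nat set \<Rightarrow> state \<Rightarrow> bool" where
  "sample S \<sigma> \<longleftrightarrow> (\<forall>k<l. mem \<sigma> 4 (int k) = of_bool (k \<in> S))"

lemma wp_set_weights:
  assumes env: "env \<sigma>" and S: "sample S \<sigma>" and c: "reg \<sigma> 16 = int c" "c < H * H * H"
    and Q: "\<And>\<sigma>' t'. agree {3, 13, 14, 15} {3} \<sigma> \<sigma>' \<Longrightarrow>
      (\<And>k. k < l \<Longrightarrow> mem \<sigma>' 3 (int k) = of_bool (k \<in> S \<inter> hash c)) \<Longrightarrow> t' \<le> t + 60 * (n * n) \<Longrightarrow> Q \<sigma>' t'"
  shows "wp w set_weights Q \<sigma> t"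
proof -
  define q a b where "q = 1 + c div (H * H)" and "a = c div H mod H" and "b = c mod H"
  have H2: "H * H \<le> H * H * H" and H1: "H \<le> H * H" using H_pos by auto
  have "c div (H * H) < H" using c(2) H_pos by (intro less_mult_imp_div_less) (simp add: mult_ac)
  then have q: "q \<le> H" "1 \<le> q" by (auto simp: q_def)
  have ab: "a < H" "b < H" using H_pos by (auto simp: a_def b_def)
  have bq: "int q \<le> w" "int (q + 1) \<le> w" "int (c div (H * H)) \<le> w"
    using q H1 H2 H_pos \<open>c div (H * H) < H\<close> by (intro hash_le_w1, linarith)+
  have bH: "int (H * H) \<le> w" "int H \<le> w" using H1 H2 by (intro hash_le_w1, linarith)+
  have cH: "c div H \<le> c" by simp
  have bab: "int a \<le> w" "int b \<le> w" "int (c div H) \<le> w"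
    using ab H1 H2 cH c(2) by (intro hash_le_w1, linarith)+
  have w2: "2 \<le> w" "int l \<le> w" using small1[of 2] small1[of l] l by auto
  have r0: "reg \<sigma> 0 = int n" "reg \<sigma> 1 = int l" "reg \<sigma> 11 = int H" using env by (rule envD)+
  define \<sigma>1 where "\<sigma>1 = set_reg (set_reg (set_reg \<sigma> 13 (int q)) 14 (int a)) 15 (int b)"
  have ag1: "agree {3, 13, 14, 15} {3} \<sigma> \<sigma>1" by (simp add: \<sigma>1_def agree_set_reg)
  have S1: "\<And>k. k < l \<Longrightarrow> mem \<sigma>1 4 (int k) = of_bool (k \<in> S)" using S by (simp add: \<sigma>1_def sample_def)
  have loop: "wp w (For 3 1
     (Cond (N 2 [*] ((V 14 [*] V 3 [+] V 15) [mod] V 13)) (V 13 [+] N 1)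
       (Wr 3 (V 3) (Rd 4 (V 3)))
       (Wr 3 (V 3) (N 0)))) Q \<sigma>1 t1" if t1: "t1 \<le> t + 30" for t1
  proof (rule wp_For[where m = l and Rs = "{3}" and Ms = "{3}" and C = 20 and
        J = "\<lambda>k \<sigma>'. \<forall>y<k. mem \<sigma>' 3 (int y) = of_bool (y \<in> S \<inter> hash c)"])
    show "reg \<sigma>1 1 = int l" using r0 by (simp add: \<sigma>1_def)
    fix k \<sigma>' t'
    assume k: "k < l" and ag: "agree {3} {3} \<sigma>1 \<sigma>'" and rx: "reg \<sigma>' 3 = int k"
      and J: "\<forall>y<k. mem \<sigma>' 3 (int y) = of_bool (y \<in> S \<inter> hash c)"
    have m4: "mem \<sigma>' 4 = mem \<sigma>1 4" using agree_mem[OF ag, of 4] by simp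
    have r: "reg \<sigma>' 13 = int q" "reg \<sigma>' 14 = int a" "reg \<sigma>' 15 = int b"
      using agree_reg[OF ag, of 13] agree_reg[OF ag, of 14] agree_reg[OF ag, of 15] by (simp_all add: \<sigma>1_def)
    have "a * k \<le> H * n" using ab k l by (intro mult_mono) auto
    moreover have "H * n + H \<le> 4 * (H * H * H) * (n + 1)"
    proof -
      have "H * n + H = 1 * H * (n + 1)" by (simp only: distrib_left mult_1 mult_1_right)
      also have "\<dots> \<le> 4 * (H * H * H) * (n + 1)" using H1 H2 by (intro mult_right_mono) auto
      finally show ?thesis .
    qed
    ultimately have "a * k \<le> 4 * (H * H * H) * (n + 1)" "a * k + b \<le> 4 * (H * H * H) * (n + 1)"
      using ab by linarith+
    note le = this[THEN hash_le_w]
    have m: "(a * k + b) mod q < q" using q by simp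
    have "(a * k + b) mod q \<le> 4 * (H * H * H)" "2 * ((a * k + b) mod q) \<le> 4 * (H * H * H)"
      using m q H1 H2 by linarith+
    note le2 = this[THEN hash_le_w1]
    have e: "int a * int k = int (a * k)" "int (a * k) + int b = int (a * k + b)"
      "int (a * k + b) mod int q = int ((a * k + b) mod q)"
      "2 * int ((a * k + b) mod q) = int (2 * ((a * k + b) mod q))" "int q + 1 = int (q + 1)"
      by (simp_all add: zmod_int)
    \<comment> \<open>The machine compares by \<open><\<close> only, hence \<open>q + 1\<close> on
      the right.\<close>
    have hk: "k \<in> hash c \<longleftrightarrow> 2 * ((a * k + b) mod q) < q + 1"
      by (auto simp: hash_def pick_def a_def b_def q_def)
    show "wp w (Cond (N 2 [*] ((V 14 [*] V 3 [+] V 15) [mod] V 13)) (V 13 [+] N 1)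
       (Wr 3 (V 3) (Rd 4 (V 3))) (Wr 3 (V 3) (N 0)))
     (\<lambda>\<sigma>'' t''. t'' \<le> t' + 20 \<and> agree {3} {3} \<sigma>1 \<sigma>'' \<and> reg \<sigma>'' 3 = int k \<and>
      (\<forall>y<Suc k. mem (set_reg \<sigma>'' 3 (int k + 1)) 3 (int y) = of_bool (y \<in> S \<inter> hash c))) \<sigma>' t'"
      apply (intro wp_intros)
      using le le2 w2 bq J S1[OF k] ag
      by (simp_all add: rx r m4 e hk agree_set_mem less_Suc_eq split: if_splits del: of_nat_add of_nat_mult)
  next
    fix \<sigma>' t'
    assume ag: "agree {3} {3} \<sigma>1 \<sigma>'" and J: "\<forall>y<l. mem \<sigma>' 3 (int y) = of_bool (y \<in> S \<inter> hash c)"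
      and t': "t' \<le> t1 + l * (20 + 3) + 2"
    show "Q \<sigma>' t'"
    proof (rule Q)
      show "agree {3, 13, 14, 15} {3} \<sigma> \<sigma>'" by (rule agree_trans[OF ag1 ag]) auto
      have "l \<le> n * n" "1 \<le> n * n" using mult_le_mono[OF l(2) n] mult_le_mono[OF n n] by auto
      moreover have "t' \<le> t1 + 23 * l + 2" using t' by simp
      ultimately show "t' \<le> t + 60 * (n * n)" using t1 by linarith
    qed (use J in auto)
  qed (use w2 in auto)
  have e: "int H * int H = int (H * H)" "int c div int (H * H) = int (c div (H * H))"
    "int c div int H = int (c div H)" "int (c div H) mod int H = int a" "int c mod int H = int b"
    "1 + int (c div (H * H)) = int q" by (simp_all add: zmod_int zdiv_int a_def b_def q_def)
  show ?thesis
    unfolding set_weights_def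
    apply (intro wp_intros)
    using bq bab bH w2
    by (simp_all add: r0 c(1) e loop[unfolded \<sigma>1_def] del: of_nat_add of_nat_mult)
qed

text \<open>Unresolved entries are required to have a witness, so that a cell of memory 5 is
  positive exactly for them.\<close>

definition unresolved :: "nat \<Rightarrow> nat set \<Rightarrow> state \<Rightarrow> bool" where
  "unresolved \<beta> U \<sigma> \<longleftrightarrow> U \<subseteq> {..<n * n} \<and> (\<forall>x\<in>U. block_witnesses \<beta> x \<noteq> {}) \<and>
    (\<forall>x<n * n. mem \<sigma> 5 (int x) = (if x \<in> U then int (card (block_witnesses \<beta> x)) else 0))"

definition at_scale :: "nat \<Rightarrow> nat \<Rightarrow> nat set \<Rightarrow> nat set" where
  "at_scale \<beta> s U = {x \<in> U. 2 ^ s \<le> card (block_witnesses \<beta> x) \<and> card (block_witnesses \<beta> x) < 2 ^ Suc s}"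

lemma card_block_witnesses_le: "card (block_witnesses \<beta> x \<inter> S) \<le> n"
proof -
  have "card (block_witnesses \<beta> x \<inter> S) \<le> card {..<l}"
    by (rule card_mono) (auto simp: block_witnesses_def)
  then show ?thesis using l by simp
qed

text \<open>As \<open>s < lam\<close>, the power \<open>2 ^ Suc s\<close> is at most
  \<open>2 * n\<close>. So \<open>2 ^ s\<close> is at most \<open>n\<close>, and
  \<open>2 ^ j\<close> costs no more than a factor \<open>8 * n\<close>.\<close>

lemma potential_words:
  assumes s: "s < lam" and j: "j \<le> s + 3" and d: "d \<le> n"
  shows "(s + 3) * 2 ^ j * d \<le> 8 * ((lam + 3) * (n * n))" "(s + 3 + j) * (d * d) \<le> 2 * ((lam + 3) * (n * n))"
proof -
  have "(2::nat) ^ Suc s \<le> 2 ^ lam" using s by (intro power_increasing) auto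
  then have p: "(2::nat) ^ s \<le> n" using lam by simp
  have "(2::nat) ^ j \<le> 2 ^ (s + 3)" using j by (intro power_increasing) auto
  also have "\<dots> = 8 * 2 ^ s" by (simp add: power_add)
  finally have "(2::nat) ^ j \<le> 8 * n" using p by simp
  then have "(s + 3) * 2 ^ j * d \<le> (lam + 3) * (8 * n) * n"
    using s d by (intro mult_mono) auto
  then show "(s + 3) * 2 ^ j * d \<le> 8 * ((lam + 3) * (n * n))" by (simp add: mult_ac)
  have "(s + 3 + j) * (d * d) \<le> (2 * (lam + 3)) * (n * n)"
    using s j d by (intro mult_mono) auto
  then show "(s + 3 + j) * (d * d) \<le> 2 * ((lam + 3) * (n * n))" by (simp add: mult_ac)
qed

lemma le_w2: "k \<le> 10 * ((lam + 3) * (n * n)) * (n * n) \<Longrightarrow> int k \<le> w"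
proof (rule le_w)
  assume k: "k \<le> 10 * ((lam + 3) * (n * n)) * (n * n)"
  have "10 * ((lam + 3) * (n * n)) * (n * n) = (10 * (lam + 3)) * n ^ 4" by (simp add: power4_eq_xxxx mult_ac)
  also have "\<dots> \<le> (100 * (lam + 3)) * (n + 1) ^ 4" by (intro mult_mono power_mono) auto
  finally show "k \<le> 100 * (lam + 3) * (n + 1) ^ 4" using k by linarith
qed

text \<open>Stated for every set \<open>E\<close> of entries because the program accumulates the sum
  entry by entry, and each partial sum must be a word.\<close>

lemma potential_le_w:
  assumes s: "s < lam" and j: "j \<le> s + 3" and E: "E \<subseteq> {..<n * n}"
  shows "\<bar>isolation_potential (s + 3) j E (block_witnesses \<beta>) S\<bar> \<le> w"
proof -
  have fE: "finite E" using E by (rule finite_subset) simp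
  have cE: "card E \<le> n * n" using card_mono[OF _ E] by simp
  have "\<bar>isolation_potential (s + 3) j E (block_witnesses \<beta>) S\<bar> \<le>
      int (card E * ((s + 3) * 2 ^ j * n + (s + 3 + j) * (n * n)))"
    by (rule isolation_potential_bound[OF fE]) (rule card_block_witnesses_le)
  also have "\<dots> \<le> w"
  proof (rule le_w2)
    have "card E * ((s + 3) * 2 ^ j * n + (s + 3 + j) * (n * n)) \<le>
      (n * n) * (8 * ((lam + 3) * (n * n)) + 2 * ((lam + 3) * (n * n)))"
      by (intro mult_le_mono cE add_mono potential_words[OF s j order_refl])
    then show "card E * ((s + 3) * 2 ^ j * n + (s + 3 + j) * (n * n)) \<le> 10 * ((lam + 3) * (n * n)) * (n * n)"
      by (simp add: algebra_simps)
  qed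
  finally show ?thesis .
qed

lemma wp_score:
  assumes env: "env \<sigma>" and U: "unresolved \<beta> U \<sigma>" and s: "s < lam" and j: "j \<le> s + 3"
    and r: "reg \<sigma> 21 = int (s + 3)" "reg \<sigma> 22 = 2 ^ s" "reg \<sigma> 23 = 2 ^ j" "reg \<sigma> 24 = int j"
    and D: "\<And>x. x < n * n \<Longrightarrow> mem \<sigma> 12 (int x) = int (card (block_witnesses \<beta> x \<inter> S))"
    and Q: "\<And>\<sigma>' t'. agree {5, 7, 8, 20} {} \<sigma> \<sigma>' \<Longrightarrow>
      reg \<sigma>' 20 = isolation_potential (s + 3) j (at_scale \<beta> s U) (block_witnesses \<beta>) S \<Longrightarrow>
      t' \<le> t + 70 * (n * n) \<Longrightarrow> Q \<sigma>' t'"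
  shows "wp w score Q \<sigma> t"
proof -
  define G where "G = at_scale \<beta> s U"
  define P where "P = (\<lambda>E. isolation_potential (s + 3) j E (block_witnesses \<beta>) S)"
  have Un: "U \<subseteq> {..<n * n}" and U5: "\<And>x. x < n * n \<Longrightarrow> mem \<sigma> 5 (int x) = (if x \<in> U then int (card (block_witnesses \<beta> x)) else 0)"
    using U by (auto simp: unresolved_def)
  have Gn: "G \<subseteq> {..<n * n}" using Un by (auto simp: G_def at_scale_def)
  define \<sigma>1 where "\<sigma>1 = set_reg \<sigma> 20 0"
  have ag1: "agree {5, 7, 8, 20} {} \<sigma> \<sigma>1" by (simp add: \<sigma>1_def agree_set_reg)
  have nn: "int (n * n) \<le> w" by (rule small) (simp add: algebra_simps)
  have pn: "int (2 * 2 ^ s) \<le> w"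
  proof (rule small1)
    have "(2::nat) ^ Suc s \<le> 2 ^ lam" using s by (intro power_increasing) auto
    then show "2 * 2 ^ s \<le> 100 * (n + 1)" using lam by simp
  qed
  have w2: "2 \<le> w" using small1[of 2] by simp
  have loop: "wp w (For 5 9
     (Asg 8 (Rd 12 (V 5)) ;;
      Asg 7 (Rd 5 (V 5)) ;;
      Cond (V 7) (V 22) Skip
       (Cond (V 7) (N 2 [*] V 22)
         (Asg 20 (V 20 [+] (V 21 [*] V 23 [*] V 8 [-] (V 21 [+] V 24) [*] (V 8 [*] (V 8 [-] N 1)))))
         Skip))) Q \<sigma>1 t1" if t1: "t1 \<le> t + 5" for t1
  proof (rule wp_For[where m = "n * n" and Rs = "{5, 7, 8, 20}" and Ms = "{}" and C = 50 and
        J = "\<lambda>x \<sigma>'. reg \<sigma>' 20 = P (G \<inter> {..<x})"])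
    show "reg \<sigma>1 9 = int (n * n)" using env by (simp add: \<sigma>1_def env_def)
    show "reg (set_reg \<sigma>1 5 0) 20 = P (G \<inter> {..<0})"
      by (simp add: \<sigma>1_def P_def isolation_potential_def)
    fix x \<sigma>' t'
    assume x: "x < n * n" and ag: "agree {5, 7, 8, 20} {} \<sigma>1 \<sigma>'" and rx: "reg \<sigma>' 5 = int x"
      and J: "reg \<sigma>' 20 = P (G \<inter> {..<x})"
    have rr: "reg \<sigma>' 21 = int (s + 3)" "reg \<sigma>' 22 = 2 ^ s" "reg \<sigma>' 23 = 2 ^ j" "reg \<sigma>' 24 = int j"
      using r by (simp_all add: agree_reg[OF ag] \<sigma>1_def)
    define d where "d = card (block_witnesses \<beta> x \<inter> S)"
    have m: "mem \<sigma>' 12 (int x) = int d" "mem \<sigma>' 5 (int x) = (if x \<in> U then int (card (block_witnesses \<beta> x)) else 0)"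
      using D[OF x] U5[OF x] by (simp_all add: agree_mem[OF ag] \<sigma>1_def d_def)
    have d: "d \<le> n" unfolding d_def by (rule card_block_witnesses_le)
    have dw: "int d \<le> w" using small_trans[OF d] by simp
    have cw: "int (card (block_witnesses \<beta> x)) \<le> w"
      using small_trans[OF card_block_witnesses_le[of \<beta> x UNIV]] by simp
    note pw = potential_words[OF s j d]
    have big: "8 * ((lam + 3) * (n * n)) \<le> 10 * ((lam + 3) * (n * n)) * (n * n)"
    proof -
      have "10 * ((lam + 3) * (n * n)) * 1 \<le> 10 * ((lam + 3) * (n * n)) * (n * n)"
        using mult_le_mono[OF n n] by (intro mult_le_mono2) simp
      then show ?thesis by linarith
    qed
    have "(lam + 3) * 1 \<le> (lam + 3) * (n * n)" using mult_le_mono[OF n n] by (intro mult_le_mono2) simp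
    then have "lam + 3 \<le> (lam + 3) * (n * n)" by (simp only: mult_1_right)
    then have sj: "s + 3 + j \<le> 2 * ((lam + 3) * (n * n))" using s j by linarith
    have s2j: "(s + 3) * 2 ^ j \<le> 8 * ((lam + 3) * (n * n))"
      using potential_words(1)[OF s j n] by simp
    have dd: "d * d \<le> n * n" using d by (intro mult_mono) auto
    have "n * n \<le> (lam + 3) * (n * n)" by simp
    then have dd': "d * d \<le> 2 * ((lam + 3) * (n * n))" using dd by linarith
    have w1: "int ((s + 3) * 2 ^ j) \<le> w" "int ((s + 3) * 2 ^ j * d) \<le> w" "int (s + 3 + j) \<le> w"
      "int ((s + 3 + j) * (d * d)) \<le> w" "int (d * d) \<le> w"
      using pw big sj s2j dd' by (intro le_w2, linarith)+
    have a: "0 \<le> int d * (int d - 1)" by (cases d) auto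
    have b: "int d * (int d - 1) \<le> int (d * d)" by (simp add: algebra_simps)
    have e: "0 \<le> int (s + 3 + j) * (int d * (int d - 1))" using a by simp
    have f: "int (s + 3 + j) * (int d * (int d - 1)) \<le> int ((s + 3 + j) * (d * d))"
      using mult_left_mono[OF b, of "int (s + 3 + j)"] by simp
    have g: "0 \<le> int ((s + 3) * 2 ^ j * d)" by simp
    have bounds: "\<bar>int d\<bar> \<le> w" "\<bar>int d - 1\<bar> \<le> w" "\<bar>int d * (int d - 1)\<bar> \<le> w"
      "\<bar>int (s + 3) * 2 ^ j\<bar> \<le> w" "\<bar>int (s + 3) * 2 ^ j * int d\<bar> \<le> w" "\<bar>int (s + 3) + int j\<bar> \<le> w"
      "\<bar>(int (s + 3) + int j) * (int d * (int d - 1))\<bar> \<le> w"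
      "\<bar>int (s + 3) * 2 ^ j * int d - (int (s + 3) + int j) * (int d * (int d - 1))\<bar> \<le> w"
      subgoal using dw by simp
      subgoal using dw w2 by linarith
      subgoal using a b w1(5) by linarith
      subgoal using w1(1) by simp
      subgoal using w1(2) by simp
      subgoal using w1(3) by simp
      subgoal using e f w1(4) by (simp only: of_nat_add)
      subgoal
      proof -
        have "int (s + 3) * 2 ^ j * int d = int ((s + 3) * 2 ^ j * d)"
          "(int (s + 3) + int j) * (int d * (int d - 1)) = int (s + 3 + j) * (int d * (int d - 1))" by simp_all
        then show ?thesis using e f g w1(2,4) by linarith
      qed
      done
    have step: "P (G \<inter> {..<Suc x}) = (if x \<in> G then P (G \<inter> {..<x}) +
       (int (s + 3) * 2 ^ j * int d - (int (s + 3) + int j) * (int d * (int d - 1))) else P (G \<inter> {..<x}))"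
    proof (cases "x \<in> G")
      case True
      then have "G \<inter> {..<Suc x} = insert x (G \<inter> {..<x})" by (auto simp: less_Suc_eq)
      then show ?thesis using True unfolding P_def isolation_potential_def d_def by simp
    next
      case False
      then have "G \<inter> {..<Suc x} = G \<inter> {..<x}" by (auto simp: less_Suc_eq)
      then show ?thesis using False by simp
    qed
    have Pw: "\<bar>P (G \<inter> {..<Suc x})\<bar> \<le> w" unfolding P_def
      by (rule potential_le_w[OF s j]) (use Gn in auto)
    \<comment> \<open>Outside \<open>U\<close> the cell reads 0, which is below
      \<open>2 ^ s\<close>. So two comparisons decide membership in the scale.\<close>
    have xG: "x \<in> G \<longleftrightarrow> \<not> (if x \<in> U then int (card (block_witnesses \<beta> x)) else 0) < 2 ^ s \<and>
        (if x \<in> U then int (card (block_witnesses \<beta> x)) else 0) < 2 * 2 ^ s"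
    proof -
      have "int (card (block_witnesses \<beta> x)) < 2 ^ s \<longleftrightarrow> card (block_witnesses \<beta> x) < 2 ^ s"
        "int (card (block_witnesses \<beta> x)) < 2 * 2 ^ s \<longleftrightarrow> card (block_witnesses \<beta> x) < 2 * 2 ^ s"
        using of_nat_less_iff[where 'a = int, of "card (block_witnesses \<beta> x)" "2 ^ s"]
          of_nat_less_iff[where 'a = int, of "card (block_witnesses \<beta> x)" "2 * 2 ^ s"] by simp_all
      then show ?thesis by (auto simp: G_def at_scale_def not_less)
    qed
    define \<delta> where "\<delta> = (if x \<in> U then int (card (block_witnesses \<beta> x)) else 0)"
    have \<delta>: "\<bar>\<delta>\<bar> \<le> w" using cw w2 by (simp add: \<delta>_def)
    show "wp w (Asg 8 (Rd 12 (V 5)) ;;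
      Asg 7 (Rd 5 (V 5)) ;;
      Cond (V 7) (V 22) Skip
       (Cond (V 7) (N 2 [*] V 22)
         (Asg 20 (V 20 [+] (V 21 [*] V 23 [*] V 8 [-] (V 21 [+] V 24) [*] (V 8 [*] (V 8 [-] N 1)))))
         Skip))
     (\<lambda>\<sigma>'' t''. t'' \<le> t' + 50 \<and> agree {5, 7, 8, 20} {} \<sigma>1 \<sigma>'' \<and> reg \<sigma>'' 5 = int x \<and>
        reg (set_reg \<sigma>'' 5 (int x + 1)) 20 = P (G \<inter> {..<Suc x})) \<sigma>' t'"
      apply (intro wp_intros wp_Skip)
      using bounds \<delta> pn Pw w2 ag
      by (simp_all add: rx rr m \<delta>_def[symmetric] J step xG[folded \<delta>_def] agree_set_reg split del: if_split del: of_nat_add)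
  next
    fix \<sigma>' t'
    assume ag: "agree {5, 7, 8, 20} {} \<sigma>1 \<sigma>'" and J: "reg \<sigma>' 20 = P (G \<inter> {..<n * n})"
      and t': "t' \<le> t1 + n * n * (50 + 3) + 2"
    show "Q \<sigma>' t'"
    proof (rule Q)
      show "agree {5, 7, 8, 20} {} \<sigma> \<sigma>'" by (rule agree_trans[OF ag1 ag]) auto
      have "G \<inter> {..<n * n} = G" using Gn by auto
      then show "reg \<sigma>' 20 = isolation_potential (s + 3) j (at_scale \<beta> s U) (block_witnesses \<beta>) S"
        using J by (simp add: P_def G_def)
      have "1 \<le> n * n" using mult_le_mono[OF n n] by simp
      moreover have "t' \<le> t1 + 53 * (n * n) + 2" using t' by simp
      ultimately show "t' \<le> t + 70 * (n * n)" using t1 by linarith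
    qed
  qed (use w2 nn in auto)
  show ?thesis
    unfolding score_def
    apply (intro wp_intros)
    using w2 by (simp_all add: loop[unfolded \<sigma>1_def])
qed

lemma unresolved_agree: "agree Rs Ms \<sigma> \<sigma>' \<Longrightarrow> 5 \<notin> Ms \<Longrightarrow> unresolved \<beta> U \<sigma> \<Longrightarrow> unresolved \<beta> U \<sigma>'"
  by (simp add: unresolved_def agree_mem)

lemma sample_agree: "agree Rs Ms \<sigma> \<sigma>' \<Longrightarrow> 4 \<notin> Ms \<Longrightarrow> sample S \<sigma> \<Longrightarrow> sample S \<sigma>'"
  by (simp add: sample_def agree_mem)

lemma sum_of_bool_block: "(\<Sum>k\<in>block_witnesses \<beta> x. of_bool (k \<in> S)) = int (card (block_witnesses \<beta> x \<inter> S))"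
  using finite_block_witnesses by (simp add: Int_def)

text \<open>One product together with the quadratic work around it, up to a constant. It is at most
  \<open>2 * T\<close> once \<open>n * n \<le> T\<close> is known.\<close>

definition unit_time :: nat where
  "unit_time = Tm + n * n"

definition select_regs :: "nat set" where
  "select_regs = {2, 3, 5, 7, 8, 13, 14, 15, 16, 17, 18, 19, 20}"

lemma wp_candidate:
  assumes env: "env \<sigma>" and U: "unresolved \<beta> U \<sigma>" and S: "sample S \<sigma>" and b: "reg \<sigma> 6 = int \<beta>" "\<beta> \<le> 2 * n"
    and s: "s < lam" and j: "j \<le> s + 3"
    and r: "reg \<sigma> 21 = int (s + 3)" "reg \<sigma> 22 = 2 ^ s" "reg \<sigma> 23 = 2 ^ j" "reg \<sigma> 24 = int j"
    and c: "reg \<sigma> 17 = int c" "c < H * H * H"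
    and best: "\<bar>reg \<sigma> 18\<bar> \<le> w"
    and Q: "\<And>\<sigma>' t' P. agree (select_regs - {17}) {3, 10, 11, 12} \<sigma> \<sigma>' \<Longrightarrow>
      P = isolation_potential (s + 3) j (at_scale \<beta> s U) (block_witnesses \<beta>) (S \<inter> hash c) \<Longrightarrow>
      (if reg \<sigma> 18 < P then reg \<sigma>' 18 = P \<and> reg \<sigma>' 19 = int c else reg \<sigma>' 18 = reg \<sigma> 18 \<and> reg \<sigma>' 19 = reg \<sigma> 19) \<Longrightarrow>
      t' \<le> t + 300 * unit_time \<Longrightarrow> Q \<sigma>' t'"
  shows "wp w (Asg 16 (V 17) ;; set_weights ;; count ;; score ;;
      Cond (V 18) (V 20) (Asg 18 (V 20) ;; Asg 19 (V 17)) Skip) Q \<sigma> t"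
proof -
  have cw: "int c \<le> w" using c(2) by (intro hash_le_w1) simp
  define \<sigma>0 where "\<sigma>0 = set_reg \<sigma> 16 (int c)"
  have ag0: "agree {16} {} \<sigma> \<sigma>0" by (simp add: \<sigma>0_def agree_set_reg)
  have rest: "wp w (set_weights ;; count ;; score ;; Cond (V 18) (V 20) (Asg 18 (V 20) ;; Asg 19 (V 17)) Skip) Q \<sigma>0 (t + 3)"
  proof (rule wp_Seq, rule wp_set_weights[OF env_agree[OF ag0 env] sample_agree[OF ag0 _ S] _ c(2)])
    show "reg \<sigma>0 16 = int c" by (simp add: \<sigma>0_def)
    fix \<sigma>1 t1
    assume ag1: "agree {3, 13, 14, 15} {3} \<sigma>0 \<sigma>1" and t1: "t1 \<le> t + 3 + 60 * (n * n)"
      and W: "\<And>k. k < l \<Longrightarrow> mem \<sigma>1 3 (int k) = of_bool (k \<in> S \<inter> hash c)"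
    have a1: "agree (select_regs - {17}) {3, 10, 11, 12} \<sigma> \<sigma>1"
      by (rule agree_trans[OF agree_weaken[OF ag0] ag1]) (auto simp: select_regs_def)
    have b1: "reg \<sigma>1 6 = int \<beta>" using agree_reg[OF a1, of 6] b by (simp add: select_regs_def)
    have env1: "env \<sigma>1" by (rule env_agree[OF a1 env]) (auto simp: select_regs_def)
    show "wp w (count ;; score ;; Cond (V 18) (V 20) (Asg 18 (V 20) ;; Asg 19 (V 17)) Skip) Q \<sigma>1 t1"
    proof (rule wp_Seq, rule wp_count[OF env1 b1 b(2)])
      fix k assume "k < l"
      then show "\<bar>mem \<sigma>1 3 (int k)\<bar> \<le> int n" using W n by simp
    next
      fix \<sigma>2 t2
      assume ag2: "agree {2, 3, 7} {10, 11, 12} \<sigma>1 \<sigma>2" and t2: "t2 \<le> t1 + (Tm + 90 * (n * n))"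
        and D: "\<And>x. x < n * n \<Longrightarrow> mem \<sigma>2 12 (int x) = (\<Sum>k\<in>block_witnesses \<beta> x. mem \<sigma>1 3 (int k))"
      have a2: "agree (select_regs - {17}) {3, 10, 11, 12} \<sigma> \<sigma>2"
        by (rule agree_trans[OF a1 ag2]) (auto simp: select_regs_def)
      have D2: "mem \<sigma>2 12 (int x) = int (card (block_witnesses \<beta> x \<inter> (S \<inter> hash c)))" if "x < n * n" for x
        unfolding D[OF that] sum_of_bool_block[symmetric]
        by (rule sum.cong[OF refl]) (rule W, erule block_witnesses_less)
      have env2: "env \<sigma>2" by (rule env_agree[OF a2 env]) (auto simp: select_regs_def)
      have U2: "unresolved \<beta> U \<sigma>2" by (rule unresolved_agree[OF a2 _ U]) simp
      have r2: "reg \<sigma>2 21 = int (s + 3)" "reg \<sigma>2 22 = 2 ^ s" "reg \<sigma>2 23 = 2 ^ j" "reg \<sigma>2 24 = int j"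
        using r by (simp_all add: agree_reg[OF a2] select_regs_def)
      show "wp w (score ;; Cond (V 18) (V 20) (Asg 18 (V 20) ;; Asg 19 (V 17)) Skip) Q \<sigma>2 t2"
      proof (rule wp_Seq, rule wp_score[OF env2 U2 s j r2 D2])
        fix \<sigma>3 t3
        let ?P = "isolation_potential (s + 3) j (at_scale \<beta> s U) (block_witnesses \<beta>) (S \<inter> hash c)"
        assume ag3: "agree {5, 7, 8, 20} {} \<sigma>2 \<sigma>3" and t3: "t3 \<le> t2 + 70 * (n * n)"
          and P: "reg \<sigma>3 20 = ?P"
        have a3: "agree (select_regs - {17}) {3, 10, 11, 12} \<sigma> \<sigma>3"
          by (rule agree_trans[OF a2 ag3]) (auto simp: select_regs_def)
        have r17: "reg \<sigma>3 17 = int c" using agree_reg[OF a3, of 17] c by simp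
        have r18: "reg \<sigma>3 18 = reg \<sigma> 18 \<and> reg \<sigma>3 19 = reg \<sigma> 19"
          by (simp add: agree_reg[OF ag3] agree_reg[OF ag2] agree_reg[OF ag1] agree_reg[OF ag0])
        have Pw: "\<bar>?P\<bar> \<le> w" by (rule potential_le_w[OF s j]) (use U in \<open>auto simp: at_scale_def unresolved_def\<close>)
        have nn: "1 \<le> n * n" using mult_le_mono[OF n n] by simp
        have tt: "t3 + 9 \<le> t + 300 * unit_time"
          using t1 t2 t3 nn unfolding unit_time_def by (simp add: algebra_simps)
        have in_regs: "18 \<in> select_regs - {17}" "19 \<in> select_regs - {17}" by (simp_all add: select_regs_def)
        show "wp w (Cond (V 18) (V 20) (Asg 18 (V 20) ;; Asg 19 (V 17)) Skip) Q \<sigma>3 t3"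
        proof (intro wp_intros wp_Skip)
          assume lt: "ev (V 18) \<sigma>3 < ev (V 20) \<sigma>3"
          show "Q (set_reg (set_reg \<sigma>3 18 (ev (V 20) \<sigma>3)) 19 (ev (V 17) (set_reg \<sigma>3 18 (ev (V 20) \<sigma>3))))
            (t3 + (cost (V 18) + cost (V 20) + 1) + (cost (V 20) + 2) + (cost (V 17) + 2))"
            by (rule Q[OF agree_set_reg[OF agree_set_reg[OF a3]] refl]) (use tt P r17 r18 in_regs lt in simp_all)
        next
          assume lt: "\<not> ev (V 18) \<sigma>3 < ev (V 20) \<sigma>3"
          show "Q \<sigma>3 (t3 + (cost (V 18) + cost (V 20) + 1) + 1)"
            by (rule Q[OF a3 refl]) (use tt P r18 lt in simp_all)
        qed (use Pw cw in \<open>simp_all add: P r17\<close>)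
      qed
    qed
  qed auto
  show ?thesis
  proof (rule wp_Seq, rule wp_Asg)
    show "wp w (set_weights ;; count ;; score ;; Cond (V 18) (V 20) (Asg 18 (V 20) ;; Asg 19 (V 17)) Skip) Q
       (set_reg \<sigma> 16 (ev (V 17) \<sigma>)) (t + (cost (V 17) + 2))"
      using rest c(1) by (simp add: \<sigma>0_def)
  qed (use cw c(1) in simp_all)
qed

text \<open>The guarantee presupposes a positive potential at \<open>Suc j\<close>. The maximum in
  register 18 starts at 0, so a code with nonpositive potential is never recorded. In the positive
  case \<open>exists_pick\<close> provides a code of positive potential, hence the final maximum is
  the potential of the recorded code.\<close>

lemma wp_select:
  assumes env: "env \<sigma>" and U: "unresolved \<beta> U \<sigma>" and S: "sample S \<sigma>" and b: "reg \<sigma> 6 = int \<beta>" "\<beta> \<le> 2 * n"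
    and s: "s < lam" and j: "j < s + 3"
    and r: "reg \<sigma> 21 = int (s + 3)" "reg \<sigma> 22 = 2 ^ s" "reg \<sigma> 23 = 2 ^ j" "reg \<sigma> 24 = int j"
    and Q: "\<And>\<sigma>' t' S'. agree select_regs {3, 4, 10, 11, 12} \<sigma> \<sigma>' \<Longrightarrow> sample S' \<sigma>' \<Longrightarrow>
      (0 < isolation_potential (s + 3) (Suc j) (at_scale \<beta> s U) (block_witnesses \<beta>) S \<Longrightarrow>
       isolation_potential (s + 3) (Suc j) (at_scale \<beta> s U) (block_witnesses \<beta>) S \<le>
        4 * isolation_potential (s + 3) j (at_scale \<beta> s U) (block_witnesses \<beta>) S') \<Longrightarrow>
      t' \<le> t + 600 * (H * H * H) * unit_time \<Longrightarrow> Q \<sigma>' t'"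
  shows "wp w (select count) Q \<sigma> t"
proof -
  let ?G = "at_scale \<beta> s U"
  let ?P = "\<lambda>c. isolation_potential (s + 3) j ?G (block_witnesses \<beta>) (S \<inter> hash c)"
  have Gn: "?G \<subseteq> {..<n * n}" using U by (auto simp: at_scale_def unresolved_def)
  have Pw: "\<bar>?P c\<bar> \<le> w" for c by (rule potential_le_w[OF s _ Gn]) (use j in simp)
  have H3: "1 \<le> H * H * H" using mult_le_mono[OF mult_le_mono[OF H_pos H_pos] H_pos] by simp
  have w2: "2 \<le> w" using small1[of 2] by simp
  have Hw: "int (H * H * H) \<le> w" by (rule hash_le_w1) simp
  have nn: "1 \<le> n * n" "l \<le> n * n" using mult_le_mono[OF n n] mult_le_mono[OF l(2) n] by simp_all
  have copy: "wp w (For 3 1 (Wr 4 (V 3) (Rd 3 (V 3)))) Q \<sigma>1 t1"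
    if ag1: "agree select_regs {3, 10, 11, 12} \<sigma> \<sigma>1" and W: "\<And>k. k < l \<Longrightarrow> mem \<sigma>1 3 (int k) = of_bool (k \<in> S \<inter> hash c)"
      and c: "0 < isolation_potential (s + 3) (Suc j) ?G (block_witnesses \<beta>) S \<Longrightarrow>
        isolation_potential (s + 3) (Suc j) ?G (block_witnesses \<beta>) S \<le> 4 * ?P c"
      and t1: "t1 + 20 * (n * n) \<le> t + 600 * (H * H * H) * unit_time" for \<sigma>1 t1 c
  proof (rule wp_For[where m = l and Rs = "{3}" and Ms = "{4}" and C = 10 and
        J = "\<lambda>k \<sigma>'. \<forall>y<k. mem \<sigma>' 4 (int y) = of_bool (y \<in> S \<inter> hash c)"])
    show "reg \<sigma>1 1 = int l" using agree_reg[OF ag1, of 1] envD(2)[OF env] by (simp add: select_regs_def)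
    show "int l \<le> w" using small1[of l] l by simp
    fix k \<sigma>' t'
    assume k: "k < l" and ag: "agree {3} {4} \<sigma>1 \<sigma>'" and rx: "reg \<sigma>' 3 = int k"
      and J: "\<forall>y<k. mem \<sigma>' 4 (int y) = of_bool (y \<in> S \<inter> hash c)"
    show "wp w (Wr 4 (V 3) (Rd 3 (V 3))) (\<lambda>\<sigma>'' t''. t'' \<le> t' + 10 \<and> agree {3} {4} \<sigma>1 \<sigma>'' \<and> reg \<sigma>'' 3 = int k \<and>
       (\<forall>y<Suc k. mem (set_reg \<sigma>'' 3 (int k + 1)) 4 (int y) = of_bool (y \<in> S \<inter> hash c))) \<sigma>' t'"
      apply (intro wp_intros)
      using J W[OF k] ag by (simp_all add: rx agree_mem[OF ag] agree_set_mem less_Suc_eq)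
  next
    fix \<sigma>' t'
    assume ag: "agree {3} {4} \<sigma>1 \<sigma>'" and J: "\<forall>y<l. mem \<sigma>' 4 (int y) = of_bool (y \<in> S \<inter> hash c)"
      and t': "t' \<le> t1 + l * (10 + 3) + 2"
    show "Q \<sigma>' t'"
    proof (rule Q[OF _ _ c])
      show "agree select_regs {3, 4, 10, 11, 12} \<sigma> \<sigma>'"
        by (rule agree_trans[OF agree_weaken[OF ag1] ag]) (auto simp: select_regs_def)
      show "sample (S \<inter> hash c) \<sigma>'" using J by (simp add: sample_def)
      have "t' \<le> t1 + 13 * l + 2" using t' by simp
      then show "t' \<le> t + 600 * (H * H * H) * unit_time" using t1 nn by linarith
    qed
  qed (use w2 in auto)
  define \<sigma>0 where "\<sigma>0 = set_reg (set_reg \<sigma> 18 0) 19 0"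
  have a0: "agree select_regs {3, 10, 11, 12} \<sigma> \<sigma>0" by (simp add: \<sigma>0_def agree_set_reg select_regs_def)
  have loop: "wp w (For 17 12 (Asg 16 (V 17) ;; set_weights ;; count ;; score ;;
      Cond (V 18) (V 20) (Asg 18 (V 20) ;; Asg 19 (V 17)) Skip))
    (wp w (Asg 16 (V 19) ;; set_weights ;; For 3 1 (Wr 4 (V 3) (Rd 3 (V 3)))) Q) \<sigma>0 (t + 6)"
  proof (rule wp_For[where m = "H * H * H" and Rs = select_regs and Ms = "{3, 10, 11, 12}" and C = "300 * unit_time" and
        J = "\<lambda>k \<sigma>'. \<exists>c. c < H * H * H \<and> reg \<sigma>' 19 = int c \<and> 0 \<le> reg \<sigma>' 18 \<and> (reg \<sigma>' 18 = 0 \<or> reg \<sigma>' 18 = ?P c) \<and>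
          (\<forall>c'<k. ?P c' \<le> reg \<sigma>' 18)"])
    show "reg \<sigma>0 12 = int (H * H * H)" using envD(6)[OF env] by (simp add: \<sigma>0_def)
    show "\<exists>c. c < H * H * H \<and> reg (set_reg \<sigma>0 17 0) 19 = int c \<and> 0 \<le> reg (set_reg \<sigma>0 17 0) 18 \<and>
        (reg (set_reg \<sigma>0 17 0) 18 = 0 \<or> reg (set_reg \<sigma>0 17 0) 18 = ?P c) \<and>
          (\<forall>c'<0. ?P c' \<le> reg (set_reg \<sigma>0 17 0) 18)"
      using H_pos by (intro exI[of _ 0]) (auto simp: \<sigma>0_def)
    fix k \<sigma>' t'
    assume k: "k < H * H * H" and ag: "agree select_regs {3, 10, 11, 12} \<sigma>0 \<sigma>'" and rx: "reg \<sigma>' 17 = int k"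
      and J: "\<exists>c. c < H * H * H \<and> reg \<sigma>' 19 = int c \<and> 0 \<le> reg \<sigma>' 18 \<and> (reg \<sigma>' 18 = 0 \<or> reg \<sigma>' 18 = ?P c) \<and>
          (\<forall>c'<k. ?P c' \<le> reg \<sigma>' 18)"
    have a: "agree select_regs {3, 10, 11, 12} \<sigma> \<sigma>'" by (rule agree_trans[OF a0 ag]) auto
    have env': "env \<sigma>'" by (rule env_agree[OF a env]) (auto simp: select_regs_def)
    have r': "reg \<sigma>' 21 = int (s + 3)" "reg \<sigma>' 22 = 2 ^ s" "reg \<sigma>' 23 = 2 ^ j" "reg \<sigma>' 24 = int j" "reg \<sigma>' 6 = int \<beta>"
      using r b by (simp_all add: agree_reg[OF a] select_regs_def)
    obtain c where c: "c < H * H * H" "reg \<sigma>' 19 = int c" "0 \<le> reg \<sigma>' 18" "reg \<sigma>' 18 = 0 \<or> reg \<sigma>' 18 = ?P c"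
      "\<forall>c'<k. ?P c' \<le> reg \<sigma>' 18" using J by blast
    have best: "\<bar>reg \<sigma>' 18\<bar> \<le> w" using c(4) Pw[of c] w2 by auto
    show "wp w (Asg 16 (V 17) ;; set_weights ;; count ;; score ;;
      Cond (V 18) (V 20) (Asg 18 (V 20) ;; Asg 19 (V 17)) Skip)
      (\<lambda>\<sigma>'' t''. t'' \<le> t' + 300 * unit_time \<and> agree select_regs {3, 10, 11, 12} \<sigma>0 \<sigma>'' \<and> reg \<sigma>'' 17 = int k \<and>
        (\<exists>c. c < H * H * H \<and> reg (set_reg \<sigma>'' 17 (int k + 1)) 19 = int c \<and> 0 \<le> reg (set_reg \<sigma>'' 17 (int k + 1)) 18 \<and>
        (reg (set_reg \<sigma>'' 17 (int k + 1)) 18 = 0 \<or> reg (set_reg \<sigma>'' 17 (int k + 1)) 18 = ?P c) \<and>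
          (\<forall>c'<Suc k. ?P c' \<le> reg (set_reg \<sigma>'' 17 (int k + 1)) 18))) \<sigma>' t'"
    proof (rule wp_candidate[OF env' unresolved_agree[OF a _ U] sample_agree[OF a _ S] r'(5) b(2) s less_imp_le[OF j] r'(1-4) rx k best])
      fix \<sigma>'' t'' P
      assume ag2: "agree (select_regs - {17}) {3, 10, 11, 12} \<sigma>' \<sigma>''" and P: "P = ?P k"
        and upd: "if reg \<sigma>' 18 < P then reg \<sigma>'' 18 = P \<and> reg \<sigma>'' 19 = int k
           else reg \<sigma>'' 18 = reg \<sigma>' 18 \<and> reg \<sigma>'' 19 = reg \<sigma>' 19"
        and t'': "t'' \<le> t' + 300 * unit_time"
      have "agree select_regs {3, 10, 11, 12} \<sigma>0 \<sigma>''" by (rule agree_trans[OF ag ag2]) auto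
      moreover have "reg \<sigma>'' 17 = int k" using agree_reg[OF ag2, of 17] rx by simp
      moreover have "\<exists>c. c < H * H * H \<and> reg \<sigma>'' 19 = int c \<and> 0 \<le> reg \<sigma>'' 18 \<and> (reg \<sigma>'' 18 = 0 \<or> reg \<sigma>'' 18 = ?P c) \<and>
          (\<forall>c'<Suc k. ?P c' \<le> reg \<sigma>'' 18)"
      proof (cases "reg \<sigma>' 18 < P")
        case True
        then have "reg \<sigma>'' 18 = ?P k" "reg \<sigma>'' 19 = int k" "reg \<sigma>' 18 < ?P k" using upd P by simp_all
        moreover have "\<forall>c'<Suc k. ?P c' \<le> ?P k"
          using c(5) \<open>reg \<sigma>' 18 < ?P k\<close> by (force simp: less_Suc_eq)
        ultimately show ?thesis using k c(3) by (intro exI[of _ k]) simp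
      next
        case False
        then have e: "reg \<sigma>'' 18 = reg \<sigma>' 18" "reg \<sigma>'' 19 = reg \<sigma>' 19" "\<not> reg \<sigma>' 18 < ?P k" using upd P by simp_all
        then show ?thesis unfolding e(1,2) using c by (intro exI[of _ c]) (auto simp: less_Suc_eq)
      qed
      ultimately show "t'' \<le> t' + 300 * unit_time \<and> agree select_regs {3, 10, 11, 12} \<sigma>0 \<sigma>'' \<and> reg \<sigma>'' 17 = int k \<and>
        (\<exists>c. c < H * H * H \<and> reg (set_reg \<sigma>'' 17 (int k + 1)) 19 = int c \<and> 0 \<le> reg (set_reg \<sigma>'' 17 (int k + 1)) 18 \<and>
        (reg (set_reg \<sigma>'' 17 (int k + 1)) 18 = 0 \<or> reg (set_reg \<sigma>'' 17 (int k + 1)) 18 = ?P c) \<and>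
          (\<forall>c'<Suc k. ?P c' \<le> reg (set_reg \<sigma>'' 17 (int k + 1)) 18))"
        using t'' by simp
    qed auto
  next
    fix \<sigma>' t'
    assume ag: "agree select_regs {3, 10, 11, 12} \<sigma>0 \<sigma>'" and
      J: "\<exists>c. c < H * H * H \<and> reg \<sigma>' 19 = int c \<and> 0 \<le> reg \<sigma>' 18 \<and> (reg \<sigma>' 18 = 0 \<or> reg \<sigma>' 18 = ?P c) \<and>
          (\<forall>c'<H * H * H. ?P c' \<le> reg \<sigma>' 18)"
      and t': "t' \<le> t + 6 + H * H * H * (300 * unit_time + 3) + 2"
    have a: "agree select_regs {3, 10, 11, 12} \<sigma> \<sigma>'" by (rule agree_trans[OF a0 ag]) auto
    obtain c where c: "c < H * H * H" "reg \<sigma>' 19 = int c" "0 \<le> reg \<sigma>' 18" "reg \<sigma>' 18 = 0 \<or> reg \<sigma>' 18 = ?P c"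
      "\<forall>c'<H * H * H. ?P c' \<le> reg \<sigma>' 18" using J by blast
    have good: "isolation_potential (s + 3) (Suc j) ?G (block_witnesses \<beta>) S \<le> 4 * ?P c"
      if pos: "0 < isolation_potential (s + 3) (Suc j) ?G (block_witnesses \<beta>) S"
    proof -
      have "\<exists>q\<le>(16 * lam) ^ 3. \<exists>a<q. \<exists>b<q. isolation_potential (s + 3) (Suc j) ?G (block_witnesses \<beta>) S
          \<le> 4 * isolation_potential (s + 3) j ?G (block_witnesses \<beta>) (S \<inter> pick q a b)"
      proof (rule exists_pick[OF lam_pos])
        \<comment> \<open>From \<open>s < lam\<close> and \<open>j < s + 3\<close> the sum is at
          most \<open>2 * lam + 3\<close>, and \<open>lam\<close> is positive.\<close>
        show "s + 3 + j \<le> 5 * lam" using s j lam_pos by linarith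
        show "finite ?G" using Gn by (rule finite_subset) simp
        show "block_witnesses \<beta> e \<inter> S \<subseteq> {..<2 ^ lam}" for e
          using lam l by (auto simp: block_witnesses_def)
      qed
      then obtain q a b where q: "q \<le> H" "a < q" "b < q" and le: "isolation_potential (s + 3) (Suc j) ?G (block_witnesses \<beta>) S
          \<le> 4 * isolation_potential (s + 3) j ?G (block_witnesses \<beta>) (S \<inter> pick q a b)"
        unfolding H_def by blast
      from hash_code[OF q] obtain c' where c': "c' < H * H * H" "hash c' = pick q a b" by blast
      then have "?P c' \<le> reg \<sigma>' 18" "isolation_potential (s + 3) (Suc j) ?G (block_witnesses \<beta>) S \<le> 4 * ?P c'"
        using c(5) le by auto
      then have "reg \<sigma>' 18 \<noteq> 0" "isolation_potential (s + 3) (Suc j) ?G (block_witnesses \<beta>) S \<le> 4 * reg \<sigma>' 18"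
        using pos by linarith+
      then show ?thesis using c(4) by simp
    qed
    define \<sigma>2 where "\<sigma>2 = set_reg \<sigma>' 16 (int c)"
    have a2: "agree select_regs {3, 10, 11, 12} \<sigma> \<sigma>2" using a by (simp add: \<sigma>2_def agree_set_reg select_regs_def)
    have env2: "env \<sigma>2" by (rule env_agree[OF a2 env]) (auto simp: select_regs_def)
    have rest: "wp w set_weights (wp w (For 3 1 (Wr 4 (V 3) (Rd 3 (V 3)))) Q) \<sigma>2 (t' + 3)"
    proof (rule wp_set_weights[OF env2 sample_agree[OF a2 _ S] _ c(1)])
      show "reg \<sigma>2 16 = int c" by (simp add: \<sigma>2_def)
      fix \<sigma>3 t3
      assume ag3: "agree {3, 13, 14, 15} {3} \<sigma>2 \<sigma>3" and t3: "t3 \<le> t' + 3 + 60 * (n * n)"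
        and W: "\<And>k. k < l \<Longrightarrow> mem \<sigma>3 3 (int k) = of_bool (k \<in> S \<inter> hash c)"
      show "wp w (For 3 1 (Wr 4 (V 3) (Rd 3 (V 3)))) Q \<sigma>3 t3"
      proof (rule copy[OF _ W good])
        show "agree select_regs {3, 10, 11, 12} \<sigma> \<sigma>3"
          by (rule agree_trans[OF a2 ag3]) (auto simp: select_regs_def)
        define h where "h = H * H * H"
        have "1 \<le> unit_time" "n * n \<le> unit_time" using nn by (auto simp: unit_time_def)
        moreover have "1 * unit_time \<le> h * unit_time" "h * 1 \<le> h * unit_time"
          unfolding h_def by (rule mult_le_mono1[OF H3], rule mult_le_mono2[OF \<open>1 \<le> unit_time\<close>])
        moreover have "t' \<le> t + 6 + (300 * (h * unit_time) + 3 * h) + 2" using t' unfolding h_def by (simp add: algebra_simps)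
        ultimately have "t3 + 20 * (n * n) \<le> t + 600 * (h * unit_time)" using t3 nn by linarith
        then show "t3 + 20 * (n * n) \<le> t + 600 * (H * H * H) * unit_time" by (simp add: h_def mult.assoc)
      qed
    qed auto
    show "wp w (Asg 16 (V 19) ;; set_weights ;; For 3 1 (Wr 4 (V 3) (Rd 3 (V 3)))) Q \<sigma>' t'"
    proof (rule wp_Seq, rule wp_Asg)
      show "wp w (set_weights ;; For 3 1 (Wr 4 (V 3) (Rd 3 (V 3)))) Q
         (set_reg \<sigma>' 16 (ev (V 19) \<sigma>')) (t' + (cost (V 19) + 2))"
        using wp_Seq[OF rest] c(2) by (simp add: \<sigma>2_def)
      have "int c \<le> int (H * H * H)" using c(1) by (intro of_nat_mono) simp
      then show "\<bar>ev (V 19) \<sigma>'\<bar> \<le> w" using c(2) Hw by simp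
    qed simp_all
  qed (use Hw w2 in \<open>auto simp: select_regs_def\<close>)
  show ?thesis
    unfolding select_def
  proof (intro wp_Seq wp_Asg)
    show "wp w (For 17 12 (Asg 16 (V 17) ;; set_weights ;; count ;; score ;; Cond (V 18) (V 20) (Asg 18 (V 20) ;; Asg 19 (V 17)) Skip))
      (wp w (Asg 16 (V 19) ;; set_weights ;; For 3 1 (Wr 4 (V 3) (Rd 3 (V 3)))) Q)
      (set_reg (set_reg \<sigma> 18 (ev (N 0) \<sigma>)) 19 (ev (N 0) (set_reg \<sigma> 18 (ev (N 0) \<sigma>))))
      (t + (cost (N 0) + 2) + (cost (N 0) + 2))"
      using loop by (simp add: \<sigma>0_def add.commute[of 6 t])
  qed (use w2 in simp_all)
qed

end

section \<open>Rounds, scales and complete blocks\<close>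

lemma wp_fill:
  assumes "v < 50" "b < 50" "b \<noteq> v" "a < 13" and b: "reg \<sigma> b = int m" and w: "1 \<le> w" "int m \<le> w"
    and e: "\<And>k \<sigma>'. k < m \<Longrightarrow> agree {v} {a} \<sigma> \<sigma>' \<Longrightarrow> reg \<sigma>' v = int k \<Longrightarrow> defined w e \<sigma>' \<and> ev e \<sigma>' = f k"
    and Q: "\<And>\<sigma>' t'. agree {v} {a} \<sigma> \<sigma>' \<Longrightarrow> (\<And>k. k < m \<Longrightarrow> mem \<sigma>' a (int k) = f k) \<Longrightarrow>
      t' \<le> t + m * (cost e + 5) + 2 \<Longrightarrow> Q \<sigma>' t'"
  shows "wp w (For v b (Wr a (V v) e)) Q \<sigma> t"
proof (rule wp_For[where m = m and Rs = "{v}" and Ms = "{a}" and C = "cost e + 2" and J = "\<lambda>k \<sigma>'. \<forall>y<k. mem \<sigma>' a (int y) = f y"])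
  fix k \<sigma>' t'
  assume k: "k < m" and ag: "agree {v} {a} \<sigma> \<sigma>'" and r: "reg \<sigma>' v = int k" and J: "\<forall>y<k. mem \<sigma>' a (int y) = f y"
  show "wp w (Wr a (V v) e) (\<lambda>\<sigma>'' t''. t'' \<le> t' + (cost e + 2) \<and> agree {v} {a} \<sigma> \<sigma>'' \<and> reg \<sigma>'' v = int k \<and>
      (\<forall>y<Suc k. mem (set_reg \<sigma>'' v (int k + 1)) a (int y) = f y)) \<sigma>' t'"
    by (rule wp_Wr) (use assms(1,4) e[OF k ag r] ag J r in \<open>auto simp: agree_set_mem less_Suc_eq\<close>)
next
  fix \<sigma>' t'
  assume "agree {v} {a} \<sigma> \<sigma>'" "\<forall>y<m. mem \<sigma>' a (int y) = f y" "t' \<le> t + m * (cost e + 2 + 3) + 2"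
  then show "Q \<sigma>' t'" by (intro Q) (auto simp: numeral_eq_Suc)
qed (use assms in auto)

text \<open>Register 8 proposes a column of the block as a witness; the proposal is checked before it is reported.\<close>

definition resolve :: com where
  "resolve = For 5 9
    (Cond (N 0) (Rd 5 (V 5))
      (Asg 8 (Rd 12 (V 5)) ;;
       Cond (V 8) (V 1)
        (Asg 7 (V 6 [+] V 8) ;;
         Cond (V 7) (V 0)
          (Cond (N 0) (Rd 0 (V 5 [div] V 0 [*] V 0 [+] V 7))
            (Cond (N 0) (Rd 1 (V 7 [*] V 0 [+] V 5 [mod] V 0))
              (Wr 2 (V 5) (V 7) ;; Wr 5 (V 5) (N 0))
              Skip)
            Skip)
          Skip)
        Skip)
      Skip)"

text \<open>The index of the potential and the number of halvings made add up to
  \<open>s + 3\<close>. Register 23 is halved before \<open>select\<close>, because the candidates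
  for the next sample are evaluated at the index below the current one.\<close>

definition round_com :: "com \<Rightarrow> com" where
  "round_com cnt =
    For 3 1 (Wr 4 (V 3) (N 1)) ;;
    Asg 23 (N 8 [*] V 22) ;;
    For 25 21
     (Asg 23 (V 23 [div] N 2) ;;
      Asg 24 (V 21 [-] V 25 [-] N 1) ;;
      select cnt) ;;
    For 3 1 (Wr 3 (V 3) (Rd 4 (V 3) [*] V 3)) ;;
    cnt ;;
    resolve"

definition scale :: "com \<Rightarrow> com" where
  "scale cnt = Asg 21 (V 28 [+] N 3) ;; For 26 27 (round_com cnt) ;; Asg 22 (V 22 [*] N 2)"

definition block :: "com \<Rightarrow> com" where
  "block cnt =
    For 3 1 (Wr 3 (V 3) (N 1)) ;;
    cnt ;;
    For 5 9 (Wr 5 (V 5) (Rd 12 (V 5))) ;;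
    Asg 22 (N 1) ;;
    For 28 10 (scale cnt)"

context block_algorithm
begin

text \<open>Compares the output memory with its former contents, so that an entry without witness in
  the present block keeps what an earlier block reported.\<close>

definition progress :: "nat \<Rightarrow> nat set \<Rightarrow> nat set \<Rightarrow> state \<Rightarrow> state \<Rightarrow> bool" where
  "progress \<beta> U U' \<sigma> \<sigma>' \<longleftrightarrow> U' \<subseteq> U \<and> (\<forall>x<n * n.
     if x \<in> U - U' then \<exists>v\<in>block_witnesses \<beta> x. mem \<sigma>' 2 (int x) = int (\<beta> + v)
     else mem \<sigma>' 2 (int x) = mem \<sigma> 2 (int x))"

lemma progress_cong:
  "mem \<sigma> 2 = mem \<tau> 2 \<Longrightarrow> mem \<sigma>' 2 = mem \<tau>' 2 \<Longrightarrow> progress \<beta> U U' \<sigma> \<sigma>' \<longleftrightarrow> progress \<beta> U U' \<tau> \<tau>'"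
  by (simp add: progress_def)

lemma lam_le: "lam \<le> 2 * n"
proof -
  have "lam \<le> 2 ^ lam" by (rule less_imp_le[OF less_exp])
  then show ?thesis using lam(2) by (rule order_trans)
qed

lemma progress_same: "mem \<sigma>' 2 = mem \<sigma> 2 \<Longrightarrow> progress \<beta> U U \<sigma> \<sigma>'"
  by (simp add: progress_def)

lemma progress_trans:
  assumes "progress \<beta> U U' \<sigma> \<sigma>'" "progress \<beta> U' U'' \<sigma>' \<sigma>''"
  shows "progress \<beta> U U'' \<sigma> \<sigma>''"
proof -
  have "if x \<in> U - U'' then \<exists>v\<in>block_witnesses \<beta> x. mem \<sigma>'' 2 (int x) = int (\<beta> + v)
     else mem \<sigma>'' 2 (int x) = mem \<sigma> 2 (int x)" if x: "x < n * n" for x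
  proof -
    have 1: "if x \<in> U - U' then \<exists>v\<in>block_witnesses \<beta> x. mem \<sigma>' 2 (int x) = int (\<beta> + v)
       else mem \<sigma>' 2 (int x) = mem \<sigma> 2 (int x)"
      and 2: "if x \<in> U' - U'' then \<exists>v\<in>block_witnesses \<beta> x. mem \<sigma>'' 2 (int x) = int (\<beta> + v)
       else mem \<sigma>'' 2 (int x) = mem \<sigma>' 2 (int x)"
      and "U' \<subseteq> U" "U'' \<subseteq> U'"
      using assms x by (auto simp: progress_def)
    then show ?thesis by (cases "x \<in> U''"; cases "x \<in> U'"; cases "x \<in> U") auto
  qed
  moreover have "U'' \<subseteq> U" using assms by (auto simp: progress_def)
  ultimately show ?thesis unfolding progress_def by blast
qed

lemma nn_pos: "1 \<le> n * n" "l \<le> n * n"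
  using mult_le_mono[OF n n] mult_le_mono[OF l(2) n] by simp_all

lemma nn_le_w: "int (n * n) \<le> w"
  by (rule small) (simp add: algebra_simps)

lemma l_le_w: "int l \<le> w"
  using small1[of l] l by simp

lemma two_le_w: "2 \<le> w"
  using small1[of 2] by simp

lemma card_block_pos: "x \<in> U \<Longrightarrow> unresolved \<beta> U \<sigma> \<Longrightarrow> 0 < card (block_witnesses \<beta> x)"
  using finite_block_witnesses by (auto simp: unresolved_def card_gt_0_iff)

text \<open>The proposal \<open>v x\<close> may be nonsense: for an entry that is not isolated it is
  a sum of several offsets, or 0. As it is checked against both matrices, a wrong proposal is
  discarded, and one that happens to be a witness is welcome.\<close>

lemma wp_resolve:
  assumes env: "env \<sigma>" and U: "unresolved \<beta> U \<sigma>" and b: "reg \<sigma> 6 = int \<beta>" "\<beta> \<le> 2 * n"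
    and v: "\<And>x. x < n * n \<Longrightarrow> mem \<sigma> 12 (int x) = int (v x) \<and> v x \<le> n * n"
    and Q: "\<And>\<sigma>' t'. agree {5, 7, 8} {2, 5} \<sigma> \<sigma>' \<Longrightarrow> unresolved \<beta> {x \<in> U. v x \<notin> block_witnesses \<beta> x} \<sigma>' \<Longrightarrow>
      progress \<beta> U {x \<in> U. v x \<notin> block_witnesses \<beta> x} \<sigma> \<sigma>' \<Longrightarrow> t' \<le> t + 90 * (n * n) \<Longrightarrow> Q \<sigma>' t'"
  shows "wp w resolve Q \<sigma> t"
proof -
  define hit where "hit = (\<lambda>x. x \<in> U \<and> v x \<in> block_witnesses \<beta> x)"
  let ?W = "\<lambda>x. int (card (block_witnesses \<beta> x))"
  have U5: "mem \<sigma> 5 (int x) = (if x \<in> U then ?W x else 0)" if "x < n * n" for x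
    using U that by (simp add: unresolved_def)
  show ?thesis
    unfolding resolve_def
  proof (rule wp_For[where m = "n * n" and Rs = "{5, 7, 8}" and Ms = "{2, 5}" and C = 60 and
        J = "\<lambda>x \<sigma>'. \<forall>y<n * n. mem \<sigma>' 5 (int y) = (if y \<in> U \<and> \<not> (y < x \<and> hit y) then ?W y else 0) \<and>
          mem \<sigma>' 2 (int y) = (if y < x \<and> hit y then int (\<beta> + v y) else mem \<sigma> 2 (int y))"])
    show "reg \<sigma> 9 = int (n * n)" by (rule envD(3)[OF env])
    show "\<forall>y<n * n. mem (set_reg \<sigma> 5 0) 5 (int y) = (if y \<in> U \<and> \<not> (y < 0 \<and> hit y) then ?W y else 0) \<and>
          mem (set_reg \<sigma> 5 0) 2 (int y) = (if y < 0 \<and> hit y then int (\<beta> + v y) else mem \<sigma> 2 (int y))"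
      using U5 by simp
    fix x \<sigma>' t'
    assume x: "x < n * n" and ag: "agree {5, 7, 8} {2, 5} \<sigma> \<sigma>'" and rx: "reg \<sigma>' 5 = int x"
      and J: "\<forall>y<n * n. mem \<sigma>' 5 (int y) = (if y \<in> U \<and> \<not> (y < x \<and> hit y) then ?W y else 0) \<and>
          mem \<sigma>' 2 (int y) = (if y < x \<and> hit y then int (\<beta> + v y) else mem \<sigma> 2 (int y))"
    have env': "env \<sigma>'" by (rule env_agree[OF ag env]) auto
    have rr: "reg \<sigma>' 0 = int n" "reg \<sigma>' 1 = int l" "reg \<sigma>' 6 = int \<beta>"
      using env' b by (simp_all add: env_def agree_reg[OF ag])
    have m12: "mem \<sigma>' 12 (int x) = int (v x)" using v[OF x] by (simp add: agree_mem[OF ag])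
    have m5: "mem \<sigma>' 5 (int x) = (if x \<in> U then ?W x else 0)" using J x by simp
    have pos: "0 < mem \<sigma>' 5 (int x) \<longleftrightarrow> x \<in> U" unfolding m5 using card_block_pos[OF _ U] by auto
    note xn = div_mod_less[OF x]
    have mA: "\<beta> + v x < n \<Longrightarrow> mem \<sigma>' 0 (int (x div n * n + (\<beta> + v x))) = of_bool (A $$ (x div n, \<beta> + v x))"
      using envD(9)[OF env'] xn by blast
    have mB: "\<beta> + v x < n \<Longrightarrow> mem \<sigma>' 1 (int ((\<beta> + v x) * n + x mod n)) = of_bool (B $$ (\<beta> + v x, x mod n))"
      using envD(10)[OF env'] xn by blast
    have hit: "hit x \<longleftrightarrow> x \<in> U \<and> v x < l \<and> \<beta> + v x < n \<and> A $$ (x div n, \<beta> + v x) \<and> B $$ (\<beta> + v x, x mod n)"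
      by (auto simp: hit_def block_witnesses_def)
    have dn: "x div n * n \<le> n * n" using xn by (intro mult_le_mono) auto
    have dn2: "\<beta> + v x < n \<Longrightarrow> (\<beta> + v x) * n \<le> n * n" by (intro mult_le_mono) auto
    have xm: "x mod n \<le> n" using xn by simp
    have sq: "3 * (n * n) + 3 * n \<le> 100 * ((n + 1) * (n + 1))" by (simp add: algebra_simps)
    have bounds: "int (v x) \<le> w" "int (\<beta> + v x) \<le> w" "int (x div n) \<le> w" "int (x div n * n) \<le> w" "int (x mod n) \<le> w"
      "\<beta> + v x < n \<Longrightarrow> int (x div n * n + (\<beta> + v x)) \<le> w"
      "\<beta> + v x < n \<Longrightarrow> int ((\<beta> + v x) * n) \<le> w" "\<beta> + v x < n \<Longrightarrow> int ((\<beta> + v x) * n + x mod n) \<le> w"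
      subgoal by (rule small) (use v[OF x] sq in linarith)
      subgoal by (rule small) (use v[OF x] sq b in linarith)
      subgoal by (rule small) (use xn sq in linarith)
      subgoal by (rule small) (use dn sq in linarith)
      subgoal by (rule small_trans[OF xm]) simp
      subgoal by (rule small) (use dn sq in linarith)
      subgoal by (rule small) (use dn2 sq in linarith)
      subgoal by (rule small[OF order_trans[OF add_mono[OF dn2 xm]]]) (use sq in auto)
      done
    have e: "int \<beta> + int (v x) = int (\<beta> + v x)" "int x div int n = int (x div n)" "int x mod int n = int (x mod n)"
      "int (x div n) * int n = int (x div n * n)" "int (x div n * n) + int (\<beta> + v x) = int (x div n * n + (\<beta> + v x))"
      "int (\<beta> + v x) * int n = int ((\<beta> + v x) * n)"
      "int ((\<beta> + v x) * n) + int (x mod n) = int ((\<beta> + v x) * n + x mod n)"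
      by (simp_all add: zdiv_int zmod_int)
    have J': "\<And>y. y < n * n \<Longrightarrow> mem \<sigma>' 5 (int y) = (if y \<in> U \<and> \<not> (y < x \<and> hit y) then ?W y else 0)"
      "\<And>y. y < n * n \<Longrightarrow> mem \<sigma>' 2 (int y) = (if y < x \<and> hit y then int (\<beta> + v y) else mem \<sigma> 2 (int y))"
      using J by auto
    have miss: "\<not> hit x \<Longrightarrow> y < n * n \<Longrightarrow>
       mem \<sigma>' 5 (int y) = (if y \<in> U \<and> \<not> (y < Suc x \<and> hit y) then ?W y else 0) \<and>
       mem \<sigma>' 2 (int y) = (if y < Suc x \<and> hit y then int (\<beta> + v y) else mem \<sigma> 2 (int y))" for y
      using J' by (auto simp: less_Suc_eq)
    have succ: "hit x \<Longrightarrow> y < n * n \<Longrightarrow>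
       ((mem \<sigma>' 5)(int x := 0)) (int y) = (if y \<in> U \<and> \<not> (y < Suc x \<and> hit y) then ?W y else 0) \<and>
       ((mem \<sigma>' 2)(int x := int (\<beta> + v x))) (int y) = (if y < Suc x \<and> hit y then int (\<beta> + v y) else mem \<sigma> 2 (int y))" for y
      using J' by (auto simp: less_Suc_eq)
    show "wp w (Cond (N 0) (Rd 5 (V 5))
      (Asg 8 (Rd 12 (V 5)) ;;
       Cond (V 8) (V 1)
        (Asg 7 (V 6 [+] V 8) ;;
         Cond (V 7) (V 0)
          (Cond (N 0) (Rd 0 (V 5 [div] V 0 [*] V 0 [+] V 7))
            (Cond (N 0) (Rd 1 (V 7 [*] V 0 [+] V 5 [mod] V 0))
              (Wr 2 (V 5) (V 7) ;; Wr 5 (V 5) (N 0))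
              Skip)
            Skip)
          Skip)
        Skip)
      Skip)
      (\<lambda>\<sigma>'' t''. t'' \<le> t' + 60 \<and> agree {5, 7, 8} {2, 5} \<sigma> \<sigma>'' \<and> reg \<sigma>'' 5 = int x \<and>
        (\<forall>y<n * n. mem (set_reg \<sigma>'' 5 (int x + 1)) 5 (int y) = (if y \<in> U \<and> \<not> (y < Suc x \<and> hit y) then ?W y else 0) \<and>
          mem (set_reg \<sigma>'' 5 (int x + 1)) 2 (int y) = (if y < Suc x \<and> hit y then int (\<beta> + v y) else mem \<sigma> 2 (int y)))) \<sigma>' t'"
      apply (intro wp_intros wp_Skip)
      using bounds two_le_w ag miss succ
      by (simp_all add: rx rr m12 pos e mA mB hit agree_set_reg agree_set_mem del: of_nat_add of_nat_mult fun_upd_apply split del: if_split)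
  next
    fix \<sigma>' t'
    assume ag: "agree {5, 7, 8} {2, 5} \<sigma> \<sigma>'" and t': "t' \<le> t + n * n * (60 + 3) + 2"
      and J: "\<forall>y<n * n. mem \<sigma>' 5 (int y) = (if y \<in> U \<and> \<not> (y < n * n \<and> hit y) then ?W y else 0) \<and>
          mem \<sigma>' 2 (int y) = (if y < n * n \<and> hit y then int (\<beta> + v y) else mem \<sigma> 2 (int y))"
    show "Q \<sigma>' t'"
    proof (rule Q[OF ag])
      show "unresolved \<beta> {x \<in> U. v x \<notin> block_witnesses \<beta> x} \<sigma>'"
        using U J by (auto simp: unresolved_def hit_def)
      show "progress \<beta> U {x \<in> U. v x \<notin> block_witnesses \<beta> x} \<sigma> \<sigma>'"
        using J by (auto simp: progress_def hit_def)
      have "t' \<le> t + 63 * (n * n) + 2" using t' by simp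
      then show "t' \<le> t + 90 * (n * n)" using nn_pos by linarith
    qed
  qed (use nn_le_w two_le_w in auto)
qed

definition hash_time :: nat where
  "hash_time = H * H * H * unit_time"

lemma time_bounds: "1 \<le> hash_time" "n * n \<le> hash_time" "Tm \<le> hash_time" "l \<le> hash_time"
proof -
  have "1 * 1 * 1 * unit_time \<le> hash_time" unfolding hash_time_def using H_pos by (intro mult_le_mono) auto
  then have "unit_time \<le> hash_time" by simp
  then show "1 \<le> hash_time" "n * n \<le> hash_time" "Tm \<le> hash_time" "l \<le> hash_time"
    using nn_pos unfolding unit_time_def by linarith+
qed

definition round_regs :: "nat set" where
  "round_regs = {2, 3, 5, 7, 8, 13, 14, 15, 16, 17, 18, 19, 20, 23, 24, 25}"

text \<open>The factor 29/32 is 1 - 3/32, where 3/32 is the fraction of entries at scale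
  \<open>s\<close> that the potential guarantees to be isolated by the final sample.\<close>

lemma wp_round:
  assumes env: "env \<sigma>" and U: "unresolved \<beta> U \<sigma>" and b: "reg \<sigma> 6 = int \<beta>" "\<beta> \<le> 2 * n"
    and s: "s < lam" and r: "reg \<sigma> 21 = int (s + 3)" "reg \<sigma> 22 = 2 ^ s"
    and Q: "\<And>\<sigma>' t' U'. agree round_regs {2, 3, 4, 5, 10, 11, 12} \<sigma> \<sigma>' \<Longrightarrow> unresolved \<beta> U' \<sigma>' \<Longrightarrow>
      progress \<beta> U U' \<sigma> \<sigma>' \<Longrightarrow> 32 * card (at_scale \<beta> s U') \<le> 29 * card (at_scale \<beta> s U) \<Longrightarrow>
      t' \<le> t + 3000 * (lam * hash_time) \<Longrightarrow> Q \<sigma>' t'"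
  shows "wp w (round_com count) Q \<sigma> t"
proof -
  let ?G = "at_scale \<beta> s U"
  let ?P = "\<lambda>j S. isolation_potential (s + 3) j ?G (block_witnesses \<beta>) S"
  have Un: "U \<subseteq> {..<n * n}" using U by (simp add: unresolved_def)
  have Gn: "?G \<subseteq> {..<n * n}" using Un by (auto simp: at_scale_def)
  then have fG: "finite ?G" by (rule finite_subset) simp
  have p8: "(8::int) * 2 ^ s \<le> w"
  proof -
    have "(2::nat) ^ Suc s \<le> 2 ^ lam" using s by (intro power_increasing) auto
    then have "int (8 * 2 ^ s) \<le> w" using lam by (intro small1) simp
    then show ?thesis by simp
  qed
  have finish: "wp w (For 3 1 (Wr 3 (V 3) (Rd 4 (V 3) [*] V 3)) ;; count ;; resolve) Q \<sigma>1 t1"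
    if ag1: "agree round_regs {3, 4, 10, 11, 12} \<sigma> \<sigma>1" and S: "sample S \<sigma>1"
      and iso: "3 * card ?G \<le> 32 * card {x \<in> ?G. card (block_witnesses \<beta> x \<inter> S) = 1}"
      and t1: "t1 + 400 * hash_time \<le> t + 3000 * (lam * hash_time)" for \<sigma>1 t1 S
  proof (rule wp_Seq, rule wp_fill[where m = l and f = "\<lambda>k. of_bool (k \<in> S) * int k"])
    have env1: "env \<sigma>1" by (rule env_agree[OF ag1 env]) (auto simp: round_regs_def)
    show "reg \<sigma>1 1 = int l" using env1 by (rule envD)
    show "int l \<le> w" by (rule l_le_w)
    fix k \<sigma>'
    assume k: "k < l" and ag: "agree {3} {3} \<sigma>1 \<sigma>'" and rk: "reg \<sigma>' 3 = int k"
    have "mem \<sigma>' 4 (int k) = of_bool (k \<in> S)" using S k by (simp add: sample_def agree_mem[OF ag])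
    moreover have "int k \<le> w" using k l_le_w by linarith
    ultimately show "defined w (Rd 4 (V 3) [*] V 3) \<sigma>' \<and> ev (Rd 4 (V 3) [*] V 3) \<sigma>' = of_bool (k \<in> S) * int k"
      using rk two_le_w by simp
  next
    fix \<sigma>2 t2
    assume ag2: "agree {3} {3} \<sigma>1 \<sigma>2" and W: "\<And>k. k < l \<Longrightarrow> mem \<sigma>2 3 (int k) = of_bool (k \<in> S) * int k"
      and t2: "t2 \<le> t1 + l * (cost (Rd 4 (V 3) [*] V 3) + 5) + 2"
    have a2: "agree round_regs {3, 4, 10, 11, 12} \<sigma> \<sigma>2"
      by (rule agree_trans[OF ag1 ag2]) (auto simp: round_regs_def)
    have env2: "env \<sigma>2" by (rule env_agree[OF a2 env]) (auto simp: round_regs_def)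
    have b2: "reg \<sigma>2 6 = int \<beta>" using b by (simp add: agree_reg[OF a2] round_regs_def)
    show "wp w (count ;; resolve) Q \<sigma>2 t2"
    proof (rule wp_Seq, rule wp_count[OF env2 b2 b(2)])
      fix k assume "k < l"
      then show "\<bar>mem \<sigma>2 3 (int k)\<bar> \<le> int n" using W l by simp
    next
      fix \<sigma>3 t3
      assume ag3: "agree {2, 3, 7} {10, 11, 12} \<sigma>2 \<sigma>3" and t3: "t3 \<le> t2 + (Tm + 90 * (n * n))"
        and D: "\<And>x. x < n * n \<Longrightarrow> mem \<sigma>3 12 (int x) = (\<Sum>k\<in>block_witnesses \<beta> x. mem \<sigma>2 3 (int k))"
      \<comment> \<open>For an isolated entry this is a sum over a singleton, hence the witness
        itself.\<close>
      define v where "v = (\<lambda>x. \<Sum>(block_witnesses \<beta> x \<inter> S))"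
      have a3: "agree round_regs {3, 4, 10, 11, 12} \<sigma> \<sigma>3"
        by (rule agree_trans[OF a2 ag3]) (auto simp: round_regs_def)
      have env3: "env \<sigma>3" by (rule env_agree[OF a3 env]) (auto simp: round_regs_def)
      have b3: "reg \<sigma>3 6 = int \<beta>" using b by (simp add: agree_reg[OF a3] round_regs_def)
      have U3: "unresolved \<beta> U \<sigma>3" by (rule unresolved_agree[OF a3 _ U]) simp
      have D3: "mem \<sigma>3 12 (int x) = int (v x) \<and> v x \<le> n * n" if x: "x < n * n" for x
      proof
        have "mem \<sigma>3 12 (int x) = (\<Sum>k\<in>block_witnesses \<beta> x. if k \<in> S then int k else 0)"
          unfolding D[OF x] by (rule sum.cong[OF refl]) (use W block_witnesses_less in auto)
        then show "mem \<sigma>3 12 (int x) = int (v x)"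
          
          by (simp add: v_def sum.inter_restrict[OF finite_block_witnesses] if_distrib[of int] cong: if_cong)
        have "v x \<le> (\<Sum>k\<in>block_witnesses \<beta> x \<inter> S. n)"
          unfolding v_def by (rule sum_mono) (use block_witnesses_less l in fastforce)
        also have "\<dots> = card (block_witnesses \<beta> x \<inter> S) * n" by simp
        also have "\<dots> \<le> n * n" by (rule mult_le_mono1) (rule card_block_witnesses_le)
        finally show "v x \<le> n * n" .
      qed
      show "wp w resolve Q \<sigma>3 t3"
      proof (rule wp_resolve[OF env3 U3 b3 b(2) D3])
        fix \<sigma>4 t4
        let ?U = "{x \<in> U. v x \<notin> block_witnesses \<beta> x}"
        assume ag4: "agree {5, 7, 8} {2, 5} \<sigma>3 \<sigma>4" and U4: "unresolved \<beta> ?U \<sigma>4"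
          and pr: "progress \<beta> U ?U \<sigma>3 \<sigma>4" and t4: "t4 \<le> t3 + 90 * (n * n)"
        show "Q \<sigma>4 t4"
        proof (rule Q[OF _ U4])
          show "agree round_regs {2, 3, 4, 5, 10, 11, 12} \<sigma> \<sigma>4"
            by (rule agree_trans[OF agree_weaken[OF a3] ag4]) (auto simp: round_regs_def)
          have "mem \<sigma>3 2 = mem \<sigma> 2" by (simp add: agree_mem[OF a3])
          then show "progress \<beta> U ?U \<sigma> \<sigma>4" using pr progress_cong[of \<sigma>3 \<sigma> \<sigma>4 \<sigma>4] by blast
          have "{x \<in> ?G. card (block_witnesses \<beta> x \<inter> S) = 1} \<subseteq> ?G - at_scale \<beta> s ?U"
          proof safe
            fix x assume x: "card (block_witnesses \<beta> x \<inter> S) = 1" "x \<in> at_scale \<beta> s ?U"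
            from x(1) obtain k where k: "block_witnesses \<beta> x \<inter> S = {k}" using card_1_singletonE by blast
            then have "v x = k" by (simp add: v_def)
            then show False using k x(2) by (auto simp: at_scale_def)
          qed
          then have "card {x \<in> ?G. card (block_witnesses \<beta> x \<inter> S) = 1} \<le> card (?G - at_scale \<beta> s ?U)"
            using fG by (intro card_mono) auto
          also have "\<dots> = card ?G - card (at_scale \<beta> s ?U)"
            using fG by (intro card_Diff_subset finite_subset[OF _ fG]) (auto simp: at_scale_def)
          finally have "card {x \<in> ?G. card (block_witnesses \<beta> x \<inter> S) = 1} \<le> card ?G - card (at_scale \<beta> s ?U)" .
          moreover have "card (at_scale \<beta> s ?U) \<le> card ?G" by (rule card_mono[OF fG]) (auto simp: at_scale_def)
          ultimately show "32 * card (at_scale \<beta> s ?U) \<le> 29 * card ?G" using iso by linarith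
          have "t2 \<le> t1 + 9 * l + 2" using t2 by simp
          then show "t4 \<le> t + 3000 * (lam * hash_time)" using t1 t3 t4 time_bounds by linarith
        qed
      qed
    qed
  qed (use two_le_w in auto)
  define h where "h = lam * hash_time"
  have hh: "hash_time \<le> h" unfolding h_def using mult_le_mono1[OF lam_pos, of hash_time] by simp
  have "wp w (For 25 21
     (Asg 23 (V 23 [div] N 2) ;;
      Asg 24 (V 21 [-] V 25 [-] N 1) ;;
      select count))
     (wp w (For 3 1 (Wr 3 (V 3) (Rd 4 (V 3) [*] V 3)) ;; count ;; resolve) Q) \<sigma>1 t1"
    if ag1: "agree round_regs {3, 4, 10, 11, 12} \<sigma> \<sigma>1" and S: "sample {..<l} \<sigma>1" and r23: "reg \<sigma>1 23 = 2 ^ (s + 3)"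
      and t1: "t1 \<le> t + 20 * hash_time" for \<sigma>1 t1
  \<comment> \<open>The power of 4 absorbs the factor 4 lost in each halving. The inequality starts
    as \<open>isolation_potential_initial\<close> and ends, with \<open>4 ^ 0\<close>, as the
    assumption of \<open>isolation_potential_final\<close>.\<close>
  proof (rule wp_For[where m = "s + 3" and Rs = round_regs and Ms = "{3, 4, 10, 11, 12}" and C = "620 * hash_time" and
        J = "\<lambda>i \<sigma>'. reg \<sigma>' 23 = 2 ^ (s + 3 - i) \<and> (\<exists>S. sample S \<sigma>' \<and>
          3 * int (s + 3) * 4 ^ (s + 3 - i) * int (card ?G) \<le> 32 * ?P (s + 3 - i) S)"])
    show "reg \<sigma>1 21 = int (s + 3)" using r by (simp add: agree_reg[OF ag1] round_regs_def)
    show "int (s + 3) \<le> w"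
    by (rule small1) (use lam_le s in simp)
    show "reg (set_reg \<sigma>1 25 0) 23 = 2 ^ (s + 3 - 0) \<and> (\<exists>S. sample S (set_reg \<sigma>1 25 0) \<and>
          3 * int (s + 3) * 4 ^ (s + 3 - 0) * int (card ?G) \<le> 32 * ?P (s + 3 - 0) S)"
    proof (intro conjI exI[of _ "{..<l}"])
      show "sample {..<l} (set_reg \<sigma>1 25 0)" using S by (simp add: sample_def)
      have "3 * int (s + 3) * 4 ^ (s + 3) * int (card ?G) \<le> 32 * ?P (s + 3) {..<l}"
        by (rule isolation_potential_initial) (auto simp: at_scale_def block_witnesses_def)
      then show "3 * int (s + 3) * 4 ^ (s + 3 - 0) * int (card ?G) \<le> 32 * ?P (s + 3 - 0) {..<l}" by simp
    qed (use r23 in simp)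
    fix i \<sigma>' t'
    assume i: "i < s + 3" and ag: "agree round_regs {3, 4, 10, 11, 12} \<sigma>1 \<sigma>'" and ri: "reg \<sigma>' 25 = int i"
      and J: "reg \<sigma>' 23 = 2 ^ (s + 3 - i) \<and> (\<exists>S. sample S \<sigma>' \<and>
          3 * int (s + 3) * 4 ^ (s + 3 - i) * int (card ?G) \<le> 32 * ?P (s + 3 - i) S)"
    define j where "j = s + 3 - Suc i"
    have j: "s + 3 - i = Suc j" "j < s + 3" "int (s + 3) - int i - 1 = int j" using i by (auto simp: j_def)
    obtain S' where S': "sample S' \<sigma>'" "3 * int (s + 3) * 4 ^ Suc j * int (card ?G) \<le> 32 * ?P (Suc j) S'"
      using J unfolding j(1) by blast
    have a: "agree round_regs {3, 4, 10, 11, 12} \<sigma> \<sigma>'" by (rule agree_trans[OF ag1 ag]) auto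
    define \<sigma>2 where "\<sigma>2 = set_reg (set_reg \<sigma>' 23 (2 ^ j)) 24 (int j)"
    have a2: "agree round_regs {3, 4, 10, 11, 12} \<sigma> \<sigma>2" using a by (simp add: \<sigma>2_def agree_set_reg round_regs_def)
    have a2': "agree round_regs {3, 4, 10, 11, 12} \<sigma>1 \<sigma>2" using ag by (simp add: \<sigma>2_def agree_set_reg round_regs_def)
    have env2: "env \<sigma>2" by (rule env_agree[OF a2 env]) (auto simp: round_regs_def)
    have r2: "reg \<sigma>2 6 = int \<beta>" "reg \<sigma>2 21 = int (s + 3)" "reg \<sigma>2 22 = 2 ^ s" "reg \<sigma>2 23 = 2 ^ j" "reg \<sigma>2 24 = int j"
      using b r by (simp_all add: agree_reg[OF a2] round_regs_def) (simp_all add: \<sigma>2_def)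
    have S2: "sample S' \<sigma>2" using S'(1) by (simp add: sample_def \<sigma>2_def)
    have sel: "wp w (select count)
      (\<lambda>\<sigma>'' t''. t'' \<le> t' + 620 * hash_time \<and> agree round_regs {3, 4, 10, 11, 12} \<sigma>1 \<sigma>'' \<and> reg \<sigma>'' 25 = int i \<and>
        reg (set_reg \<sigma>'' 25 (int i + 1)) 23 = 2 ^ (s + 3 - Suc i) \<and> (\<exists>S. sample S (set_reg \<sigma>'' 25 (int i + 1)) \<and>
          3 * int (s + 3) * 4 ^ (s + 3 - Suc i) * int (card ?G) \<le> 32 * ?P (s + 3 - Suc i) S)) \<sigma>2 t2"
      if t2: "t2 \<le> t' + 12" for t2
    proof (rule wp_select[OF env2 unresolved_agree[OF a2 _ U] S2 r2(1) b(2) s j(2) r2(2-5)])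
      fix \<sigma>'' t'' S''
      assume ag'': "agree select_regs {3, 4, 10, 11, 12} \<sigma>2 \<sigma>''" and S'': "sample S'' \<sigma>''"
        and P: "0 < ?P (Suc j) S' \<Longrightarrow> ?P (Suc j) S' \<le> 4 * ?P j S''"
        and t'': "t'' \<le> t2 + 600 * (H * H * H) * unit_time"
      have "agree round_regs {3, 4, 10, 11, 12} \<sigma>1 \<sigma>''"
        by (rule agree_trans[OF a2' ag'']) (auto simp: round_regs_def select_regs_def)
      moreover have "reg \<sigma>'' 25 = int i" "reg \<sigma>'' 23 = 2 ^ j"
        using ri by (simp_all add: agree_reg[OF ag''] select_regs_def \<sigma>2_def)
      moreover have "3 * int (s + 3) * 4 ^ j * int (card ?G) \<le> 32 * ?P j S''"
      \<comment> \<open>If entries are left at this scale, the invariant makes the potential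
        positive, as the guarantee of \<open>select\<close> presupposes. Otherwise both sides are
        0.\<close>
      proof (cases "card ?G = 0")
        case True
        then have "?G = {}" using fG by simp
        then show ?thesis by (simp add: isolation_potential_def)
      next
        case False
        then have "0 < 3 * int (s + 3) * 4 ^ Suc j * int (card ?G)" by simp
        then have "?P (Suc j) S' \<le> 4 * ?P j S''" using S'(2) by (intro P) linarith
        then have "4 * (3 * int (s + 3) * 4 ^ j * int (card ?G)) \<le> 4 * (32 * ?P j S'')" using S'(2) by simp
        then show ?thesis by (rule mult_left_le_imp_le) simp
      qed
      moreover have "sample S'' (set_reg \<sigma>'' 25 (int i + 1))" using S'' by (simp add: sample_def)
      moreover have "t'' \<le> t' + 620 * hash_time"
        using t'' t2 time_bounds(1) unfolding hash_time_def mult.assoc[of 600] by linarith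
      ultimately show "t'' \<le> t' + 620 * hash_time \<and> agree round_regs {3, 4, 10, 11, 12} \<sigma>1 \<sigma>'' \<and> reg \<sigma>'' 25 = int i \<and>
        reg (set_reg \<sigma>'' 25 (int i + 1)) 23 = 2 ^ (s + 3 - Suc i) \<and> (\<exists>S. sample S (set_reg \<sigma>'' 25 (int i + 1)) \<and>
          3 * int (s + 3) * 4 ^ (s + 3 - Suc i) * int (card ?G) \<le> 32 * ?P (s + 3 - Suc i) S)"
        unfolding j_def[symmetric] by auto
    qed simp
    have sw: "int (s + 3) \<le> w" by fact
    have pj: "(2::int) ^ j \<le> w"
    proof -
      have "(2::int) ^ j \<le> 2 ^ (s + 3)" using j by (intro power_increasing) auto
      then show ?thesis using p8 by (simp add: power_add)
    qed
    have r'': "reg \<sigma>' 21 = int (s + 3)" "reg \<sigma>' 23 = 2 * 2 ^ j"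
      using r J j(1) by (simp_all add: agree_reg[OF a] round_regs_def)
    have ij: "\<bar>int (s + 3) - int i\<bar> \<le> w" "\<bar>int j\<bar> \<le> w" using i sw j by linarith+
    show "wp w (Asg 23 (V 23 [div] N 2) ;; Asg 24 (V 21 [-] V 25 [-] N 1) ;; select count)
      (\<lambda>\<sigma>'' t''. t'' \<le> t' + 620 * hash_time \<and> agree round_regs {3, 4, 10, 11, 12} \<sigma>1 \<sigma>'' \<and> reg \<sigma>'' 25 = int i \<and>
        reg (set_reg \<sigma>'' 25 (int i + 1)) 23 = 2 ^ (s + 3 - Suc i) \<and> (\<exists>S. sample S (set_reg \<sigma>'' 25 (int i + 1)) \<and>
          3 * int (s + 3) * 4 ^ (s + 3 - Suc i) * int (card ?G) \<le> 32 * ?P (s + 3 - Suc i) S)) \<sigma>' t'"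
    proof (intro wp_Seq wp_Asg)
      have e: "set_reg (set_reg \<sigma>' 23 (ev (V 23 [div] N 2) \<sigma>')) 24 (ev (V 21 [-] V 25 [-] N 1) (set_reg \<sigma>' 23 (ev (V 23 [div] N 2) \<sigma>'))) = \<sigma>2"
        unfolding \<sigma>2_def using r'' ri j(3) by (simp del: of_nat_add)
      show "wp w (select count)
      (\<lambda>\<sigma>'' t''. t'' \<le> t' + 620 * hash_time \<and> agree round_regs {3, 4, 10, 11, 12} \<sigma>1 \<sigma>'' \<and> reg \<sigma>'' 25 = int i \<and>
        reg (set_reg \<sigma>'' 25 (int i + 1)) 23 = 2 ^ (s + 3 - Suc i) \<and> (\<exists>S. sample S (set_reg \<sigma>'' 25 (int i + 1)) \<and>
          3 * int (s + 3) * 4 ^ (s + 3 - Suc i) * int (card ?G) \<le> 32 * ?P (s + 3 - Suc i) S))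
       (set_reg (set_reg \<sigma>' 23 (ev (V 23 [div] N 2) \<sigma>')) 24 (ev (V 21 [-] V 25 [-] N 1) (set_reg \<sigma>' 23 (ev (V 23 [div] N 2) \<sigma>'))))
       (t' + (cost (V 23 [div] N 2) + 2) + (cost (V 21 [-] V 25 [-] N 1) + 2))"
        unfolding e by (rule sel) simp
    qed (use pj ij two_le_w in \<open>simp_all add: r'' ri j(3) del: of_nat_add\<close>)
  next
    fix \<sigma>' t'
    assume ag: "agree round_regs {3, 4, 10, 11, 12} \<sigma>1 \<sigma>'" and t': "t' \<le> t1 + (s + 3) * (620 * hash_time + 3) + 2"
      and J: "reg \<sigma>' 23 = 2 ^ (s + 3 - (s + 3)) \<and> (\<exists>S. sample S \<sigma>' \<and>
          3 * int (s + 3) * 4 ^ (s + 3 - (s + 3)) * int (card ?G) \<le> 32 * ?P (s + 3 - (s + 3)) S)"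
    then obtain S where S: "sample S \<sigma>'" "3 * int (s + 3) * int (card ?G) \<le> 32 * ?P 0 S" by auto
    show "wp w (For 3 1 (Wr 3 (V 3) (Rd 4 (V 3) [*] V 3)) ;; count ;; resolve) Q \<sigma>' t'"
    proof (rule finish[OF _ S(1)])
      show "agree round_regs {3, 4, 10, 11, 12} \<sigma> \<sigma>'" by (rule agree_trans[OF ag1 ag]) auto
      show "3 * card ?G \<le> 32 * card {x \<in> ?G. card (block_witnesses \<beta> x \<inter> S) = 1}"
        by (rule isolation_potential_final[OF fG _ S(2)]) simp
      have "(s + 3) * (620 * hash_time + 3) \<le> (lam + 2) * (623 * hash_time)"
        using s time_bounds(1) by (intro mult_le_mono) linarith+
      also have "\<dots> = 623 * h + 1246 * hash_time" by (simp add: h_def algebra_simps)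
      finally have "t' \<le> t1 + 623 * h + 1246 * hash_time + 2" using t' by linarith
      moreover have "t1 + 0 \<le> t + 20 * hash_time" using t1 by simp
      ultimately have "t' + 400 * hash_time \<le> t + 623 * h + 1666 * hash_time + 2 * hash_time" using time_bounds(1) by linarith
      then show "t' + 400 * hash_time \<le> t + 3000 * (lam * hash_time)" using hh unfolding h_def[symmetric] by linarith
    qed
  qed (use two_le_w in \<open>auto simp: round_regs_def\<close>)
  note loop = this
  show ?thesis
    unfolding round_com_def
  proof (rule wp_Seq, rule wp_fill[where m = l and f = "\<lambda>_. 1"])
    show "reg \<sigma> 1 = int l" using env by (rule envD)
    show "int l \<le> w" by (rule l_le_w)
    fix \<sigma>1 t1
    assume ag1: "agree {3} {4} \<sigma> \<sigma>1" and m: "\<And>k. k < l \<Longrightarrow> mem \<sigma>1 4 (int k) = 1" and t1: "t1 \<le> t + l * (cost (N 1) + 5) + 2"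
    have "reg \<sigma>1 22 = 2 ^ s" using r by (simp add: agree_reg[OF ag1])
    show "wp w (Asg 23 (N 8 [*] V 22) ;;
     For 25 21 (Asg 23 (V 23 [div] N 2) ;; Asg 24 (V 21 [-] V 25 [-] N 1) ;; select count) ;;
     For 3 1 (Wr 3 (V 3) (Rd 4 (V 3) [*] V 3)) ;; count ;; resolve) Q \<sigma>1 t1"
    proof (intro wp_Seq wp_Asg loop)
      have ag1': "agree round_regs {3, 4, 10, 11, 12} \<sigma> \<sigma>1" by (rule agree_weaken[OF ag1]) (auto simp: round_regs_def)
      then show "agree round_regs {3, 4, 10, 11, 12} \<sigma> (set_reg \<sigma>1 23 (ev (N 8 [*] V 22) \<sigma>1))"
        by (rule agree_set_reg) (simp add: round_regs_def)
      show "sample {..<l} (set_reg \<sigma>1 23 (ev (N 8 [*] V 22) \<sigma>1))" using m by (simp add: sample_def)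
      show "reg (set_reg \<sigma>1 23 (ev (N 8 [*] V 22) \<sigma>1)) 23 = 2 ^ (s + 3)"
        using \<open>reg \<sigma>1 22 = 2 ^ s\<close> by (simp add: power_add)
      show "t1 + (cost (N 8 [*] V 22) + 2) \<le> t + 20 * hash_time" using t1 time_bounds by simp
      have "8 \<le> w" using p8 one_le_power[of "2::int" s] by linarith
      then show "defined w (N 8 [*] V 22) \<sigma>1" "\<bar>ev (N 8 [*] V 22) \<sigma>1\<bar> \<le> w"
        using p8 \<open>reg \<sigma>1 22 = 2 ^ s\<close> by simp_all
    qed simp
  qed (use two_le_w in auto)
qed

lemma nn_less_4: "n * n < 4 ^ lam"
proof -
  have "n * n < 2 ^ lam * 2 ^ lam" by (rule mult_strict_mono) (use lam n in auto)
  also have "\<dots> = 4 ^ lam" by (simp flip: power_mult_distrib)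
  finally show ?thesis .
qed

text \<open>Sixteen rounds reduce the number of entries by (29/32)^16, which is below 1/4. As
  \<open>n * n < 4 ^ lam\<close>, fewer than one entry is left after \<open>16 * lam\<close>
  rounds.\<close>

lemma decay: "g * 32 ^ (16 * lam) \<le> 29 ^ (16 * lam) * (n * n) \<Longrightarrow> g = 0"
proof (rule ccontr)
  assume le: "g * 32 ^ (16 * lam) \<le> 29 ^ (16 * lam) * (n * n)" and "g \<noteq> 0"
  have "(29::nat) ^ (16 * lam) * 4 ^ lam = (29 ^ 16 * 4) ^ lam"
    by (simp only: power_mult power_mult_distrib)
  also have "\<dots> \<le> (32 ^ 16) ^ lam" by (rule power_mono) simp_all
  also have "\<dots> = 32 ^ (16 * lam)" by (simp only: power_mult)
  finally have "(29::nat) ^ (16 * lam) * 4 ^ lam \<le> 32 ^ (16 * lam)" .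
  moreover have "29 ^ (16 * lam) * (n * n) < 29 ^ (16 * lam) * 4 ^ lam" using nn_less_4 by simp
  moreover have "1 * 32 ^ (16 * lam) \<le> g * 32 ^ (16 * lam)" using \<open>g \<noteq> 0\<close> by (intro mult_le_mono1) simp
  ultimately show False using le by linarith
qed

definition scale_regs :: "nat set" where
  "scale_regs = round_regs \<union> {21, 22, 26}"

text \<open>Scales are treated in increasing order, so no unresolved entry lies below the current
  one. Emptying it therefore raises the lower bound for the witness counts from \<open>2 ^ s\<close>
  to \<open>2 ^ Suc s\<close>.\<close>

lemma wp_scale:
  assumes env: "env \<sigma>" and U: "unresolved \<beta> U \<sigma>" and b: "reg \<sigma> 6 = int \<beta>" "\<beta> \<le> 2 * n"
    and s: "s < lam" and r: "reg \<sigma> 28 = int s" "reg \<sigma> 22 = 2 ^ s"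
    and low: "\<And>x. x \<in> U \<Longrightarrow> 2 ^ s \<le> card (block_witnesses \<beta> x)"
    and Q: "\<And>\<sigma>' t' U'. agree scale_regs {2, 3, 4, 5, 10, 11, 12} \<sigma> \<sigma>' \<Longrightarrow> unresolved \<beta> U' \<sigma>' \<Longrightarrow>
      progress \<beta> U U' \<sigma> \<sigma>' \<Longrightarrow> reg \<sigma>' 22 = 2 ^ Suc s \<Longrightarrow> (\<And>x. x \<in> U' \<Longrightarrow> 2 ^ Suc s \<le> card (block_witnesses \<beta> x)) \<Longrightarrow>
      t' \<le> t + 50000 * (lam * (lam * hash_time)) \<Longrightarrow> Q \<sigma>' t'"
  shows "wp w (scale count) Q \<sigma> t"
proof -
  define h where "h = lam * hash_time"
  have hh: "hash_time \<le> h" unfolding h_def using mult_le_mono1[OF lam_pos, of hash_time] by simp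
  have lh: "lam \<le> lam * h" "h \<le> lam * h"
    using mult_le_mono2[of 1 h lam] mult_le_mono1[OF lam_pos, of h] hh time_bounds(1) by simp_all
  have s3: "int (s + 3) \<le> w"
  by (rule small1) (use lam_le s in simp)
  have p2: "(2::int) ^ Suc s \<le> w"
  proof -
    have "(2::nat) ^ Suc s \<le> 2 ^ lam" using s by (intro power_increasing) auto
    then have "int (2 ^ Suc s) \<le> w" using lam by (intro small1) simp
    then show ?thesis by simp
  qed
  have lw: "int (16 * lam) \<le> w"
  by (rule small1) (use lam_le in simp)
  define \<sigma>1 where "\<sigma>1 = set_reg \<sigma> 21 (int (s + 3))"
  have a1: "agree scale_regs {2, 3, 4, 5, 10, 11, 12} \<sigma> \<sigma>1" by (simp add: \<sigma>1_def agree_set_reg scale_regs_def)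
  have loop: "wp w (For 26 27 (round_com count)) (wp w (Asg 22 (V 22 [*] N 2)) Q) \<sigma>1 (t + 5)"
  proof (rule wp_For[where m = "16 * lam" and Rs = "round_regs \<union> {26}" and Ms = "{2, 3, 4, 5, 10, 11, 12}" and C = "3000 * h" and
        J = "\<lambda>i \<sigma>'. \<exists>U'. unresolved \<beta> U' \<sigma>' \<and> progress \<beta> U U' \<sigma> \<sigma>' \<and>
          card (at_scale \<beta> s U') * 32 ^ i \<le> 29 ^ i * (n * n)"])
    show "reg \<sigma>1 27 = int (16 * lam)" using envD(7)[OF env] by (simp add: \<sigma>1_def)
    have "at_scale \<beta> s U \<subseteq> {..<n * n}" using U by (auto simp: at_scale_def unresolved_def)
    then have "card (at_scale \<beta> s U) \<le> n * n" using card_mono[of "{..<n * n}"] by simp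
    moreover have "unresolved \<beta> U (set_reg \<sigma>1 26 0)" using U by (simp add: \<sigma>1_def unresolved_def)
    moreover have "progress \<beta> U U \<sigma> (set_reg \<sigma>1 26 0)" by (rule progress_same) (simp add: \<sigma>1_def)
    ultimately show "\<exists>U'. unresolved \<beta> U' (set_reg \<sigma>1 26 0) \<and> progress \<beta> U U' \<sigma> (set_reg \<sigma>1 26 0) \<and>
          card (at_scale \<beta> s U') * 32 ^ 0 \<le> 29 ^ 0 * (n * n)" by auto
    fix i \<sigma>' t'
    assume i: "i < 16 * lam" and ag: "agree (round_regs \<union> {26}) {2, 3, 4, 5, 10, 11, 12} \<sigma>1 \<sigma>'" and ri: "reg \<sigma>' 26 = int i"
      and J: "\<exists>U'. unresolved \<beta> U' \<sigma>' \<and> progress \<beta> U U' \<sigma> \<sigma>' \<and> card (at_scale \<beta> s U') * 32 ^ i \<le> 29 ^ i * (n * n)"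
    from J obtain U' where U': "unresolved \<beta> U' \<sigma>'" "progress \<beta> U U' \<sigma> \<sigma>'" "card (at_scale \<beta> s U') * 32 ^ i \<le> 29 ^ i * (n * n)"
      by blast
    have a: "agree scale_regs {2, 3, 4, 5, 10, 11, 12} \<sigma> \<sigma>'"
      by (rule agree_trans[OF a1 ag]) (auto simp: scale_regs_def)
    have env': "env \<sigma>'" by (rule env_agree[OF a env]) (auto simp: scale_regs_def round_regs_def)
    have r': "reg \<sigma>' 6 = int \<beta>" "reg \<sigma>' 21 = int (s + 3)" "reg \<sigma>' 22 = 2 ^ s"
      using b r by (simp_all add: agree_reg[OF ag] round_regs_def \<sigma>1_def)
    show "wp w (round_com count) (\<lambda>\<sigma>'' t''. t'' \<le> t' + 3000 * h \<and> agree (round_regs \<union> {26}) {2, 3, 4, 5, 10, 11, 12} \<sigma>1 \<sigma>'' \<and>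
        reg \<sigma>'' 26 = int i \<and> (\<exists>U'. unresolved \<beta> U' (set_reg \<sigma>'' 26 (int i + 1)) \<and> progress \<beta> U U' \<sigma> (set_reg \<sigma>'' 26 (int i + 1)) \<and>
          card (at_scale \<beta> s U') * 32 ^ Suc i \<le> 29 ^ Suc i * (n * n))) \<sigma>' t'"
    proof (rule wp_round[OF env' U'(1) r'(1) b(2) s r'(2,3)])
      fix \<sigma>'' t'' U''
      assume ag'': "agree round_regs {2, 3, 4, 5, 10, 11, 12} \<sigma>' \<sigma>''" and U'': "unresolved \<beta> U'' \<sigma>''"
        and pr: "progress \<beta> U' U'' \<sigma>' \<sigma>''" and c: "32 * card (at_scale \<beta> s U'') \<le> 29 * card (at_scale \<beta> s U')"
        and t'': "t'' \<le> t' + 3000 * (lam * hash_time)"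
      have "agree (round_regs \<union> {26}) {2, 3, 4, 5, 10, 11, 12} \<sigma>1 \<sigma>''" by (rule agree_trans[OF ag ag'']) auto
      moreover have "reg \<sigma>'' 26 = int i" using ri by (simp add: agree_reg[OF ag''] round_regs_def)
      moreover have "unresolved \<beta> U'' (set_reg \<sigma>'' 26 (int i + 1))" using U'' by (simp add: unresolved_def)
      moreover have "progress \<beta> U U'' \<sigma> (set_reg \<sigma>'' 26 (int i + 1))"
        using progress_trans[OF U'(2) pr] by (simp cong: progress_cong)
      moreover have "card (at_scale \<beta> s U'') * 32 ^ Suc i \<le> 29 ^ Suc i * (n * n)"
      proof -
        have "card (at_scale \<beta> s U'') * 32 ^ Suc i = (32 * card (at_scale \<beta> s U'')) * 32 ^ i" by simp
        also have "\<dots> \<le> (29 * card (at_scale \<beta> s U')) * 32 ^ i" using c by (rule mult_le_mono1)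
        also have "\<dots> = 29 * (card (at_scale \<beta> s U') * 32 ^ i)" by simp
        also have "\<dots> \<le> 29 * (29 ^ i * (n * n))" using U'(3) by (rule mult_le_mono2)
        finally show ?thesis by simp
      qed
      ultimately show "t'' \<le> t' + 3000 * h \<and> agree (round_regs \<union> {26}) {2, 3, 4, 5, 10, 11, 12} \<sigma>1 \<sigma>'' \<and>
        reg \<sigma>'' 26 = int i \<and> (\<exists>U'. unresolved \<beta> U' (set_reg \<sigma>'' 26 (int i + 1)) \<and> progress \<beta> U U' \<sigma> (set_reg \<sigma>'' 26 (int i + 1)) \<and>
          card (at_scale \<beta> s U') * 32 ^ Suc i \<le> 29 ^ Suc i * (n * n))"
        using t'' unfolding h_def by blast
    qed
  next
    fix \<sigma>' t'
    assume ag: "agree (round_regs \<union> {26}) {2, 3, 4, 5, 10, 11, 12} \<sigma>1 \<sigma>'" and t': "t' \<le> t + 5 + 16 * lam * (3000 * h + 3) + 2"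
      and J: "\<exists>U'. unresolved \<beta> U' \<sigma>' \<and> progress \<beta> U U' \<sigma> \<sigma>' \<and> card (at_scale \<beta> s U') * 32 ^ (16 * lam) \<le> 29 ^ (16 * lam) * (n * n)"
    from J obtain U' where U': "unresolved \<beta> U' \<sigma>'" "progress \<beta> U U' \<sigma> \<sigma>'"
      "card (at_scale \<beta> s U') * 32 ^ (16 * lam) \<le> 29 ^ (16 * lam) * (n * n)" by blast
    have "finite U'" using U'(1) by (auto simp: unresolved_def intro: finite_subset)
    then have empty: "at_scale \<beta> s U' = {}" using decay[OF U'(3)] by (simp add: at_scale_def)
    have a: "agree scale_regs {2, 3, 4, 5, 10, 11, 12} \<sigma> \<sigma>'"
      by (rule agree_trans[OF a1 ag]) (auto simp: scale_regs_def)
    have r22: "reg \<sigma>' 22 = 2 ^ s" using r by (simp add: agree_reg[OF ag] round_regs_def \<sigma>1_def)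
    show "wp w (Asg 22 (V 22 [*] N 2)) Q \<sigma>' t'"
    proof (rule wp_Asg)
      show "Q (set_reg \<sigma>' 22 (ev (V 22 [*] N 2) \<sigma>')) (t' + (cost (V 22 [*] N 2) + 2))"
      proof (rule Q)
        show "agree scale_regs {2, 3, 4, 5, 10, 11, 12} \<sigma> (set_reg \<sigma>' 22 (ev (V 22 [*] N 2) \<sigma>'))"
          using a by (rule agree_set_reg) (simp add: scale_regs_def)
        show "unresolved \<beta> U' (set_reg \<sigma>' 22 (ev (V 22 [*] N 2) \<sigma>'))" using U'(1) by (simp add: unresolved_def)
        show "progress \<beta> U U' \<sigma> (set_reg \<sigma>' 22 (ev (V 22 [*] N 2) \<sigma>'))" using U'(2) by (simp cong: progress_cong)
        show "reg (set_reg \<sigma>' 22 (ev (V 22 [*] N 2) \<sigma>')) 22 = 2 ^ Suc s" using r22 by simp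
        show "2 ^ Suc s \<le> card (block_witnesses \<beta> x)" if "x \<in> U'" for x
        proof (rule ccontr)
          assume "\<not> 2 ^ Suc s \<le> card (block_witnesses \<beta> x)"
          moreover have "x \<in> U" using U'(2) that by (auto simp: progress_def)
          ultimately have "x \<in> at_scale \<beta> s U'" using low that by (simp add: at_scale_def)
          then show False using empty by simp
        qed
        have "t' \<le> t + 7 + 48000 * (lam * h) + 48 * lam" using t' by (simp add: algebra_simps)
        then have "t' + 5 \<le> t + 50000 * (lam * h)" using lh lam_pos by linarith
        then show "t' + (cost (V 22 [*] N 2) + 2) \<le> t + 50000 * (lam * (lam * hash_time))"
          unfolding h_def by simp
      qed
    qed (use r22 p2 two_le_w in \<open>simp_all add: mult.commute\<close>)
  qed (use lw two_le_w in \<open>auto simp: round_regs_def\<close>)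
  show ?thesis
    unfolding scale_def
  proof (intro wp_Seq wp_Asg)
    have "set_reg \<sigma> 21 (ev (V 28 [+] N 3) \<sigma>) = \<sigma>1" using r by (simp add: \<sigma>1_def)
    then show "wp w (For 26 27 (round_com count)) (wp w (Asg 22 (V 22 [*] N 2)) Q) (set_reg \<sigma> 21 (ev (V 28 [+] N 3) \<sigma>))
      (t + (cost (V 28 [+] N 3) + 2))" using loop by (simp add: add.commute[of 5 t])
  qed (use s3 r in simp_all)
qed

definition block_regs :: "nat set" where
  "block_regs = scale_regs \<union> {28}"

text \<open>The three factors \<open>lam\<close> stand for the scales, the rounds of a scale and the
  halvings of a round; \<open>hash_time\<close> stands for one search. A cost factor of 3000 per
  round and \<open>16 * lam\<close> rounds give 48000, rounded up to 50000 for a scale and to 60000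
  for the block.\<close>

definition block_time :: nat where
  "block_time = 60000 * (lam * (lam * (lam * hash_time)))"

text \<open>After \<open>lam\<close> scales an unresolved entry would need at least
  \<open>2 ^ lam\<close> witnesses, which is more than \<open>n\<close>. So none is left.\<close>

lemma wp_block:
  assumes env: "env \<sigma>" and b: "reg \<sigma> 6 = int \<beta>" "\<beta> \<le> 2 * n"
    and Q: "\<And>\<sigma>' t'. agree block_regs {2, 3, 4, 5, 10, 11, 12} \<sigma> \<sigma>' \<Longrightarrow>
      (\<And>x. x < n * n \<Longrightarrow> if block_witnesses \<beta> x \<noteq> {} then \<exists>v\<in>block_witnesses \<beta> x. mem \<sigma>' 2 (int x) = int (\<beta> + v)
         else mem \<sigma>' 2 (int x) = mem \<sigma> 2 (int x)) \<Longrightarrow>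
      t' \<le> t + block_time \<Longrightarrow> Q \<sigma>' t'"
  shows "wp w (block count) Q \<sigma> t"
  unfolding block_def
proof (rule wp_Seq, rule wp_fill[where m = l and f = "\<lambda>_. 1"])
  show "reg \<sigma> 1 = int l" using env by (rule envD)
  show "int l \<le> w" by (rule l_le_w)
  fix \<sigma>1 t1
  assume ag1: "agree {3} {3} \<sigma> \<sigma>1" and m3: "\<And>k. k < l \<Longrightarrow> mem \<sigma>1 3 (int k) = 1" and t1: "t1 \<le> t + l * (cost (N 1) + 5) + 2"
  have a1: "agree block_regs {2, 3, 4, 5, 10, 11, 12} \<sigma> \<sigma>1"
    by (rule agree_weaken[OF ag1]) (auto simp: block_regs_def scale_regs_def round_regs_def)
  have env1: "env \<sigma>1" by (rule env_agree[OF ag1 env]) auto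
  have b1: "reg \<sigma>1 6 = int \<beta>" using b by (simp add: agree_reg[OF ag1])
  show "wp w (count ;; For 5 9 (Wr 5 (V 5) (Rd 12 (V 5))) ;; Asg 22 (N 1) ;; For 28 10 (scale count)) Q \<sigma>1 t1"
  proof (rule wp_Seq, rule wp_count[OF env1 b1 b(2)])
    fix k assume "k < l"
    then show "\<bar>mem \<sigma>1 3 (int k)\<bar> \<le> int n" using m3 n by simp
  next
    fix \<sigma>2 t2
    assume ag2: "agree {2, 3, 7} {10, 11, 12} \<sigma>1 \<sigma>2" and t2: "t2 \<le> t1 + (Tm + 90 * (n * n))"
      and D: "\<And>x. x < n * n \<Longrightarrow> mem \<sigma>2 12 (int x) = (\<Sum>k\<in>block_witnesses \<beta> x. mem \<sigma>1 3 (int k))"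
    have a2: "agree block_regs {2, 3, 4, 5, 10, 11, 12} \<sigma> \<sigma>2"
      by (rule agree_trans[OF a1 ag2]) (auto simp: block_regs_def scale_regs_def round_regs_def)
    have D2: "mem \<sigma>2 12 (int x) = int (card (block_witnesses \<beta> x))" if "x < n * n" for x
    proof -
      have "mem \<sigma>2 12 (int x) = (\<Sum>k\<in>block_witnesses \<beta> x. 1)"
        unfolding D[OF that] by (rule sum.cong[OF refl]) (rule m3, erule block_witnesses_less)
      then show ?thesis by simp
    qed
    show "wp w (For 5 9 (Wr 5 (V 5) (Rd 12 (V 5))) ;; Asg 22 (N 1) ;; For 28 10 (scale count)) Q \<sigma>2 t2"
    proof (rule wp_Seq, rule wp_fill[where m = "n * n" and f = "\<lambda>x. int (card (block_witnesses \<beta> x))"])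
      have env2: "env \<sigma>2" by (rule env_agree[OF ag2 env1]) auto
      then show "reg \<sigma>2 9 = int (n * n)" by (rule envD)
      fix k \<sigma>' assume "k < n * n" "agree {5} {5} \<sigma>2 \<sigma>'" "reg \<sigma>' 5 = int k"
      then show "defined w (Rd 12 (V 5)) \<sigma>' \<and> ev (Rd 12 (V 5)) \<sigma>' = int (card (block_witnesses \<beta> k))"
        using D2 by (simp add: agree_mem)
    next
      fix \<sigma>3 t3
      assume ag3: "agree {5} {5} \<sigma>2 \<sigma>3" and t3: "t3 \<le> t2 + n * n * (cost (Rd 12 (V 5)) + 5) + 2"
        and D3: "\<And>x. x < n * n \<Longrightarrow> mem \<sigma>3 5 (int x) = int (card (block_witnesses \<beta> x))"
      define U where "U = {x. x < n * n \<and> block_witnesses \<beta> x \<noteq> {}}"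
      define \<sigma>4 where "\<sigma>4 = set_reg \<sigma>3 22 1"
      have a4: "agree block_regs {2, 3, 4, 5, 10, 11, 12} \<sigma> \<sigma>4"
        unfolding \<sigma>4_def by (rule agree_set_reg[OF agree_trans[OF a2 ag3]]) (auto simp: block_regs_def scale_regs_def round_regs_def)
      have m2: "mem \<sigma>4 2 = mem \<sigma> 2" by (simp add: \<sigma>4_def agree_mem[OF ag3] agree_mem[OF ag2] agree_mem[OF ag1])
      have env4: "env \<sigma>4" by (rule env_agree[OF a4 env]) (auto simp: block_regs_def scale_regs_def round_regs_def)
      have U4: "unresolved \<beta> U \<sigma>4" using D3 by (auto simp: unresolved_def U_def \<sigma>4_def)
      have lw: "int lam \<le> w"
      by (rule small1) (use lam_le in simp)
      define h where "h = lam * (lam * hash_time)"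
      have loop: "wp w (For 28 10 (scale count)) Q \<sigma>4 (t3 + 3)"
      proof (rule wp_For[where m = lam and Rs = block_regs and Ms = "{2, 3, 4, 5, 10, 11, 12}" and C = "50000 * h" and
          J = "\<lambda>s \<sigma>'. \<exists>U'. unresolved \<beta> U' \<sigma>' \<and> progress \<beta> U U' \<sigma> \<sigma>' \<and> reg \<sigma>' 22 = 2 ^ s \<and>
            (\<forall>x\<in>U'. 2 ^ s \<le> card (block_witnesses \<beta> x))"])
        show "reg \<sigma>4 10 = int lam" by (rule envD(4)[OF env4])
        have "unresolved \<beta> U (set_reg \<sigma>4 28 0)" using U4 by (simp add: unresolved_def)
        moreover have "progress \<beta> U U \<sigma> (set_reg \<sigma>4 28 0)" by (rule progress_same) (simp add: m2)
        moreover have "\<forall>x\<in>U. 2 ^ 0 \<le> card (block_witnesses \<beta> x)"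
          using card_block_pos[OF _ U4] by (auto simp: Suc_le_eq One_nat_def)
        ultimately show "\<exists>U'. unresolved \<beta> U' (set_reg \<sigma>4 28 0) \<and> progress \<beta> U U' \<sigma> (set_reg \<sigma>4 28 0) \<and> reg (set_reg \<sigma>4 28 0) 22 = 2 ^ 0 \<and>
            (\<forall>x\<in>U'. 2 ^ 0 \<le> card (block_witnesses \<beta> x))" by (intro exI[of _ U]) (simp add: \<sigma>4_def)
        fix s \<sigma>' t'
        assume s: "s < lam" and ag: "agree block_regs {2, 3, 4, 5, 10, 11, 12} \<sigma>4 \<sigma>'" and rs: "reg \<sigma>' 28 = int s"
          and J: "\<exists>U'. unresolved \<beta> U' \<sigma>' \<and> progress \<beta> U U' \<sigma> \<sigma>' \<and> reg \<sigma>' 22 = 2 ^ s \<and>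
            (\<forall>x\<in>U'. 2 ^ s \<le> card (block_witnesses \<beta> x))"
        from J obtain U' where U': "unresolved \<beta> U' \<sigma>'" "progress \<beta> U U' \<sigma> \<sigma>'" "reg \<sigma>' 22 = 2 ^ s"
            "\<And>x. x \<in> U' \<Longrightarrow> 2 ^ s \<le> card (block_witnesses \<beta> x)" by blast
        have a: "agree block_regs {2, 3, 4, 5, 10, 11, 12} \<sigma> \<sigma>'" by (rule agree_trans[OF a4 ag]) auto
        have env': "env \<sigma>'" by (rule env_agree[OF a env]) (auto simp: block_regs_def scale_regs_def round_regs_def)
        have b': "reg \<sigma>' 6 = int \<beta>" using b by (simp add: agree_reg[OF a] block_regs_def scale_regs_def round_regs_def)
        show "wp w (scale count) (\<lambda>\<sigma>'' t''. t'' \<le> t' + 50000 * h \<and> agree block_regs {2, 3, 4, 5, 10, 11, 12} \<sigma>4 \<sigma>'' \<and> reg \<sigma>'' 28 = int s \<and>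
          (\<exists>U'. unresolved \<beta> U' (set_reg \<sigma>'' 28 (int s + 1)) \<and> progress \<beta> U U' \<sigma> (set_reg \<sigma>'' 28 (int s + 1)) \<and>
            reg (set_reg \<sigma>'' 28 (int s + 1)) 22 = 2 ^ Suc s \<and> (\<forall>x\<in>U'. 2 ^ Suc s \<le> card (block_witnesses \<beta> x)))) \<sigma>' t'"
        proof (rule wp_scale[OF env' U'(1) b' b(2) s rs U'(3,4)])
          fix \<sigma>'' t'' U''
          assume ag'': "agree scale_regs {2, 3, 4, 5, 10, 11, 12} \<sigma>' \<sigma>''" and U'': "unresolved \<beta> U'' \<sigma>''"
            and pr: "progress \<beta> U' U'' \<sigma>' \<sigma>''" and r22: "reg \<sigma>'' 22 = 2 ^ Suc s"
            and low: "\<And>x. x \<in> U'' \<Longrightarrow> 2 ^ Suc s \<le> card (block_witnesses \<beta> x)"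
            and t'': "t'' \<le> t' + 50000 * (lam * (lam * hash_time))"
          have "agree block_regs {2, 3, 4, 5, 10, 11, 12} \<sigma>4 \<sigma>''"
            by (rule agree_trans[OF ag ag'']) (auto simp: block_regs_def)
          moreover have "reg \<sigma>'' 28 = int s" using rs by (simp add: agree_reg[OF ag''] scale_regs_def round_regs_def)
          moreover have "unresolved \<beta> U'' (set_reg \<sigma>'' 28 (int s + 1))" using U'' by (simp add: unresolved_def)
          moreover have "progress \<beta> U U'' \<sigma> (set_reg \<sigma>'' 28 (int s + 1))"
            using progress_trans[OF U'(2) pr] by (simp cong: progress_cong)
          moreover have "reg (set_reg \<sigma>'' 28 (int s + 1)) 22 = 2 ^ Suc s" using r22 by simp
          ultimately show "t'' \<le> t' + 50000 * h \<and> agree block_regs {2, 3, 4, 5, 10, 11, 12} \<sigma>4 \<sigma>'' \<and> reg \<sigma>'' 28 = int s \<and>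
          (\<exists>U'. unresolved \<beta> U' (set_reg \<sigma>'' 28 (int s + 1)) \<and> progress \<beta> U U' \<sigma> (set_reg \<sigma>'' 28 (int s + 1)) \<and>
            reg (set_reg \<sigma>'' 28 (int s + 1)) 22 = 2 ^ Suc s \<and> (\<forall>x\<in>U'. 2 ^ Suc s \<le> card (block_witnesses \<beta> x)))"
            using t'' low unfolding h_def by blast
        qed
      next
        fix \<sigma>' t'
        assume ag: "agree block_regs {2, 3, 4, 5, 10, 11, 12} \<sigma>4 \<sigma>'" and t': "t' \<le> t3 + 3 + lam * (50000 * h + 3) + 2"
          and J: "\<exists>U'. unresolved \<beta> U' \<sigma>' \<and> progress \<beta> U U' \<sigma> \<sigma>' \<and> reg \<sigma>' 22 = 2 ^ lam \<and>
            (\<forall>x\<in>U'. 2 ^ lam \<le> card (block_witnesses \<beta> x))"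
        then obtain U' where U': "unresolved \<beta> U' \<sigma>'" "progress \<beta> U U' \<sigma> \<sigma>'"
            "\<And>x. x \<in> U' \<Longrightarrow> 2 ^ lam \<le> card (block_witnesses \<beta> x)" by blast
        have "card (block_witnesses \<beta> x) < 2 ^ lam" for x
          using card_block_witnesses_le[of \<beta> x UNIV] lam by simp
        then have empty: "U' = {}" using U'(3) by (meson equals0I not_less)
        show "Q \<sigma>' t'"
        proof (rule Q)
          show "agree block_regs {2, 3, 4, 5, 10, 11, 12} \<sigma> \<sigma>'" by (rule agree_trans[OF a4 ag]) auto
          show "if block_witnesses \<beta> x \<noteq> {} then \<exists>v\<in>block_witnesses \<beta> x. mem \<sigma>' 2 (int x) = int (\<beta> + v)
            else mem \<sigma>' 2 (int x) = mem \<sigma> 2 (int x)" if "x < n * n" for x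
            using U'(2) that unfolding empty progress_def by (simp add: U_def del: of_nat_add)
          have "hash_time \<le> lam * hash_time" "lam * hash_time \<le> h" "h \<le> lam * h"
            using mult_le_mono1[OF lam_pos, of hash_time] mult_le_mono1[OF lam_pos, of "lam * hash_time"]
              mult_le_mono1[OF lam_pos, of h] by (simp_all add: h_def)
          moreover have "lam \<le> lam * hash_time" using mult_le_mono2[OF time_bounds(1), of lam] by simp
          moreover have "t1 \<le> t + 6 * l + 2" using t1 by simp
          moreover have "t3 \<le> t2 + 7 * (n * n) + 2" using t3 by simp
          moreover have "t' \<le> t3 + 5 + 50000 * (lam * h) + 3 * lam" using t' by (simp add: algebra_simps)
          ultimately show "t' \<le> t + block_time"
            using t2 time_bounds unfolding block_time_def h_def[symmetric] by linarith
        qed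
      qed (use lw two_le_w in \<open>auto simp: block_regs_def scale_regs_def round_regs_def\<close>)
      show "wp w (Asg 22 (N 1) ;; For 28 10 (scale count)) Q \<sigma>3 t3"
      proof (intro wp_Seq wp_Asg)
        show "wp w (For 28 10 (scale count)) Q (set_reg \<sigma>3 22 (ev (N 1) \<sigma>3)) (t3 + (cost (N 1) + 2))"
          using loop by (simp add: \<sigma>4_def add.commute[of 3 t3])
      qed (use two_le_w in simp_all)
    qed (use nn_le_w two_le_w in auto)
  qed
qed (use two_le_w in auto)

end

section \<open>Reporting witnesses\<close>

definition blocks :: "com \<Rightarrow> com" where
  "blocks cnt = For 29 30 (Asg 6 (V 29 [*] V 1) ;; block cnt)"

text \<open>The bit length is found by guarded doubling. The loop makes \<open>n\<close> iterations
  because \<open>For\<close> needs a bound that is at hand; they suffice since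
  \<open>lam \<le> n\<close>, and their cost is negligible against \<open>n * n\<close>. The output
  is preset to the value for zero entries.\<close>

definition init_com :: com where
  "init_com =
    Asg 9 (V 0 [*] V 0) ;;
    Asg 33 (V 0 [*] V 1) ;;
    Asg 30 ((V 0 [+] V 1 [-] N 1) [div] V 1) ;;
    Asg 10 (N 0) ;;
    Asg 22 (N 1) ;;
    For 5 0 (Cond (V 0) (V 22) Skip (Asg 22 (V 22 [*] N 2) ;; Asg 10 (V 10 [+] N 1))) ;;
    Asg 27 (N 16 [*] V 10) ;;
    Asg 11 (V 27 [*] V 27 [*] V 27) ;;
    Asg 12 (V 11 [*] V 11 [*] V 11) ;;
    For 5 9 (Wr 2 (V 5) (N (- 1)))"

definition report :: "com \<Rightarrow> com" where
  "report p = init_com ;; blocks (block_algorithm.count p)"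

context block_algorithm
begin

section \<open>The invariant over the blocks\<close>

definition seen :: "nat \<Rightarrow> nat \<Rightarrow> nat set" where
  "seen m x = {k. k < m \<and> k < n \<and> A $$ (x div n, k) \<and> B $$ (k, x mod n)}"

definition block_count :: nat where
  "block_count = (n + l - 1) div l"

lemma block_count_covers: "n \<le> block_count * l"
proof -
  have "(n + l - 1) mod l < l" using l by simp
  moreover have "(n + l - 1) div l * l + (n + l - 1) mod l = n + l - 1" by simp
  ultimately show ?thesis using l unfolding block_count_def by linarith
qed

lemma block_start_less: "i < block_count \<Longrightarrow> i * l < n"
proof -
  assume "i < block_count"
  then have "Suc i * l \<le> block_count * l" by (intro mult_le_mono1) simp
  also have "\<dots> \<le> n + l - 1" unfolding block_count_def by (rule div_times_less_eq_dividend)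
  finally show ?thesis using l by simp
qed

lemma block_count_le: "block_count \<le> n"
proof (cases "block_count = 0")
  case False
  then have "(block_count - 1) * l < n" by (intro block_start_less) simp
  moreover have "(block_count - 1) * 1 \<le> (block_count - 1) * l" using l by (intro mult_le_mono2)
  ultimately have "block_count - 1 < n" unfolding mult_1_right by linarith
  then show ?thesis by linarith
qed simp

lemma seen_next: "seen (Suc i * l) x = seen (i * l) x \<union> (\<lambda>v. i * l + v) ` block_witnesses (i * l) x"
proof (intro equalityI subsetI)
  fix k assume k: "k \<in> seen (Suc i * l) x"
  show "k \<in> seen (i * l) x \<union> (\<lambda>v. i * l + v) ` block_witnesses (i * l) x"
  proof (cases "k < i * l")
    case False
    then have "k = i * l + (k - i * l)" "k - i * l \<in> block_witnesses (i * l) x"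
      using k by (auto simp: seen_def block_witnesses_def)
    then show ?thesis by blast
  qed (use k in \<open>auto simp: seen_def\<close>)
qed (auto simp: seen_def block_witnesses_def)

text \<open>The invariant says that the reported witness lies in the last block that contains one.\<close>

definition reported :: "nat \<Rightarrow> state \<Rightarrow> bool" where
  "reported m \<sigma> \<longleftrightarrow> (\<forall>x<n * n.
    if seen m x = {} then mem \<sigma> 2 (int x) = - 1
    else \<exists>k\<in>seen m x. mem \<sigma> 2 (int x) = int k \<and> (\<forall>k'\<in>seen m x. k < k' \<longrightarrow> k' div l = k div l))"

text \<open>All indices of the new block exceed those seen before. An entry with a witness in it is
  rightly overwritten; for any other entry the set of seen witnesses and the report stay the
  same.\<close>

lemma reported_next:
  assumes r: "reported (i * l) \<sigma>" and
    o: "\<And>x. x < n * n \<Longrightarrow> if block_witnesses (i * l) x \<noteq> {}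
         then \<exists>v\<in>block_witnesses (i * l) x. mem \<sigma>' 2 (int x) = int (i * l + v)
         else mem \<sigma>' 2 (int x) = mem \<sigma> 2 (int x)"
  shows "reported (Suc i * l) \<sigma>'"
  unfolding reported_def
proof (intro allI impI)
  fix x assume x: "x < n * n"
  show "if seen (Suc i * l) x = {} then mem \<sigma>' 2 (int x) = - 1
    else \<exists>k\<in>seen (Suc i * l) x. mem \<sigma>' 2 (int x) = int k \<and> (\<forall>k'\<in>seen (Suc i * l) x. k < k' \<longrightarrow> k' div l = k div l)"
  proof (cases "block_witnesses (i * l) x = {}")
    case True
    then have "seen (Suc i * l) x = seen (i * l) x" "mem \<sigma>' 2 (int x) = mem \<sigma> 2 (int x)"
      unfolding seen_next using o[OF x] by simp_all
    moreover have "if seen (i * l) x = {} then mem \<sigma> 2 (int x) = - 1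
      else \<exists>k\<in>seen (i * l) x. mem \<sigma> 2 (int x) = int k \<and> (\<forall>k'\<in>seen (i * l) x. k < k' \<longrightarrow> k' div l = k div l)"
      using r x unfolding reported_def by blast
    ultimately show ?thesis by simp
  next
    case False
    then obtain v where v: "v \<in> block_witnesses (i * l) x" "mem \<sigma>' 2 (int x) = int (i * l + v)" using o[OF x] by auto
    have dv: "(i * l + u) div l = i" if "u \<in> block_witnesses (i * l) x" for u
      using block_witnesses_less[OF that] by simp
    have "i * l + v \<in> seen (Suc i * l) x" unfolding seen_next using v by blast
    moreover have "k' div l = (i * l + v) div l" if k': "k' \<in> seen (Suc i * l) x" "i * l + v < k'" for k'
    proof -
      have "k' \<notin> seen (i * l) x" using k'(2) by (auto simp: seen_def)
      then obtain u where "u \<in> block_witnesses (i * l) x" "k' = i * l + u" using k'(1) unfolding seen_next by blast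
      then show ?thesis using dv v(1) by simp
    qed
    ultimately have ex: "\<exists>k\<in>seen (Suc i * l) x. mem \<sigma>' 2 (int x) = int k \<and> (\<forall>k'\<in>seen (Suc i * l) x. k < k' \<longrightarrow> k' div l = k div l)"
      using v(2) by blast
    then have "seen (Suc i * l) x \<noteq> {}" by blast
    with ex show ?thesis by (simp only: if_False)
  qed
qed

lemma wp_blocks:
  assumes env: "env \<sigma>" and r: "reg \<sigma> 30 = int block_count" and out: "\<And>x. x < n * n \<Longrightarrow> mem \<sigma> 2 (int x) = - 1"
    and Q: "\<And>\<sigma>' t'. reported (block_count * l) \<sigma>' \<Longrightarrow> t' \<le> t + block_count * (block_time + 10) + 2 \<Longrightarrow> Q \<sigma>' t'"
  shows "wp w (blocks count) Q \<sigma> t"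
  unfolding blocks_def
proof (rule wp_For[where m = block_count and Rs = "block_regs \<union> {6, 29}" and Ms = "{2, 3, 4, 5, 10, 11, 12}" and C = "block_time + 7" and
      J = "\<lambda>i \<sigma>'. reported (i * l) \<sigma>'"])
  show "reg \<sigma> 30 = int block_count" by (rule r)
  show "int block_count \<le> w" using block_count_le by (intro small1) simp
  show "reported (0 * l) (set_reg \<sigma> 29 0)" using out by (simp add: reported_def seen_def)
  fix i \<sigma>' t'
  assume i: "i < block_count" and ag: "agree (block_regs \<union> {6, 29}) {2, 3, 4, 5, 10, 11, 12} \<sigma> \<sigma>'"
    and ri: "reg \<sigma>' 29 = int i" and J: "reported (i * l) \<sigma>'"
  define \<sigma>1 where "\<sigma>1 = set_reg \<sigma>' 6 (int (i * l))"
  have a1: "agree (block_regs \<union> {6, 29}) {2, 3, 4, 5, 10, 11, 12} \<sigma> \<sigma>1"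
    using ag by (simp add: \<sigma>1_def agree_set_reg)
  have env1: "env \<sigma>1" by (rule env_agree[OF a1 env]) (auto simp: block_regs_def scale_regs_def round_regs_def)
  have il: "i * l < n" by (rule block_start_less[OF i])
  have r1: "reg \<sigma>' 1 = int l" using envD(2)[OF env1] by (simp add: \<sigma>1_def)
  have body: "wp w (block count)
     (\<lambda>\<sigma>'' t''. t'' \<le> t' + (block_time + 7) \<and> agree (block_regs \<union> {6, 29}) {2, 3, 4, 5, 10, 11, 12} \<sigma> \<sigma>'' \<and>
      reg \<sigma>'' 29 = int i \<and> reported (Suc i * l) (set_reg \<sigma>'' 29 (int i + 1))) \<sigma>1 (t' + 5)"
  proof (rule wp_block[OF env1])
    show "reg \<sigma>1 6 = int (i * l)" by (simp add: \<sigma>1_def)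
    show "i * l \<le> 2 * n" using il by simp
    fix \<sigma>'' t''
    assume ag'': "agree block_regs {2, 3, 4, 5, 10, 11, 12} \<sigma>1 \<sigma>''"
      and o: "\<And>x. x < n * n \<Longrightarrow> if block_witnesses (i * l) x \<noteq> {}
         then \<exists>v\<in>block_witnesses (i * l) x. mem \<sigma>'' 2 (int x) = int (i * l + v)
         else mem \<sigma>'' 2 (int x) = mem \<sigma>1 2 (int x)" and t'': "t'' \<le> t' + 5 + block_time"
    have "reported (i * l) \<sigma>1" using J by (simp add: \<sigma>1_def reported_def)
    from reported_next[OF this o] have "reported (Suc i * l) (set_reg \<sigma>'' 29 (int i + 1))"
      by (simp add: reported_def)
    moreover have "agree (block_regs \<union> {6, 29}) {2, 3, 4, 5, 10, 11, 12} \<sigma> \<sigma>''"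
      by (rule agree_trans[OF a1 ag'']) auto
    moreover have "reg \<sigma>'' 29 = int i"
      using ri by (simp add: agree_reg[OF ag''] block_regs_def scale_regs_def round_regs_def \<sigma>1_def)
    ultimately show "t'' \<le> t' + (block_time + 7) \<and> agree (block_regs \<union> {6, 29}) {2, 3, 4, 5, 10, 11, 12} \<sigma> \<sigma>'' \<and>
      reg \<sigma>'' 29 = int i \<and> reported (Suc i * l) (set_reg \<sigma>'' 29 (int i + 1))"
      using t'' by simp
  qed
  have ilw: "int (i * l) \<le> w" using il by (intro small1) simp
  show "wp w (Asg 6 (V 29 [*] V 1) ;; block count)
     (\<lambda>\<sigma>'' t''. t'' \<le> t' + (block_time + 7) \<and> agree (block_regs \<union> {6, 29}) {2, 3, 4, 5, 10, 11, 12} \<sigma> \<sigma>'' \<and>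
      reg \<sigma>'' 29 = int i \<and> reported (Suc i * l) (set_reg \<sigma>'' 29 (int i + 1))) \<sigma>' t'"
  proof (rule wp_Seq, rule wp_Asg)
    have "ev (V 29 [*] V 1) \<sigma>' = int (i * l)" using ri r1 by simp
    then have "set_reg \<sigma>' 6 (ev (V 29 [*] V 1) \<sigma>') = \<sigma>1" by (simp only: \<sigma>1_def)
    then show "wp w (block count)
     (\<lambda>\<sigma>'' t''. t'' \<le> t' + (block_time + 7) \<and> agree (block_regs \<union> {6, 29}) {2, 3, 4, 5, 10, 11, 12} \<sigma> \<sigma>'' \<and>
      reg \<sigma>'' 29 = int i \<and> reported (Suc i * l) (set_reg \<sigma>'' 29 (int i + 1)))
      (set_reg \<sigma>' 6 (ev (V 29 [*] V 1) \<sigma>')) (t' + (cost (V 29 [*] V 1) + 2))"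
      using body by (simp add: add.commute[of 5 t'])
  qed (use ilw ri r1 in simp_all)
next
  fix \<sigma>' t'
  assume J: "reported (block_count * l) \<sigma>'" and t': "t' \<le> t + block_count * (block_time + 7 + 3) + 2"
  have "block_time + 7 + 3 = block_time + 10" by simp
  then show "Q \<sigma>' t'" using t' by (intro Q[OF J]) (simp only: add.assoc numeral_plus_numeral add_num_simps)
qed (use two_le_w in \<open>auto simp: block_regs_def scale_regs_def round_regs_def\<close>)

lemma power_le_n: "i < lam \<Longrightarrow> 2 ^ i \<le> n"
proof -
  assume "i < lam"
  then have "(2::nat) ^ Suc i \<le> 2 ^ lam" by (intro power_increasing) auto
  then show ?thesis using lam by simp
qed

lemma lam_le_n: "lam \<le> n"
proof (rule ccontr)
  assume "\<not> lam \<le> n"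
  then have "2 ^ n \<le> n" by (intro power_le_n) simp
  then show False using less_exp[of n] by linarith
qed

lemma wp_init:
  assumes r: "reg \<sigma> 0 = int n" "reg \<sigma> 1 = int l"
    and st: "stored of_bool A (mem \<sigma> 0)" "stored of_bool B (mem \<sigma> 1)"
    and Q: "\<And>\<sigma>' t'. env \<sigma>' \<Longrightarrow> reg \<sigma>' 30 = int block_count \<Longrightarrow> (\<And>x. x < n * n \<Longrightarrow> mem \<sigma>' 2 (int x) = - 1) \<Longrightarrow>
      t' \<le> t + 200 * (n * n) \<Longrightarrow> Q \<sigma>' t'"
  shows "wp w init_com Q \<sigma> t"
proof -
  define \<sigma>1 where "\<sigma>1 = set_reg (set_reg (set_reg (set_reg (set_reg \<sigma> 9 (int (n * n))) 33 (int (n * l))) 30 (int block_count)) 10 0) 22 1"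
  define lw where "lw = 16 * lam"
  have lww: "int lw \<le> w" unfolding lw_def using lam_le by (intro small1) simp
  have H: "H = lw * lw * lw" by (simp add: H_def lw_def power3_eq_cube)
  have H2: "H * H \<le> H * H * H" "H \<le> H * H" using H_pos by auto
  have HW: "int (H * H * H) \<le> w" "int (H * H) \<le> w" "int H \<le> w" "int (lw * lw) \<le> w"
  proof -
    have "lw * lw * 1 \<le> lw * lw * lw" unfolding lw_def using lam_pos by (intro mult_le_mono2) simp
    then have lwH: "lw * lw \<le> H" by (simp add: H)
    show "int (H * H * H) \<le> w" "int (H * H) \<le> w" "int H \<le> w" "int (lw * lw) \<le> w"
      by (rule hash_le_w1, use H2 lwH in linarith)+
  qed
  have tail: "wp w (Asg 27 (N 16 [*] V 10) ;; Asg 11 (V 27 [*] V 27 [*] V 27) ;; Asg 12 (V 11 [*] V 11 [*] V 11) ;;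
      For 5 9 (Wr 2 (V 5) (N (- 1)))) Q \<sigma>2 t2"
    if ag: "agree {5, 10, 22} {} \<sigma>1 \<sigma>2" and r10: "reg \<sigma>2 10 = int lam" and t2: "t2 \<le> t + 50 + 16 * n" for \<sigma>2 t2
  proof -
    define \<sigma>3 where "\<sigma>3 = set_reg (set_reg (set_reg \<sigma>2 27 (int lw)) 11 (int H)) 12 (int (H * H * H))"
    have a3: "agree {5, 10, 22, 27, 11, 12} {} \<sigma>1 \<sigma>3"
      unfolding \<sigma>3_def by (intro agree_set_reg agree_weaken[OF ag]) auto
    have env3: "env \<sigma>3"
      unfolding env_def using r st r10
      by (simp_all add: \<sigma>3_def lw_def agree_reg[OF ag] agree_mem[OF ag]) (simp_all add: \<sigma>1_def)
    have loop: "wp w (For 5 9 (Wr 2 (V 5) (N (- 1)))) Q \<sigma>3 t3" if t3: "t3 \<le> t2 + 40" for t3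
    proof (rule wp_fill[where m = "n * n" and f = "\<lambda>_. - 1"])
      show "reg \<sigma>3 9 = int (n * n)" by (rule envD(3)[OF env3])
      fix \<sigma>' t'
      assume ag': "agree {5} {2} \<sigma>3 \<sigma>'" and m: "\<And>k. k < n * n \<Longrightarrow> mem \<sigma>' 2 (int k) = - 1"
        and t': "t' \<le> t3 + n * n * (cost (N (- 1)) + 5) + 2"
      show "Q \<sigma>' t'"
      proof (rule Q)
        show "env \<sigma>'" by (rule env_agree[OF ag' env3]) auto
        show "reg \<sigma>' 30 = int block_count" by (simp add: agree_reg[OF ag'] agree_reg[OF a3]) (simp add: \<sigma>1_def)
        have "n \<le> n * n" using mult_le_mono1[OF n, of n] by simp
        moreover have "t' \<le> t3 + 6 * (n * n) + 2" using t' by simp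
        ultimately show "t' \<le> t + 200 * (n * n)" using t2 t3 nn_pos by linarith
      qed (rule m)
    qed (use nn_le_w two_le_w in auto)
    have c: "int lw * int lw = int (lw * lw)" "int (lw * lw) * int lw = int H" "int H * int H = int (H * H)"
      "int (H * H) * int H = int (H * H * H)" "16 * int lam = int lw"
      by (simp_all add: H lw_def)
    have w16: "16 \<le> w" using small1[of 16] by simp
    show ?thesis
      apply (intro wp_Seq wp_Asg)
      using lww HW w16 by (simp_all add: r10 c loop[unfolded \<sigma>3_def] del: of_nat_mult)
  qed
  have loop: "wp w (For 5 0 (Cond (V 0) (V 22) Skip (Asg 22 (V 22 [*] N 2) ;; Asg 10 (V 10 [+] N 1))))
    (wp w (Asg 27 (N 16 [*] V 10) ;; Asg 11 (V 27 [*] V 27 [*] V 27) ;; Asg 12 (V 11 [*] V 11 [*] V 11) ;;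
      For 5 9 (Wr 2 (V 5) (N (- 1)))) Q) \<sigma>1 t1" if t1: "t1 \<le> t + 40" for t1
  proof (rule wp_For[where m = n and Rs = "{5, 10, 22}" and Ms = "{}" and C = 13 and
        J = "\<lambda>i \<sigma>'. reg \<sigma>' 10 = int (min i lam) \<and> reg \<sigma>' 22 = 2 ^ min i lam"])
    show "reg \<sigma>1 0 = int n" using r by (simp add: \<sigma>1_def)
    show "int n \<le> w" by (rule small1) simp
    show "reg (set_reg \<sigma>1 5 0) 10 = int (min 0 lam) \<and> reg (set_reg \<sigma>1 5 0) 22 = 2 ^ min 0 lam"
      by (simp add: \<sigma>1_def)
    fix i \<sigma>' t'
    assume i: "i < n" and ag: "agree {5, 10, 22} {} \<sigma>1 \<sigma>'" and ri: "reg \<sigma>' 5 = int i"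
      and J: "reg \<sigma>' 10 = int (min i lam) \<and> reg \<sigma>' 22 = 2 ^ min i lam"
    have r0: "reg \<sigma>' 0 = int n" using r by (simp add: agree_reg[OF ag] \<sigma>1_def)
    \<comment> \<open>As \<open>2 ^ i \<le> n\<close> for every \<open>i < lam\<close>, the guard
      first holds after exactly \<open>lam\<close> doublings.\<close>
    have big: "int n < 2 ^ min i lam \<longleftrightarrow> lam \<le> i"
    proof -
      have "int n < 2 ^ min i lam \<longleftrightarrow> n < 2 ^ min i lam"
        using of_nat_less_iff[where 'a = int, of n "2 ^ min i lam"] by simp
      also have "\<dots> \<longleftrightarrow> lam \<le> i" using power_le_n[of i] lam by (cases "lam \<le> i") auto
      finally show ?thesis .
    qed
    have p: "(2::int) ^ i * 2 \<le> w" if "i < lam"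
    proof -
      have "int (2 ^ i * 2) \<le> w" using power_le_n[OF that] by (intro small1) simp
      then show ?thesis by simp
    qed
    have iw: "int i + 1 \<le> w"
    proof -
      have "int (i + 1) \<le> w" using i by (intro small1) simp
      then show ?thesis by simp
    qed
    show "wp w (Cond (V 0) (V 22) Skip (Asg 22 (V 22 [*] N 2) ;; Asg 10 (V 10 [+] N 1)))
      (\<lambda>\<sigma>'' t''. t'' \<le> t' + 13 \<and> agree {5, 10, 22} {} \<sigma>1 \<sigma>'' \<and> reg \<sigma>'' 5 = int i \<and>
        reg (set_reg \<sigma>'' 5 (int i + 1)) 10 = int (min (Suc i) lam) \<and> reg (set_reg \<sigma>'' 5 (int i + 1)) 22 = 2 ^ min (Suc i) lam) \<sigma>' t'"
    proof (cases "lam \<le> i")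
      case True
      show ?thesis
        apply (intro wp_intros wp_Skip)
        using J big True ag ri two_le_w by (simp_all add: r0 min_absorb2 del: zero_less_power)
    next
      case False
      show ?thesis
        apply (intro wp_intros wp_Skip)
        using J big False ag ri two_le_w p iw by (simp_all add: r0 min_absorb1 agree_set_reg)
    qed
  next
    fix \<sigma>' t'
    assume ag: "agree {5, 10, 22} {} \<sigma>1 \<sigma>'" and J: "reg \<sigma>' 10 = int (min n lam) \<and> reg \<sigma>' 22 = 2 ^ min n lam"
      and t': "t' \<le> t1 + n * (13 + 3) + 2"
    have "reg \<sigma>' 10 = int lam" using J lam_le_n by (simp add: min_absorb2)
    moreover have "t' \<le> t + 50 + 16 * n" using t' t1 by simp
    ultimately show "wp w (Asg 27 (N 16 [*] V 10) ;; Asg 11 (V 27 [*] V 27 [*] V 27) ;; Asg 12 (V 11 [*] V 11 [*] V 11) ;;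
      For 5 9 (Wr 2 (V 5) (N (- 1)))) Q \<sigma>' t'" using ag by (intro tail)
  qed (use two_le_w in auto)
  have c: "int n * int n = int (n * n)" "int n * int l = int (n * l)" "(int n + int l - 1) div int l = int block_count"
    "int n + int l - 1 = int (n + l - 1)" "int n + int l = int (n + l)"
  proof -
    show e: "int n + int l - 1 = int (n + l - 1)" using l by simp
    show "(int n + int l - 1) div int l = int block_count" unfolding e block_count_def by (simp only: zdiv_int)
  qed simp_all
  have c': "int (n + l - 1) div int l = int block_count" "int (n + l) - 1 = int (n + l - 1)"
    using c(3) unfolding c(4) by (simp, simp only: c(4,5)[symmetric])
  have b: "int (n * l) \<le> w" "int (n + l) \<le> w" "int (n + l - 1) \<le> w" "int block_count \<le> w"
    subgoal by (rule order_trans[OF of_nat_mono[OF mult_le_mono2[OF l(2)]] nn_le_w])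
    subgoal using l by (intro small1) simp
    subgoal using l by (intro small1) simp
    subgoal using block_count_le by (intro small1) simp
    done
  show ?thesis
    unfolding init_com_def
    apply (intro wp_Seq wp_Asg)
    using b nn_le_w two_le_w by (simp_all add: r c c' loop[unfolded \<sigma>1_def] del: of_nat_mult of_nat_add)
qed

lemma wp_report:
  assumes "reg \<sigma> 0 = int n" "reg \<sigma> 1 = int l" "stored of_bool A (mem \<sigma> 0)" "stored of_bool B (mem \<sigma> 1)"
    and Q: "\<And>\<sigma>' t'. reported (block_count * l) \<sigma>' \<Longrightarrow> t' \<le> t + 2 * (block_count * block_time) \<Longrightarrow> Q \<sigma>' t'"
  shows "wp w (report p) Q \<sigma> t"
  unfolding report_def
proof (rule wp_Seq, rule wp_init[OF assms(1-4)])
  fix \<sigma>1 t1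
  assume 1: "env \<sigma>1" "reg \<sigma>1 30 = int block_count" "\<And>x. x < n * n \<Longrightarrow> mem \<sigma>1 2 (int x) = - 1"
    and t1: "t1 \<le> t + 200 * (n * n)"
  show "wp w (blocks count) Q \<sigma>1 t1"
  proof (rule wp_blocks[OF 1])
    fix \<sigma>' t'
    assume J: "reported (block_count * l) \<sigma>'" and t': "t' \<le> t1 + block_count * (block_time + 10) + 2"
    show "Q \<sigma>' t'"
    proof (rule Q[OF J])
      have "block_count \<noteq> 0" using block_count_covers n by (intro notI) simp
      then have bc: "1 \<le> block_count" by simp
      have "1 * (1 * (1 * hash_time)) \<le> lam * (lam * (lam * hash_time))"
        by (intro mult_le_mono lam_pos order_refl)
      then have bt: "60000 * hash_time \<le> block_time" unfolding block_time_def by linarith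
      have "1 * block_time \<le> block_count * block_time" using bc by (rule mult_le_mono1)
      moreover have "block_count * 60000 \<le> block_count * block_time"
        using bt time_bounds(1) by (intro mult_le_mono2) linarith
      moreover have "t' \<le> t1 + block_count * block_time + 10 * block_count + 2" using t' by (simp add: algebra_simps)
      ultimately show "t' \<le> t + 2 * (block_count * block_time)"
        using t1 bt time_bounds(2) nn_pos bc by linarith
    qed
  qed
qed

end

section \<open>Running time in terms of the multiplication time\<close>

definition outputs :: "bool mat \<Rightarrow> bool mat \<Rightarrow> nat \<Rightarrow> nat \<Rightarrow> state \<Rightarrow> bool" where
  "outputs A B n l s \<longleftrightarrow> (\<forall>i<n. \<forall>j<n.
     if bool_mult A B $$ (i, j)
     then \<exists>k\<in>witnesses A B i j. mem s 2 (int (i * n + j)) = int k \<and> witness_rank A B i j k \<le> l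
     else mem s 2 (int (i * n + j)) = - 1)"

text \<open>Lets a run with a block length rounded down serve the original rank bound.\<close>

lemma outputs_mono: "outputs A B n l s \<Longrightarrow> l \<le> l' \<Longrightarrow> outputs A B n l' s"
  unfolding outputs_def by (meson order_trans)

lemma reports_witnessesI:
  assumes "\<And>A B \<sigma>. A \<in> carrier_mat n n \<Longrightarrow> B \<in> carrier_mat n n \<Longrightarrow> reg \<sigma> 0 = int n \<Longrightarrow> reg \<sigma> 1 = int l \<Longrightarrow>
    stored of_bool A (mem \<sigma> 0) \<Longrightarrow> stored of_bool B (mem \<sigma> 1) \<Longrightarrow>
    wp ((int n + 1) ^ c) p (\<lambda>\<sigma>' t. real t \<le> T \<and> outputs A B n l \<sigma>') \<sigma> 0"
  shows "reports_witnesses p c n l T"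
  unfolding reports_witnesses_def
proof (intro allI impI, elim conjE)
  fix A B and s :: state
  assume A: "A \<in> carrier_mat n n" "B \<in> carrier_mat n n" "reg s 0 = int n" "reg s 1 = int l"
    "stored of_bool A (mem s 0)" "stored of_bool B (mem s 1)"
  have "wp ((int n + 1) ^ c) p (\<lambda>\<sigma>' t. real t \<le> T \<and> outputs A B n l \<sigma>') (low s) 0"
    by (rule assms) (use A in simp_all)
  then obtain t s' where e: "exec ((int n + 1) ^ c) p s t s'" "real t \<le> T" and out: "outputs A B n l (low s')"
    unfolding wp_def by auto
  have "mem (low s') 2 = mem s' 2" by simp
  from e out[unfolded outputs_def this]
  show "\<exists>t s'. exec ((int n + 1) ^ c) p s t s' \<and> real t \<le> T \<and>
     (\<forall>i<n. \<forall>j<n. if bool_mult A B $$ (i, j)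
        then \<exists>k\<in>witnesses A B i j. mem s' 2 (int (i * n + j)) = int k \<and> witness_rank A B i j k \<le> l
        else mem s' 2 (int (i * n + j)) = - 1)"
    by (intro exI conjI)
qed

text \<open>A store changes at most one cell and no other instruction changes any, so the number of
  altered cells bounds the time from below.\<close>

lemma exec_changes:
  assumes "exec w p s t s'"
  shows "finite {x. mem s' a x \<noteq> mem s a x} \<and> card {x. mem s' a x \<noteq> mem s a x} \<le> t"
  using assms
proof (induction rule: exec.induct)
  case (Store a' x y s)
  have sub: "{z. mem (set_mem s a' (reg s x) (reg s y)) a z \<noteq> mem s a z} \<subseteq> {reg s x}" by auto
  then show ?case using card_mono[OF _ sub] finite_subset[OF sub] by simp
next
  case (Seq p s t s' q u s'')
  have sub: "{x. mem s'' a x \<noteq> mem s a x} \<subseteq> {x. mem s' a x \<noteq> mem s a x} \<union> {x. mem s'' a x \<noteq> mem s' a x}" by auto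
  show ?case using Seq.IH finite_subset[OF sub] card_mono[OF _ sub]
      card_Un_le[of "{x. mem s' a x \<noteq> mem s a x}" "{x. mem s'' a x \<noteq> mem s' a x}"] by auto
next
  case (While_true s x y p t s' u s'')
  have sub: "{x. mem s'' a x \<noteq> mem s a x} \<subseteq> {x. mem s' a x \<noteq> mem s a x} \<union> {x. mem s'' a x \<noteq> mem s' a x}" by auto
  show ?case using While_true.IH finite_subset[OF sub] card_mono[OF _ sub]
      card_Un_le[of "{x. mem s' a x \<noteq> mem s a x}" "{x. mem s'' a x \<noteq> mem s' a x}"] by auto
qed auto

text \<open>The product of zero matrices must overwrite the output memory if it is initially nonzero.\<close>

lemma multiplies_lower_bound:
  assumes "multiplies p c n m T"
  shows "real (n * n) \<le> T"
proof -
  define s :: state where "s = \<lparr>reg = (\<lambda>r. if r = 0 then int n else int m), mem = (\<lambda>a. if a = 2 then (\<lambda>_. 1) else (\<lambda>_. 0))\<rparr>"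
  have "\<exists>t s'. exec ((int n + 1) ^ c) p s t s' \<and> real t \<le> T \<and> stored id (0\<^sub>m n m * 0\<^sub>m m n :: int mat) (mem s' 2)"
    by (rule assms[unfolded multiplies_def, rule_format]) (auto simp: s_def stored_def)
  then obtain t s' where e: "exec ((int n + 1) ^ c) p s t s'" "real t \<le> T" "stored id (0\<^sub>m n n :: int mat) (mem s' 2)"
    by auto
  have z: "mem s' 2 (int x) = 0" if "x < n * n" for x
    using e(3) that div_mod_less[OF that] by (subst (asm) stored_flat[of _ n n]) auto
  have "int ` {..<n * n} \<subseteq> {x. mem s' 2 x \<noteq> mem s 2 x}" using z by (auto simp: s_def)
  then have "card (int ` {..<n * n}) \<le> card {x. mem s' 2 x \<noteq> mem s 2 x}"
    using exec_changes[OF e(1), of 2] by (intro card_mono) auto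
  also have "\<dots> \<le> t" using exec_changes[OF e(1), of 2] by simp
  finally have "n * n \<le> t" by (simp add: card_image)
  then have "real (n * n) \<le> real t" by (rule of_nat_mono)
  then show ?thesis using e(2) by linarith
qed

text \<open>Of the 480000, 60000 comes from \<open>block_time\<close> and three factors 2 come from
  \<open>wp_report\<close>, from the rounding in \<open>block_count\<close> and from
  \<open>unit_time\<close>. \<open>H * H * H\<close> contributes \<open>16 ^ 9\<close> and nine
  factors \<open>lam\<close>; with three more from \<open>block_time\<close>, replacing
  \<open>lam\<close> by twice the logarithmic term yields \<open>2 ^ 12\<close>.\<close>

definition report_factor :: real where
  "report_factor = 480000 * 16 ^ 9 * 2 ^ 12"

definition report_bound :: "nat \<Rightarrow> nat \<Rightarrow> real \<Rightarrow> real" where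
  "report_bound n l T = report_factor * (1 + ln (real n)) ^ 12 * (real n / real l * T)"

lemma exists_lam:
  fixes n :: nat
  assumes n: "1 \<le> n"
  shows "\<exists>k. n < 2 ^ k \<and> 2 ^ k \<le> 2 * n"
proof -
  define k where "k = (LEAST k. n < 2 ^ k)"
  have k: "n < 2 ^ k" unfolding k_def by (rule LeastI[of _ n]) (rule less_exp)
  then obtain j where j: "k = Suc j" using n by (cases k) auto
  have "\<not> n < 2 ^ j" using not_less_Least[of j "\<lambda>k. n < 2 ^ k"] j unfolding k_def[symmetric] by simp
  then show ?thesis using k j by (intro exI[of _ k]) auto
qed

text \<open>Numerical constants are absorbed into the word bound through
  \<open>2 \<le> n + 1\<close>, which turns every requirement into a power of \<open>n + 1\<close>.
  The largest, \<open>2 ^ 47 * (n + 1) ^ 10\<close> for the hash functions, explains the reserve of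
  60 in the exponent.\<close>

lemma wp_report_matrices:
  assumes p: "multiplies p cw n l T" and n: "1 \<le> n" and l: "1 \<le> l" "l \<le> n" and w: "(int n + 1) ^ (cw + 60) \<le> w"
    and A: "A \<in> carrier_mat n n" and B: "B \<in> carrier_mat n n"
    and \<sigma>: "reg \<sigma> 0 = int n" "reg \<sigma> 1 = int l" "stored of_bool A (mem \<sigma> 0)" "stored of_bool B (mem \<sigma> 1)"
    and Q: "\<And>\<sigma>' t'. outputs A B n l \<sigma>' \<Longrightarrow> real t' \<le> real t + report_bound n l T \<Longrightarrow> Q \<sigma>' t'"
  shows "wp w (report p) Q \<sigma> t"
proof -
  from exists_lam[OF n] obtain lam where lam: "n < 2 ^ lam" "2 ^ lam \<le> 2 * n" by blast
  have lam2: "lam \<le> 2 * n" using less_exp[of lam] lam by linarith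
  have pw: "(int n + 1) ^ k \<le> w" if "k \<le> cw + 60" for k
    by (rule order_trans[OF power_increasing[OF that] w]) simp
  have pn: "int (2 ^ j * (n + 1) ^ k) \<le> w" if "j + k \<le> 60" for j k
  proof -
    have "2 ^ j * (n + 1) ^ k \<le> (n + 1) ^ j * (n + 1) ^ k" using n by (intro mult_le_mono1 power_mono) auto
    also have "\<dots> = (n + 1) ^ (j + k)" by (simp add: power_add)
    finally have "int (2 ^ j * (n + 1) ^ k) \<le> int ((n + 1) ^ (j + k))" by (rule of_nat_mono)
    also have "\<dots> = (int n + 1) ^ (j + k)" by simp
    also have "\<dots> \<le> w" using that by (intro pw) simp
    finally show ?thesis .
  qed
  interpret block_algorithm n l lam w A B p cw T
  proof
    show "1 \<le> n" "1 \<le> l" "l \<le> n" "n < 2 ^ lam" "2 ^ lam \<le> 2 * n" "A \<in> carrier_mat n n" "B \<in> carrier_mat n n"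
      "multiplies p cw n l T" by fact+
    show "(int n + 1) ^ cw \<le> w" by (rule pw) simp
    have "100 * (lam + 3) * (n + 1) ^ 4 \<le> (2 ^ 9 * (n + 1)) * (n + 1) ^ 4"
      using lam2 by (intro mult_le_mono1) simp
    also have "\<dots> = 2 ^ 9 * (n + 1) ^ 5" by (simp only: mult.assoc power_Suc[symmetric]) simp
    finally show "int (100 * (lam + 3) * (n + 1) ^ 4) \<le> w"
      by (rule order_trans[OF of_nat_mono pn]) simp
    have "16 * lam \<le> 2 ^ 5 * (n + 1)" using lam2 by simp
    then have "(16 * lam) ^ 9 \<le> (2 ^ 5 * (n + 1)) ^ 9" by (rule power_mono) simp
    also have "\<dots> = 2 ^ 45 * (n + 1) ^ 9" by (simp only: power_mult_distrib power_mult[symmetric]) simp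
    finally have "4 * (16 * lam) ^ 9 * (n + 1) \<le> 4 * (2 ^ 45 * (n + 1) ^ 9) * (n + 1)"
      by (intro mult_le_mono1 mult_le_mono2)
    also have "\<dots> = (4 * 2 ^ 45) * ((n + 1) ^ 9 * (n + 1))" by (simp only: mult_ac)
    also have "\<dots> = 2 ^ 47 * (n + 1) ^ 10" by (subst power_Suc2[symmetric]) simp
    finally have "4 * ((16 * lam) ^ 3) ^ 3 * (n + 1) \<le> 2 ^ 47 * (n + 1) ^ 10"
      by (simp only: power_mult[symmetric]) simp
    then show "int (4 * ((16 * lam) ^ 3) ^ 3 * (n + 1)) \<le> w"
      by (rule order_trans[OF of_nat_mono pn]) simp
  qed
  show ?thesis
  proof (rule wp_report[OF \<sigma>])
    fix \<sigma>' t'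
    assume R: "reported (block_count * l) \<sigma>'" and t': "t' \<le> t + 2 * (block_count * block_time)"
    have S: "seen (block_count * l) (i * n + j) = witnesses A B i j" if "i < n" "j < n" for i j
    proof -
      have "(i * n + j) div n = i" "(i * n + j) mod n = j" using that by auto
      then show ?thesis using A block_count_covers by (auto simp: seen_def witnesses_def)
    qed
    have rank: "witness_rank A B i j k \<le> l"
      if "\<forall>k'\<in>witnesses A B i j. k < k' \<longrightarrow> k' div l = k div l" for i j k
    proof -
      have "{k' \<in> witnesses A B i j. k < k'} \<subseteq> {k<..<(k div l + 1) * l}"
      proof
        fix k' assume k': "k' \<in> {k' \<in> witnesses A B i j. k < k'}"
        then have "k' div l = k div l" using that by blast
        moreover have "k' < (k' div l + 1) * l" using l dividend_less_div_times[of l k'] by (simp add: algebra_simps)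
        ultimately show "k' \<in> {k<..<(k div l + 1) * l}" using k' by simp
      qed
      then have "card {k' \<in> witnesses A B i j. k < k'} \<le> card {k<..<(k div l + 1) * l}" by (intro card_mono) auto
      also have "\<dots> = (k div l + 1) * l - Suc k" by simp
      also have "\<dots> \<le> l - 1"
      proof -
        have "(k div l + 1) * l \<le> k + l" by (simp add: algebra_simps)
        then show ?thesis using l by linarith
      qed
      finally show ?thesis using l by (simp add: witness_rank_def)
    qed
    have out: "outputs A B n l \<sigma>'"
      unfolding outputs_def
    proof (intro allI impI)
      fix i j assume ij: "i < n" "j < n"
      have "i * n + j < i * n + n" using ij by simp
      also have "\<dots> = (i + 1) * n" by (simp only: distrib_right mult_1)
      also have "\<dots> \<le> n * n" using ij by (intro mult_le_mono1) simp
      finally have x: "i * n + j < n * n" .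
      have bm: "bool_mult A B $$ (i, j) \<longleftrightarrow> witnesses A B i j \<noteq> {}"
        using ij A B by (auto simp: bool_mult_def witnesses_def)
      have "if witnesses A B i j = {} then mem \<sigma>' 2 (int (i * n + j)) = - 1
        else \<exists>k\<in>witnesses A B i j. mem \<sigma>' 2 (int (i * n + j)) = int k \<and> (\<forall>k'\<in>witnesses A B i j. k < k' \<longrightarrow> k' div l = k div l)"
        using R x unfolding reported_def S[OF ij, symmetric] by blast
      then show "if bool_mult A B $$ (i, j) then \<exists>k\<in>witnesses A B i j. mem \<sigma>' 2 (int (i * n + j)) = int k \<and> witness_rank A B i j k \<le> l
          else mem \<sigma>' 2 (int (i * n + j)) = - 1"
        unfolding bm using rank by (cases "witnesses A B i j = {}") (simp_all del: of_nat_add of_nat_mult, blast)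
    qed
    show "Q \<sigma>' t'"
    proof (rule Q[OF out])
      have T: "real (n * n) \<le> T" by (rule multiplies_lower_bound[OF p])
      then have T0: "0 \<le> T" using of_nat_0_le_iff order_trans by blast
      have "real (nat \<lfloor>T\<rfloor>) \<le> T" using T0 by simp
      then have u: "real unit_time \<le> 2 * T" using T unfolding unit_time_def Tm_def of_nat_add by linarith
      have ln0: "0 \<le> ln (real n)" using n by simp
      \<comment> \<open>The bit length against the natural logarithm, by way of
        \<open>1 / 2 \<le> ln 2 \<le> 1\<close>.\<close>
      have lamr: "real lam \<le> 2 * (1 + ln (real n))"
      proof -
        have "real (2 ^ lam) \<le> real (2 * n)" using lam(2) by (rule of_nat_mono)
        then have "2 ^ lam \<le> 2 * real n" by simp
        then have "ln (2 ^ lam) \<le> ln (2 * real n)" using n by (subst ln_le_cancel_iff) auto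
        then have "real lam * ln 2 \<le> ln 2 + ln (real n)" using n by (simp add: ln_realpow ln_mult)
        moreover have "real lam * (1 / 2) \<le> real lam * ln 2"
          using ln_le_minus_one[of "1 / 2 :: real"] by (intro mult_left_mono) (auto simp: ln_div)
        ultimately have "real lam * (1 / 2) \<le> ln 2 + ln (real n)" by (rule order_trans[rotated])
        also have "\<dots> \<le> 1 + ln (real n)" using ln_le_minus_one[of "2::real"] by simp
        finally show ?thesis by simp
      qed
      have bc: "real block_count \<le> 2 * (real n / real l)"
      proof -
        have "real block_count \<le> real (n + l - 1) / real l" unfolding block_count_def by (rule of_nat_div_le_of_nat)
        also have "\<dots> \<le> real (2 * n) / real l" using l by (intro divide_right_mono of_nat_mono) auto
        finally show ?thesis by simp
      qed
      have "real block_time = 60000 * 16 ^ 9 * real lam ^ 12 * real unit_time"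
      proof -
        define x u where "x = real lam" and "u = real unit_time"
        have "(16 * x) ^ 3 = 16 ^ 3 * (x * x * x)" by (simp add: power3_eq_cube)
        moreover have "x ^ 12 = (x ^ 3) ^ 4" by (simp flip: power_mult)
        ultimately have "60000 * (x * (x * (x * ((16 * x) ^ 3 * (16 * x) ^ 3 * (16 * x) ^ 3 * u)))) = 60000 * 16 ^ 9 * x ^ 12 * u"
          by (simp add: power3_eq_cube power4_eq_xxxx)
        then show ?thesis unfolding block_time_def hash_time_def H_def x_def u_def by simp
      qed
      also have "\<dots> \<le> 60000 * 16 ^ 9 * (2 * (1 + ln (real n))) ^ 12 * (2 * T)"
        using lamr u by (intro mult_mono power_mono order_refl) auto
      finally have bt: "real block_time \<le> 60000 * 16 ^ 9 * (2 * (1 + ln (real n))) ^ 12 * (2 * T)" .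
      have "real t' \<le> real (t + 2 * (block_count * block_time))" using t' by (rule of_nat_mono)
      also have "\<dots> = real t + 2 * (real block_count * real block_time)" by simp
      also have "real block_count * real block_time \<le> 2 * (real n / real l) * (60000 * 16 ^ 9 * (2 * (1 + ln (real n))) ^ 12 * (2 * T))"
        using bc bt by (intro mult_mono) auto
      also have "2 * (2 * (real n / real l) * (60000 * 16 ^ 9 * (2 * (1 + ln (real n))) ^ 12 * (2 * T))) = report_bound n l T"
        unfolding report_bound_def report_factor_def power_mult_distrib[of 2] by (simp only: mult_ac) simp
      finally show "real t' \<le> real t + report_bound n l T" by simp
    qed
  qed
qed

subsection \<open>The elementary algorithm\<close>

definition naive :: com where
  "naive =
    Asg 9 (V 0 [*] V 0) ;;
    For 5 9
     (Asg 6 (V 5 [div] V 0 [*] V 1) ;;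
      Asg 7 (V 5 [mod] V 0) ;;
      Asg 20 (N 0) ;;
      For 3 1 (Asg 20 (V 20 [+] Rd 0 (V 6 [+] V 3) [*] Rd 1 (V 3 [*] V 0 [+] V 7))) ;;
      Wr 2 (V 5) (V 20))"

text \<open>Provides the exponent 3, so that the set whose infimum defines \<open>omega\<close> is
  nonempty for \<open>r \<le> 1\<close>.\<close>

lemma multiplies_naive:
  assumes m: "1 \<le> m" "m \<le> n"
  shows "multiplies naive 6 n m (200 * real n ^ 3)"
  unfolding multiplies_def
proof (intro allI impI, elim conjE)
  fix A B :: "int mat" and s :: state
  assume A: "A \<in> carrier_mat n m" and B: "B \<in> carrier_mat m n"
    and bd: "\<forall>i<n. \<forall>k<m. \<bar>A $$ (i, k)\<bar> \<le> int n \<and> \<bar>B $$ (k, i)\<bar> \<le> int n"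
    and r: "reg s 0 = int n" "reg s 1 = int m" and st: "stored id A (mem s 0)" "stored id B (mem s 1)"
  define w where "w = (int n + 1) ^ 6"
  have n: "1 \<le> n" using m by simp
  have n3: "n * n * n = n ^ 3" by (simp add: power3_eq_cube)
  have small: "int k \<le> w" if "k \<le> 4 * n ^ 3" for k
  proof -
    have "4 * n ^ 3 \<le> (n + 1) ^ 2 * (n + 1) ^ 3"
    proof (intro mult_le_mono power_mono)
      show "4 \<le> (n + 1) ^ 2" using power_mono[of 2 "n + 1" 2] n by simp
    qed auto
    also have "\<dots> = (n + 1) ^ 5" by (simp only: power_add[symmetric]) simp
    also have "\<dots> \<le> (n + 1) ^ 6" by (intro power_increasing) auto
    finally have "int k \<le> int ((n + 1) ^ 6)" using that by (intro of_nat_mono) simp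
    then show ?thesis by (simp add: w_def)
  qed
  have pows: "1 \<le> n ^ 3" "n \<le> n ^ 3" "n * n \<le> n ^ 3"
    using power_increasing[of 0 3 n] power_increasing[of 1 3 n] power_increasing[of 2 3 n] n
    by (simp_all add: power2_eq_square)
  have w2: "2 \<le> w" using small[of 2] pows by simp
  have mA: "mem s 0 (int (i * m + k)) = A $$ (i, k)" if "i < n" "k < m" for i k
    using st(1) A that by (auto simp: stored_def)
  have mB: "mem s 1 (int (k * n + j)) = B $$ (k, j)" if "k < m" "j < n" for k j
    using st(2) B that by (auto simp: stored_def)
  define \<sigma> where "\<sigma> = low s"
  define \<sigma>1 where "\<sigma>1 = set_reg \<sigma> 9 (int (n * n))"
  define P where "P = (\<lambda>x k. \<Sum>k'<k. A $$ (x div n, k') * B $$ (k', x mod n))"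
  have entry: "\<bar>A $$ (x div n, k) * B $$ (k, x mod n)\<bar> \<le> int (n * n)" if "x < n * n" "k < m" for x k
    unfolding abs_mult of_nat_mult using bd div_mod_less[OF that(1)] that(2) by (intro mult_mono) auto
  have Pw: "\<bar>P x k\<bar> \<le> w" if "x < n * n" "k \<le> m" for x k
  proof -
    have "\<bar>P x k\<bar> \<le> (\<Sum>k'<k. \<bar>A $$ (x div n, k') * B $$ (k', x mod n)\<bar>)" unfolding P_def by (rule sum_abs)
    also have "\<dots> \<le> (\<Sum>k'<k. int (n * n))" by (rule sum_mono) (use entry that in auto)
    also have "\<dots> = int (k * (n * n))" by simp
    also have "\<dots> \<le> w"
    proof (rule small)
      have "k * (n * n) \<le> n * (n * n)" using that m by (intro mult_le_mono1) simp
      then show "k * (n * n) \<le> 4 * n ^ 3" using n3 unfolding mult.assoc by linarith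
    qed
    finally show ?thesis .
  qed
  have loop: "wp w (For 5 9
     (Asg 6 (V 5 [div] V 0 [*] V 1) ;;
      Asg 7 (V 5 [mod] V 0) ;;
      Asg 20 (N 0) ;;
      For 3 1 (Asg 20 (V 20 [+] Rd 0 (V 6 [+] V 3) [*] Rd 1 (V 3 [*] V 0 [+] V 7))) ;;
      Wr 2 (V 5) (V 20)))
     (\<lambda>\<sigma>' t'. real t' \<le> 200 * real n ^ 3 \<and> (\<forall>x<n * n. mem \<sigma>' 2 (int x) = P x m)) \<sigma>1 5"
  proof (rule wp_For[where m = "n * n" and Rs = "{3, 5, 6, 7, 20}" and Ms = "{2}" and C = "20 * n + 40" and
        J = "\<lambda>x \<sigma>'. \<forall>y<x. mem \<sigma>' 2 (int y) = P y m"])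
    show "reg \<sigma>1 9 = int (n * n)" by (simp add: \<sigma>1_def)
    show "int (n * n) \<le> w" using pows by (intro small) simp
    fix x \<sigma>' t'
    assume x: "x < n * n" and ag: "agree {3, 5, 6, 7, 20} {2} \<sigma>1 \<sigma>'" and rx: "reg \<sigma>' 5 = int x"
      and J: "\<forall>y<x. mem \<sigma>' 2 (int y) = P y m"
    define i j where "i = x div n" and "j = x mod n"
    have ij: "i < n" "j < n" using div_mod_less[OF x] by (auto simp: i_def j_def)
    have im: "i * m \<le> n * n" using ij m by (intro mult_le_mono) auto
    have r0: "reg \<sigma>' 0 = int n" "reg \<sigma>' 1 = int m" using r by (simp_all add: agree_reg[OF ag] \<sigma>1_def \<sigma>_def)
    define \<sigma>2 where "\<sigma>2 = set_reg (set_reg (set_reg \<sigma>' 6 (int (i * m))) 7 (int j)) 20 0"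
    have a2: "agree {3, 5, 6, 7, 20} {2} \<sigma>1 \<sigma>2" using ag by (simp add: \<sigma>2_def agree_set_reg)
    have inner: "wp w (For 3 1 (Asg 20 (V 20 [+] Rd 0 (V 6 [+] V 3) [*] Rd 1 (V 3 [*] V 0 [+] V 7))))
       (wp w (Wr 2 (V 5) (V 20)) (\<lambda>\<sigma>'' t''. t'' \<le> t' + (20 * n + 40) \<and> agree {3, 5, 6, 7, 20} {2} \<sigma>1 \<sigma>'' \<and> reg \<sigma>'' 5 = int x \<and>
        (\<forall>y<Suc x. mem (set_reg \<sigma>'' 5 (int x + 1)) 2 (int y) = P y m))) \<sigma>2 t2" if t2: "t2 \<le> t' + 20" for t2
    proof (rule wp_For[where m = m and Rs = "{3, 20}" and Ms = "{}" and C = 16 and J = "\<lambda>k \<sigma>''. reg \<sigma>'' 20 = P x k"])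
      show "reg \<sigma>2 1 = int m" using r0 by (simp add: \<sigma>2_def)
      show "int m \<le> w" using m pows by (intro small) simp
      show "reg (set_reg \<sigma>2 3 0) 20 = P x 0" by (simp add: \<sigma>2_def P_def)
      fix k \<sigma>'' t''
      assume k: "k < m" and ag2: "agree {3, 20} {} \<sigma>2 \<sigma>''" and rk: "reg \<sigma>'' 3 = int k" and acc: "reg \<sigma>'' 20 = P x k"
      have rr: "reg \<sigma>'' 0 = int n" "reg \<sigma>'' 6 = int (i * m)" "reg \<sigma>'' 7 = int j"
        using r0 by (simp_all add: agree_reg[OF ag2] \<sigma>2_def)
      have mm: "mem \<sigma>'' 0 = mem s 0" "mem \<sigma>'' 1 = mem s 1"
        by (simp_all add: agree_mem[OF ag2] agree_mem[OF a2]) (simp_all add: \<sigma>1_def \<sigma>_def)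
      have kn: "k * n \<le> n * n" using k m by (intro mult_le_mono) auto
      have bounds: "int (i * m + k) \<le> w" "int (k * n) \<le> w" "int (k * n + j) \<le> w"
        by (rule small, use im kn k m ij pows in linarith)+
      have e: "int (i * m) + int k = int (i * m + k)" "int k * int n = int (k * n)" "int (k * n) + int j = int (k * n + j)"
        by simp_all
      have Ps: "P x (Suc k) = P x k + A $$ (i, k) * B $$ (k, j)" by (simp add: P_def i_def j_def)
      have tw: "\<bar>A $$ (i, k) * B $$ (k, j)\<bar> \<le> w"
        using entry[OF x k] small[of "n * n"] pows unfolding i_def j_def by linarith
      show "wp w (Asg 20 (V 20 [+] Rd 0 (V 6 [+] V 3) [*] Rd 1 (V 3 [*] V 0 [+] V 7)))
         (\<lambda>\<sigma>''' t'''. t''' \<le> t'' + 16 \<and> agree {3, 20} {} \<sigma>2 \<sigma>''' \<and> reg \<sigma>''' 3 = int k \<and>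
          reg (set_reg \<sigma>''' 3 (int k + 1)) 20 = P x (Suc k)) \<sigma>'' t''"
        apply (intro wp_intros)
        using bounds tw Pw[OF x, of "Suc k"] k ag2
        by (simp_all add: rr rk acc mm e mA[OF ij(1) k] mB[OF k ij(2)] Ps agree_set_reg del: of_nat_add of_nat_mult)
    next
      fix \<sigma>'' t''
      assume ag2: "agree {3, 20} {} \<sigma>2 \<sigma>''" and acc: "reg \<sigma>'' 20 = P x m" and t'': "t'' \<le> t2 + m * (16 + 3) + 2"
      have a3: "agree {3, 5, 6, 7, 20} {2} \<sigma>1 \<sigma>''" by (rule agree_trans[OF a2 ag2]) auto
      have r5: "reg \<sigma>'' 5 = int x" using rx by (simp add: agree_reg[OF ag2] \<sigma>2_def)
      have m2: "mem \<sigma>'' 2 = mem \<sigma>' 2" by (simp add: agree_mem[OF ag2] \<sigma>2_def)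
      have "t'' + 3 \<le> t' + (20 * n + 40)" using t'' t2 m by simp
      then show "wp w (Wr 2 (V 5) (V 20)) (\<lambda>\<sigma>'' t''. t'' \<le> t' + (20 * n + 40) \<and> agree {3, 5, 6, 7, 20} {2} \<sigma>1 \<sigma>'' \<and> reg \<sigma>'' 5 = int x \<and>
        (\<forall>y<Suc x. mem (set_reg \<sigma>'' 5 (int x + 1)) 2 (int y) = P y m)) \<sigma>'' t''"
        apply (intro wp_intros)
        using a3 J by (simp_all add: r5 acc m2 agree_set_mem less_Suc_eq)
    qed (use w2 in auto)
    have e: "int x div int n = int i" "int x mod int n = int j" "int i * int m = int (i * m)"
      by (simp_all add: i_def j_def zdiv_int zmod_int)
    have bounds: "int i \<le> w" "int j \<le> w" "int (i * m) \<le> w"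
      by (rule small, use ij im pows in linarith)+
    show "wp w (Asg 6 (V 5 [div] V 0 [*] V 1) ;;
      Asg 7 (V 5 [mod] V 0) ;;
      Asg 20 (N 0) ;;
      For 3 1 (Asg 20 (V 20 [+] Rd 0 (V 6 [+] V 3) [*] Rd 1 (V 3 [*] V 0 [+] V 7))) ;;
      Wr 2 (V 5) (V 20))
      (\<lambda>\<sigma>'' t''. t'' \<le> t' + (20 * n + 40) \<and> agree {3, 5, 6, 7, 20} {2} \<sigma>1 \<sigma>'' \<and> reg \<sigma>'' 5 = int x \<and>
        (\<forall>y<Suc x. mem (set_reg \<sigma>'' 5 (int x + 1)) 2 (int y) = P y m)) \<sigma>' t'"
      apply (intro wp_Seq wp_Asg)
      using bounds w2 inner[of "15 + t'", unfolded \<sigma>2_def] by (simp_all add: rx r0 e del: of_nat_mult)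
  next
    fix \<sigma>' t'
    assume J: "\<forall>y<n * n. mem \<sigma>' 2 (int y) = P y m" and t': "t' \<le> 5 + n * n * (20 * n + 40 + 3) + 2"
    have "t' \<le> 7 + 20 * n ^ 3 + 43 * (n * n)" using t' by (simp add: algebra_simps power3_eq_cube)
    then have "t' \<le> 200 * n ^ 3" using pows by linarith
    then have "real t' \<le> real (200 * n ^ 3)" by (rule of_nat_mono)
    then show "real t' \<le> 200 * real n ^ 3 \<and> (\<forall>x<n * n. mem \<sigma>' 2 (int x) = P x m)" using J by simp
  qed (use w2 in auto)
  have "wp w naive (\<lambda>\<sigma>' t'. real t' \<le> 200 * real n ^ 3 \<and> (\<forall>x<n * n. mem \<sigma>' 2 (int x) = P x m)) \<sigma> 0"
    unfolding naive_def
  proof (rule wp_Seq, rule wp_Asg)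
    have "reg \<sigma> 0 = int n" using r by (simp add: \<sigma>_def)
    then have e: "ev (V 0 [*] V 0) \<sigma> = int (n * n)" by simp
    then show "wp w (For 5 9
     (Asg 6 (V 5 [div] V 0 [*] V 1) ;;
      Asg 7 (V 5 [mod] V 0) ;;
      Asg 20 (N 0) ;;
      For 3 1 (Asg 20 (V 20 [+] Rd 0 (V 6 [+] V 3) [*] Rd 1 (V 3 [*] V 0 [+] V 7))) ;;
      Wr 2 (V 5) (V 20)))
     (\<lambda>\<sigma>' t'. real t' \<le> 200 * real n ^ 3 \<and> (\<forall>x<n * n. mem \<sigma>' 2 (int x) = P x m))
     (set_reg \<sigma> 9 (ev (V 0 [*] V 0) \<sigma>)) (0 + (cost (V 0 [*] V 0) + 2))"
      using loop by (simp add: \<sigma>1_def)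
    have "int (n * n) \<le> w" using pows by (intro small) simp
    then show "defined w (V 0 [*] V 0) \<sigma>" "\<bar>ev (V 0 [*] V 0) \<sigma>\<bar> \<le> w" using e by simp_all
  qed simp
  then obtain t s' where e: "exec w naive s t s'" "real t \<le> 200 * real n ^ 3" "\<forall>x<n * n. mem s' 2 (int x) = P x m"
    unfolding wp_def \<sigma>_def by auto
  have "stored id (A * B) (mem s' 2)"
  proof (subst stored_flat[of _ n n])
    show "A * B \<in> carrier_mat n n" using A B by simp
    show "\<forall>x<n * n. mem s' 2 (int x) = id ((A * B) $$ (x div n, x mod n))"
    proof (intro allI impI)
      fix x assume x: "x < n * n"
      have "(A * B) $$ (x div n, x mod n) = P x m"
        using div_mod_less[OF x] A B by (subst index_mult_mat) (auto simp: scalar_prod_def P_def lessThan_atLeast0)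
      then show "mem s' 2 (int x) = id ((A * B) $$ (x div n, x mod n))" using e(3) x by simp
    qed
  qed
  then show "\<exists>t s'. exec ((int n + 1) ^ 6) naive s t s' \<and> real t \<le> 200 * real n ^ 3 \<and> stored id (A * B) (mem s' 2)"
    using e unfolding w_def by blast
qed

section \<open>The exponent of matrix multiplication\<close>

definition exponents :: "real \<Rightarrow> real set" where
  "exponents r = {\<tau>. \<exists>p c C. \<forall>n\<ge>1. \<forall>m\<ge>1. real m \<le> real n powr r \<longrightarrow>
                        multiplies p c n m (C * real n powr \<tau>)}"

lemma omega_exponents: "omega r = Inf (exponents r)"
  by (simp add: omega_def exponents_def)

text \<open>A consequence of the cost of writing the output. It makes the set of exponents bounded
  below, without which its infimum would say nothing.\<close>

lemma exponents_ge_2: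
  assumes r: "0 \<le> r" and \<tau>: "\<tau> \<in> exponents r"
  shows "2 \<le> \<tau>"
proof (rule ccontr)
  assume "\<not> 2 \<le> \<tau>"
  define \<delta> where "\<delta> = 2 - \<tau>"
  have \<delta>: "\<delta> > 0" using \<open>\<not> 2 \<le> \<tau>\<close> by (simp add: \<delta>_def)
  from \<tau> obtain p c C where m: "\<And>n m. n \<ge> 1 \<Longrightarrow> m \<ge> 1 \<Longrightarrow> real m \<le> real n powr r \<Longrightarrow> multiplies p c n m (C * real n powr \<tau>)"
    unfolding exponents_def by blast
  \<comment> \<open>Beyond this point the power of \<open>n\<close> with exponent
    \<open>\<delta>\<close> is at least \<bar>C\<bar> + 1 and so exceeds \<open>C\<close>.\<close>
  define y where "y = (\<bar>C\<bar> + 1) powr (1 / \<delta>)"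
  obtain n :: nat where n: "y \<le> real n" "1 \<le> n"
    by (metis le_cases nle_le of_nat_1 of_nat_le_iff order_trans real_arch_simple)
  have y: "0 < y" by (simp add: y_def)
  have "real (n * n) \<le> C * real n powr \<tau>"
    using multiplies_lower_bound[OF m[of n 1]] n r by (simp add: ge_one_powr_ge_zero)
  moreover have "real (n * n) = real n powr \<delta> * real n powr \<tau>"
    using n by (simp add: powr_add[symmetric] \<delta>_def power2_eq_square)
  ultimately have "real n powr \<delta> \<le> C" using n by simp
  moreover have "y powr \<delta> \<le> real n powr \<delta>" using n y \<delta> by (intro powr_mono2) auto
  moreover have "y powr \<delta> = \<bar>C\<bar> + 1" using \<delta> by (simp add: y_def powr_powr)
  ultimately show False by linarith
qed

lemma three_in_exponents:
  assumes "r \<le> 1"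
  shows "3 \<in> exponents r"
proof -
  have "multiplies naive 6 n m (200 * real n powr 3)" if "n \<ge> 1" "m \<ge> 1" "real m \<le> real n powr r" for n m
  proof -
    have "real n powr r \<le> real n powr 1" using that assms by (intro powr_mono) auto
    then have "m \<le> n" using that by simp
    then show ?thesis using multiplies_naive[of m n] that by (simp add: powr_numeral)
  qed
  then show ?thesis unfolding exponents_def by blast
qed

text \<open>A larger \<open>r\<close> admits more inner dimensions and hence fewer exponents. The
  range of \<open>r\<close> ensures that the smaller set is nonempty and the larger one is bounded
  below.\<close>

lemma omega_mono:
  assumes "0 \<le> r" "r \<le> r'" "r' \<le> 1"
  shows "omega r \<le> omega r'"
  unfolding omega_exponents
proof (rule cInf_superset_mono)
  show "exponents r' \<noteq> {}" using three_in_exponents assms by blast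
  show "bdd_below (exponents r)" using exponents_ge_2[OF assms(1)] by (intro bdd_belowI)
  show "exponents r' \<subseteq> exponents r"
  proof
    fix \<tau> assume "\<tau> \<in> exponents r'"
    then obtain p c C where m: "\<And>n m. n \<ge> 1 \<Longrightarrow> m \<ge> 1 \<Longrightarrow> real m \<le> real n powr r' \<Longrightarrow> multiplies p c n m (C * real n powr \<tau>)"
      unfolding exponents_def by blast
    have "multiplies p c n m (C * real n powr \<tau>)" if "n \<ge> 1" "m \<ge> 1" "real m \<le> real n powr r" for n m
    proof (rule m[OF that(1,2)])
      have "real n powr r \<le> real n powr r'" using that assms by (intro powr_mono) auto
      then show "real m \<le> real n powr r'" using that by simp
    qed
    then show "\<tau> \<in> exponents r" unfolding exponents_def by blast
  qed
qed

lemma exists_exponent: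
  assumes "0 \<le> r" "r \<le> 1" "0 < \<epsilon>"
  shows "\<exists>\<tau>\<in>exponents r. \<tau> < omega r + \<epsilon>"
proof -
  have "exponents r \<noteq> {}" using three_in_exponents assms by blast
  moreover have "Inf (exponents r) < omega r + \<epsilon>" using assms(3) by (simp add: omega_exponents)
  ultimately show ?thesis by (rule cInf_lessD)
qed

lemma ln_nat_nonneg: "1 \<le> n \<Longrightarrow> 0 \<le> ln (real n)"
  by simp

lemma report_bound_mono:
  assumes "1 \<le> n" "T \<le> T'"
  shows "report_bound n l T \<le> report_bound n l T'"
  unfolding report_bound_def report_factor_def using assms ln_nat_nonneg[OF assms(1)]
  by (intro mult_left_mono) auto

text \<open>A single program for all \<open>l\<close> is given here, so \<open>report\<close> can
  use it directly and loses only a polylogarithmic factor.\<close>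

lemma reportable_if_multiplication_in_time:
  assumes "multiplication_in_time f"
  shows "witnesses_reportable_in_time (\<lambda>n l. (real n / real l) * f n l)"
proof -
  from assms obtain p c T C d where T: "\<And>n l. n \<ge> 1 \<Longrightarrow> l \<in> {1..n} \<Longrightarrow> T n l \<le> C * (1 + ln (real n)) ^ d * f n l"
    and m: "\<And>n l. n \<ge> 1 \<Longrightarrow> l \<in> {1..n} \<Longrightarrow> multiplies p c n l (T n l)"
    unfolding multiplication_in_time_def soft_O_def by blast
  have "(\<lambda>n l. report_bound n l (T n l)) \<in> soft_O (\<lambda>n l. (real n / real l) * f n l)"
    unfolding soft_O_def mem_Collect_eq
  proof (intro exI[of _ "report_factor * C"] exI[of _ "12 + d"] allI impI ballI)
    fix n l :: nat assume nl: "n \<ge> 1" "l \<in> {1..n}"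
    have "report_bound n l (T n l) \<le> report_bound n l (C * (1 + ln (real n)) ^ d * f n l)"
      using T[OF nl] nl by (intro report_bound_mono)
    also have "\<dots> = report_factor * C * (1 + ln (real n)) ^ (12 + d) * (real n / real l * f n l)"
      unfolding report_bound_def power_add by (simp only: mult_ac)
    finally show "report_bound n l (T n l) \<le> report_factor * C * (1 + ln (real n)) ^ (12 + d) * (real n / real l * f n l)" .
  qed
  moreover have "reports_witnesses (report p) (c + 60) n l (report_bound n l (T n l))" if nl: "n \<ge> 1" "l \<in> {1..n}" for n l
  proof (rule reports_witnessesI)
    fix A B and \<sigma> :: state
    assume "A \<in> carrier_mat n n" "B \<in> carrier_mat n n" "reg \<sigma> 0 = int n" "reg \<sigma> 1 = int l"
      "stored of_bool A (mem \<sigma> 0)" "stored of_bool B (mem \<sigma> 1)"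
    then show "wp ((int n + 1) ^ (c + 60)) (report p) (\<lambda>\<sigma>' t. real t \<le> report_bound n l (T n l) \<and> outputs A B n l \<sigma>') \<sigma> 0"
      using nl by (intro wp_report_matrices[OF m[OF nl]]) auto
  qed
  ultimately show ?thesis
    unfolding witnesses_reportable_in_time_def
    by (intro exI[of _ "report p"] exI[of _ "c + 60"] bexI[of _ "\<lambda>n l. report_bound n l (T n l)"]) auto
qed

subsection \<open>Rounding the block length\<close>

text \<open>
  The infimum \<open>omega r\<close> provides a program for every \<open>r\<close> separately. A single program uses those for
  \<open>r = i / K\<close>: it rounds \<open>l\<close> down to the largest \<open>m\<close> with \<open>m ^ K \<le> n ^ i\<close>, where \<open>i\<close> is the largest
  number with \<open>n ^ i \<le> l ^ K\<close>, and reports witnesses of rank at most \<open>m\<close>.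
\<close>

fun pow_expr :: "nat \<Rightarrow> nat \<Rightarrow> expr" where
  "pow_expr x 0 = N 1"
| "pow_expr x (Suc k) = pow_expr x k [*] V x"

lemma ev_pow_expr: "ev (pow_expr x k) \<sigma> = reg \<sigma> x ^ k"
  by (induction k) auto

lemma cost_pow_expr: "cost (pow_expr x k) = 2 * k + 1"
  by (induction k) auto

lemma defined_pow_expr:
  assumes "x < 50" "1 \<le> reg \<sigma> x" "reg \<sigma> x ^ k \<le> w"
  shows "defined w (pow_expr x k) \<sigma>"
  using assms(3)
proof (induction k)
  case (Suc k)
  have "reg \<sigma> x ^ k \<le> reg \<sigma> x ^ Suc k" using assms by (intro power_increasing) auto
  then have "reg \<sigma> x ^ k \<le> w" using Suc.prems by linarith
  moreover have "0 \<le> reg \<sigma> x" using assms by linarith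
  ultimately show ?case using Suc assms by (simp add: ev_pow_expr mult.commute abs_of_nonneg)
qed auto

text \<open>Register 34 keeps the original \<open>l\<close> as the bound of the loop, while register
  1 is lowered to the rounded value that \<open>report\<close> expects there.\<close>

definition branch :: "nat \<Rightarrow> (nat \<Rightarrow> com) \<Rightarrow> nat \<Rightarrow> com" where
  "branch K ps i =
    Asg 34 (V 1) ;;
    For 5 34 (Cond (pow_expr 0 i) (pow_expr 1 K) (Asg 1 (V 1 [-] N 1)) Skip) ;;
    report (ps i)"

text \<open>Each exponent has its own subprogram, so the index must be fixed in the program text;
  this calls for a chain of tests instead of a loop. Comparing integer powers replaces the
  comparison of a logarithm with \<open>i / K\<close>.\<close>

fun cascade :: "nat \<Rightarrow> (nat \<Rightarrow> com) \<Rightarrow> nat \<Rightarrow> com" where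
  "cascade K ps 0 = branch K ps 0"
| "cascade K ps (Suc i) = Cond (pow_expr 1 K) (pow_expr 0 (Suc i)) (cascade K ps i) (branch K ps (Suc i))"

lemma power_le_words:
  assumes "x \<le> n" "k \<le> c" "(int n + 1) ^ c \<le> w"
  shows "int x ^ k \<le> w"
proof -
  have "int x ^ k \<le> (int n + 1) ^ k" using assms by (intro power_mono) auto
  also have "\<dots> \<le> (int n + 1) ^ c" using assms by (intro power_increasing) auto
  finally show ?thesis using assms by linarith
qed

lemma wp_branch:
  assumes l: "1 \<le> l" "l \<le> n" and K: "1 \<le> K" and w: "(int n + 1) ^ c \<le> w" and c: "cs i + 60 \<le> c" "K \<le> c" "i \<le> c"
    and A: "A \<in> carrier_mat n n" and B: "B \<in> carrier_mat n n"
    and \<sigma>: "reg \<sigma> 0 = int n" "reg \<sigma> 1 = int l" "stored of_bool A (mem \<sigma> 0)" "stored of_bool B (mem \<sigma> 1)"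
    and m: "\<And>m. 1 \<le> m \<Longrightarrow> m \<le> n \<Longrightarrow> m ^ K \<le> n ^ i \<Longrightarrow> multiplies (ps i) (cs i) n m T"
    and Q: "\<And>\<sigma>' t' m. 1 \<le> m \<Longrightarrow> m \<le> l \<Longrightarrow> m ^ K \<le> n ^ i \<Longrightarrow> m = l \<or> n ^ i < (m + 1) ^ K \<Longrightarrow>
      outputs A B n m \<sigma>' \<Longrightarrow> real t' \<le> real t + real (l * (2 * K + 2 * i + 15) + 5) + report_bound n m T \<Longrightarrow> Q \<sigma>' t'"
  shows "wp w (branch K ps i) Q \<sigma> t"
proof -
  have n: "1 \<le> n" using l by simp
  have lw: "int l \<le> w" "1 \<le> w" using power_le_words[of l n 1 c w] power_le_words[of 1 n 1 c w] l c n w by auto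
  define \<sigma>1 where "\<sigma>1 = set_reg \<sigma> 34 (int l)"
  have loop: "wp w (For 5 34 (Cond (pow_expr 0 i) (pow_expr 1 K) (Asg 1 (V 1 [-] N 1)) Skip)) (wp w (report (ps i)) Q) \<sigma>1 (t + 3)"
  \<comment> \<open>Either the rounding is finished or every iteration so far has decremented. After
    \<open>l\<close> iterations the second case would mean \<open>m = 0\<close>, but 1 is never left
    because \<open>1 ^ K \<le> n ^ i\<close>. The other disjunction keeps track of the maximality of
    \<open>m\<close>.\<close>
  proof (rule wp_For[where m = l and Rs = "{1, 5}" and Ms = "{}" and C = "2 * K + 2 * i + 12" and
        J = "\<lambda>k \<sigma>'. \<exists>m. reg \<sigma>' 1 = int m \<and> 1 \<le> m \<and> m \<le> l \<and> (m = l \<or> n ^ i < (m + 1) ^ K) \<and> (m ^ K \<le> n ^ i \<or> m + k = l)"])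
    show "reg \<sigma>1 34 = int l" by (simp add: \<sigma>1_def)
    show "\<exists>m. reg (set_reg \<sigma>1 5 0) 1 = int m \<and> 1 \<le> m \<and> m \<le> l \<and> (m = l \<or> n ^ i < (m + 1) ^ K) \<and> (m ^ K \<le> n ^ i \<or> m + 0 = l)"
      using \<sigma> l by (intro exI[of _ l]) (simp add: \<sigma>1_def)
    fix k \<sigma>' t'
    assume k: "k < l" and ag: "agree {1, 5} {} \<sigma>1 \<sigma>'" and rk: "reg \<sigma>' 5 = int k"
      and J: "\<exists>m. reg \<sigma>' 1 = int m \<and> 1 \<le> m \<and> m \<le> l \<and> (m = l \<or> n ^ i < (m + 1) ^ K) \<and> (m ^ K \<le> n ^ i \<or> m + k = l)"
    from J obtain m where m: "reg \<sigma>' 1 = int m" "1 \<le> m" "m \<le> l" "m = l \<or> n ^ i < (m + 1) ^ K" "m ^ K \<le> n ^ i \<or> m + k = l" by blast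
    have r0: "reg \<sigma>' 0 = int n" using \<sigma> by (simp add: agree_reg[OF ag] \<sigma>1_def)
    have def: "defined w (pow_expr 0 i) \<sigma>'" "defined w (pow_expr 1 K) \<sigma>'"
      using n m l power_le_words[OF _ c(3) w, of n] power_le_words[OF _ c(2) w, of m]
      by (auto intro!: defined_pow_expr simp: r0)
    show "wp w (Cond (pow_expr 0 i) (pow_expr 1 K) (Asg 1 (V 1 [-] N 1)) Skip)
      (\<lambda>\<sigma>'' t''. t'' \<le> t' + (2 * K + 2 * i + 12) \<and> agree {1, 5} {} \<sigma>1 \<sigma>'' \<and> reg \<sigma>'' 5 = int k \<and>
       (\<exists>m. reg (set_reg \<sigma>'' 5 (int k + 1)) 1 = int m \<and> 1 \<le> m \<and> m \<le> l \<and> (m = l \<or> n ^ i < (m + 1) ^ K) \<and>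
         (m ^ K \<le> n ^ i \<or> m + Suc k = l))) \<sigma>' t'"
    proof (rule wp_Cond[OF def])
      assume "ev (pow_expr 0 i) \<sigma>' < ev (pow_expr 1 K) \<sigma>'"
      then have lt: "n ^ i < m ^ K" by (simp add: ev_pow_expr r0 m(1) flip: of_nat_power)
      have m2: "m \<noteq> 1" using lt n by (intro notI) (simp add: not_less)
      have "\<exists>m'. int m - 1 = int m' \<and> 1 \<le> m' \<and> m' \<le> l \<and> (m' = l \<or> n ^ i < (m' + 1) ^ K) \<and> (m' ^ K \<le> n ^ i \<or> m' + Suc k = l)"
        using m m2 lt by (intro exI[of _ "m - 1"]) auto
      then show "wp w (Asg 1 (V 1 [-] N 1)) (\<lambda>\<sigma>'' t''. t'' \<le> t' + (2 * K + 2 * i + 12) \<and> agree {1, 5} {} \<sigma>1 \<sigma>'' \<and> reg \<sigma>'' 5 = int k \<and>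
       (\<exists>m. reg (set_reg \<sigma>'' 5 (int k + 1)) 1 = int m \<and> 1 \<le> m \<and> m \<le> l \<and> (m = l \<or> n ^ i < (m + 1) ^ K) \<and>
         (m ^ K \<le> n ^ i \<or> m + Suc k = l))) \<sigma>' (t' + (cost (pow_expr 0 i) + cost (pow_expr 1 K) + 1))"
        apply (intro wp_intros)
        using m lw ag rk by (simp_all add: cost_pow_expr agree_set_reg)
    next
      assume "\<not> ev (pow_expr 0 i) \<sigma>' < ev (pow_expr 1 K) \<sigma>'"
      then have "m ^ K \<le> n ^ i" by (simp add: ev_pow_expr r0 m(1) not_less flip: of_nat_power)
      then show "wp w Skip (\<lambda>\<sigma>'' t''. t'' \<le> t' + (2 * K + 2 * i + 12) \<and> agree {1, 5} {} \<sigma>1 \<sigma>'' \<and> reg \<sigma>'' 5 = int k \<and>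
       (\<exists>m. reg (set_reg \<sigma>'' 5 (int k + 1)) 1 = int m \<and> 1 \<le> m \<and> m \<le> l \<and> (m = l \<or> n ^ i < (m + 1) ^ K) \<and>
         (m ^ K \<le> n ^ i \<or> m + Suc k = l))) \<sigma>' (t' + (cost (pow_expr 0 i) + cost (pow_expr 1 K) + 1))"
        using m ag rk by (intro wp_Skip) (auto simp: cost_pow_expr)
    qed
  next
    fix \<sigma>' t'
    assume ag: "agree {1, 5} {} \<sigma>1 \<sigma>'" and t': "t' \<le> t + 3 + l * (2 * K + 2 * i + 12 + 3) + 2"
      and J: "\<exists>m. reg \<sigma>' 1 = int m \<and> 1 \<le> m \<and> m \<le> l \<and> (m = l \<or> n ^ i < (m + 1) ^ K) \<and> (m ^ K \<le> n ^ i \<or> m + l = l)"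
    then obtain k where k: "reg \<sigma>' 1 = int k" "1 \<le> k" "k \<le> l" "k = l \<or> n ^ i < (k + 1) ^ K" "k ^ K \<le> n ^ i" by auto
    have kn: "k \<le> n" using k l by simp
    show "wp w (report (ps i)) Q \<sigma>' t'"
    proof (rule wp_report_matrices[OF m[OF k(2) kn k(5)] n k(2) kn _ A B _ k(1)])
      show "(int n + 1) ^ (cs i + 60) \<le> w" using power_increasing[OF c(1), of "int n + 1"] w by linarith
      show "reg \<sigma>' 0 = int n" "stored of_bool A (mem \<sigma>' 0)" "stored of_bool B (mem \<sigma>' 1)"
        using \<sigma> by (simp_all add: agree_reg[OF ag] agree_mem[OF ag] \<sigma>1_def)
      fix \<sigma>'' t''
      assume o: "outputs A B n k \<sigma>''" and t'': "real t'' \<le> real t' + report_bound n k T"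
      have "2 * K + 2 * i + 12 + 3 = 2 * K + 2 * i + 15" by simp
      then have "t' \<le> t + (l * (2 * K + 2 * i + 15) + 5)" using t' by (simp add: add_ac)
      then have "real t' \<le> real t + real (l * (2 * K + 2 * i + 15) + 5)" by (simp only: of_nat_add[symmetric] of_nat_le_iff)
      then show "Q \<sigma>'' t''" using t'' by (intro Q[OF k(2,3,5,4) o]) linarith
    qed
  qed (use lw in auto)
  show ?thesis
    unfolding branch_def
  proof (intro wp_Seq wp_Asg)
    show "wp w (For 5 34 (Cond (pow_expr 0 i) (pow_expr 1 K) (Asg 1 (V 1 [-] N 1)) Skip)) (wp w (report (ps i)) Q)
      (set_reg \<sigma> 34 (ev (V 1) \<sigma>)) (t + (cost (V 1) + 2))"
      using loop \<sigma> by (simp add: \<sigma>1_def add.commute[of 3 t])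
  qed (use \<sigma> lw in simp_all)
qed

text \<open>The disjunction assumed for \<open>i\<close> records that all larger indices have been
  rejected, which makes the chosen \<open>j\<close> maximal. The chain ends safely at 0, since
  \<open>n ^ 0 \<le> l ^ K\<close>.\<close>

lemma wp_cascade:
  assumes l: "1 \<le> l" "l \<le> n" and K: "1 \<le> K" and w: "(int n + 1) ^ c \<le> w"
    and c: "\<And>i. i \<le> K \<Longrightarrow> cs i + 60 \<le> c" "K \<le> c"
    and A: "A \<in> carrier_mat n n" and B: "B \<in> carrier_mat n n"
    and \<sigma>: "reg \<sigma> 0 = int n" "reg \<sigma> 1 = int l" "stored of_bool A (mem \<sigma> 0)" "stored of_bool B (mem \<sigma> 1)"
    and m: "\<And>i m. i \<le> K \<Longrightarrow> 1 \<le> m \<Longrightarrow> m \<le> n \<Longrightarrow> m ^ K \<le> n ^ i \<Longrightarrow> multiplies (ps i) (cs i) n m (T i)"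
    and i: "i \<le> K" "i = K \<or> l ^ K < n ^ Suc i"
    and Q: "\<And>\<sigma>' t' j m. j \<le> K \<Longrightarrow> n ^ j \<le> l ^ K \<Longrightarrow> j = K \<or> l ^ K < n ^ Suc j \<Longrightarrow> 1 \<le> m \<Longrightarrow> m \<le> l \<Longrightarrow>
      m ^ K \<le> n ^ j \<Longrightarrow> m = l \<or> n ^ j < (m + 1) ^ K \<Longrightarrow> outputs A B n m \<sigma>' \<Longrightarrow>
      real t' \<le> real t + real (i * (4 * K + 5) + (l * (4 * K + 15) + 5)) + report_bound n m (T j) \<Longrightarrow> Q \<sigma>' t'"
  shows "wp w (cascade K ps i) Q \<sigma> t"
  using i Q
proof (induction i arbitrary: t)
  case (0 t)
  show ?case
    unfolding cascade.simps
  proof (rule wp_branch[where cs = cs and T = "T 0" and i = 0 and ps = ps, OF l K w c(1)[of 0] c(2) _ A B \<sigma> m[of 0]])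
    fix \<sigma>' t' k
    assume k: "1 \<le> k" "k \<le> l" "k ^ K \<le> n ^ 0" "k = l \<or> n ^ 0 < (k + 1) ^ K" "outputs A B n k \<sigma>'"
      and t': "real t' \<le> real t + real (l * (2 * K + 2 * 0 + 15) + 5) + report_bound n k (T 0)"
    show "Q \<sigma>' t'"
    proof (rule 0(3)[of 0 k, OF _ _ 0(2) k])
      have "l * (2 * K + 2 * 0 + 15) + 5 \<le> 0 * (4 * K + 5) + (l * (4 * K + 15) + 5)" by simp
      then have "real (l * (2 * K + 2 * 0 + 15) + 5) \<le> real (0 * (4 * K + 5) + (l * (4 * K + 15) + 5))" by (rule of_nat_mono)
      then show "real t' \<le> real t + real (0 * (4 * K + 5) + (l * (4 * K + 15) + 5)) + report_bound n k (T 0)"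
        using t' by linarith
    qed (use l in auto)
  qed auto
next
  case (Suc i t)
  have n: "1 \<le> n" using l by simp
  have r: "reg \<sigma> 0 = int n" "reg \<sigma> 1 = int l" by fact+
  have def: "defined w (pow_expr 1 K) \<sigma>" "defined w (pow_expr 0 (Suc i)) \<sigma>"
    using n l Suc.prems(1) c(2) power_le_words[OF _ _ w, of n "Suc i"] power_le_words[OF _ c(2) w, of l]
    by (intro defined_pow_expr; simp add: r del: power_Suc)+
  have lt_iff: "ev (pow_expr 1 K) \<sigma> < ev (pow_expr 0 (Suc i)) \<sigma> \<longleftrightarrow> l ^ K < n ^ Suc i"
    unfolding ev_pow_expr r by (simp only: of_nat_power[symmetric] of_nat_less_iff)
  have cst: "cost (pow_expr 1 K) + cost (pow_expr 0 (Suc i)) + 1 \<le> 4 * K + 5"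
    unfolding cost_pow_expr using Suc.prems(1) by simp
  show ?case
    unfolding cascade.simps
  proof (rule wp_Cond[OF def])
    assume "ev (pow_expr 1 K) \<sigma> < ev (pow_expr 0 (Suc i)) \<sigma>"
    then have lt: "l ^ K < n ^ Suc i" by (simp only: lt_iff)
    show "wp w (cascade K ps i) Q \<sigma> (t + (cost (pow_expr 1 K) + cost (pow_expr 0 (Suc i)) + 1))"
    proof (rule Suc.IH)
      fix \<sigma>' t' j k
      assume k: "j \<le> K" "n ^ j \<le> l ^ K" "j = K \<or> l ^ K < n ^ Suc j" "1 \<le> k" "k \<le> l" "k ^ K \<le> n ^ j"
        "k = l \<or> n ^ j < (k + 1) ^ K" "outputs A B n k \<sigma>'"
        and t': "real t' \<le> real (t + (cost (pow_expr 1 K) + cost (pow_expr 0 (Suc i)) + 1)) +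
          real (i * (4 * K + 5) + (l * (4 * K + 15) + 5)) + report_bound n k (T j)"
      have "t + (cost (pow_expr 1 K) + cost (pow_expr 0 (Suc i)) + 1) + (i * (4 * K + 5) + (l * (4 * K + 15) + 5))
        \<le> t + (Suc i * (4 * K + 5) + (l * (4 * K + 15) + 5))" unfolding mult_Suc using cst by linarith
      then have "real (t + (cost (pow_expr 1 K) + cost (pow_expr 0 (Suc i)) + 1)) + real (i * (4 * K + 5) + (l * (4 * K + 15) + 5))
        \<le> real t + real (Suc i * (4 * K + 5) + (l * (4 * K + 15) + 5))"
        by (simp only: of_nat_add[symmetric] of_nat_le_iff)
      then show "Q \<sigma>' t'" using t' by (intro Suc.prems(3)[OF k]) linarith
    qed (use Suc.prems(1) lt in auto)
  next
    assume "\<not> ev (pow_expr 1 K) \<sigma> < ev (pow_expr 0 (Suc i)) \<sigma>"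
    then have ge: "n ^ Suc i \<le> l ^ K" by (simp only: lt_iff not_less)
    show "wp w (branch K ps (Suc i)) Q \<sigma> (t + (cost (pow_expr 1 K) + cost (pow_expr 0 (Suc i)) + 1))"
    proof (rule wp_branch[where cs = cs and T = "T (Suc i)" and i = "Suc i" and ps = ps, OF l K w c(1)[OF Suc.prems(1)] c(2) _ A B \<sigma> m[OF Suc.prems(1)]])
      show "Suc i \<le> c" using Suc.prems(1) c(2) by simp
      fix \<sigma>' t' k
      assume k: "1 \<le> k" "k \<le> l" "k ^ K \<le> n ^ Suc i" "k = l \<or> n ^ Suc i < (k + 1) ^ K" "outputs A B n k \<sigma>'"
        and t': "real t' \<le> real (t + (cost (pow_expr 1 K) + cost (pow_expr 0 (Suc i)) + 1)) +
          real (l * (2 * K + 2 * Suc i + 15) + 5) + report_bound n k (T (Suc i))"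
      have "l * (2 * K + 2 * Suc i + 15) \<le> l * (4 * K + 15)" using Suc.prems(1) by (intro mult_le_mono2) simp
      then have "t + (cost (pow_expr 1 K) + cost (pow_expr 0 (Suc i)) + 1) + (l * (2 * K + 2 * Suc i + 15) + 5)
        \<le> t + (Suc i * (4 * K + 5) + (l * (4 * K + 15) + 5))" unfolding mult_Suc using cst by linarith
      then have "real (t + (cost (pow_expr 1 K) + cost (pow_expr 0 (Suc i)) + 1)) + real (l * (2 * K + 2 * Suc i + 15) + 5)
        \<le> real t + real (Suc i * (4 * K + 5) + (l * (4 * K + 15) + 5))"
        by (simp only: of_nat_add[symmetric] of_nat_le_iff)
      then show "Q \<sigma>' t'" using t' by (intro Suc.prems(3)[OF Suc.prems(1) ge Suc.prems(2) k]) linarith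
    qed auto
  qed
qed

text \<open>The \<open>\<epsilon>\<close> is spent in two halves. One replaces each infimum by an
  exponent that some program attains. The other pays for rounding \<open>l\<close> to the grid of
  powers of \<open>n\<close> with step 1/K, where \<open>K\<close> is chosen such that 1/K is at
  most \<open>\<epsilon> / 2\<close>. Finitely many programs then cover all
  \<open>l\<close>.\<close>

lemma reportable_above_omega:
  assumes \<epsilon>: "0 < \<epsilon>"
  shows "witnesses_reportable_in_time
    (\<lambda>n l. (real n / real l) * real n powr (omega (log (real n) (real l)) + \<epsilon>))"
proof -
  define K where "K = nat \<lceil>2 / \<epsilon>\<rceil>"
  have "2 / \<epsilon> \<le> real K" unfolding K_def by (rule real_nat_ceiling_ge)
  moreover have "0 < 2 / \<epsilon>" using \<epsilon> by simp
  ultimately have Kpos: "0 < real K" by linarith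
  have "2 \<le> real K * \<epsilon>" using \<open>2 / \<epsilon> \<le> real K\<close> \<epsilon> by (simp add: divide_le_eq)
  then have Keps: "1 / real K \<le> \<epsilon> / 2" using Kpos by (simp add: divide_le_eq mult.commute)
  have K: "1 \<le> K" using Kpos by simp
  have "\<exists>\<tau>. i \<le> K \<longrightarrow> \<tau> \<in> exponents (real i / real K) \<and> \<tau> < omega (real i / real K) + \<epsilon> / 2" for i
    using exists_exponent[of "real i / real K" "\<epsilon> / 2"] \<epsilon> Kpos by (cases "i \<le> K") auto
  then obtain \<tau> where \<tau>: "\<And>i. i \<le> K \<Longrightarrow> \<tau> i \<in> exponents (real i / real K)"
      "\<And>i. i \<le> K \<Longrightarrow> \<tau> i < omega (real i / real K) + \<epsilon> / 2" by metis
  have "\<exists>p c C. i \<le> K \<longrightarrow> (\<forall>n\<ge>1. \<forall>m\<ge>1. real m \<le> real n powr (real i / real K) \<longrightarrow>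
      multiplies p c n m (C * real n powr \<tau> i))" for i
    using \<tau>(1)[of i] unfolding exponents_def by blast
  then obtain ps cs Cs where mult: "\<And>i n m. i \<le> K \<Longrightarrow> n \<ge> 1 \<Longrightarrow> m \<ge> 1 \<Longrightarrow>
      real m \<le> real n powr (real i / real K) \<Longrightarrow> multiplies (ps i) (cs i) n m (Cs i * real n powr \<tau> i)" by metis
  \<comment> \<open>Sums over the finitely many \<open>i \<le> K\<close> serve as bounds that are
    uniform in \<open>i\<close>.\<close>
  define c where "c = (\<Sum>i\<le>K. cs i) + 60 + K"
  define C where "C = (\<Sum>i\<le>K. \<bar>Cs i\<bar>)"
  have cs: "cs i + 60 \<le> c" if "i \<le> K" for i
    using member_le_sum[of i "{..K}" cs] that by (simp add: c_def)
  have Cs: "Cs i \<le> C" if "i \<le> K" for i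
    using member_le_sum[of i "{..K}" "\<lambda>i. \<bar>Cs i\<bar>"] that by (simp add: C_def)
  have C0: "0 \<le> C" by (simp add: C_def sum_nonneg)
  define F where "F = (\<lambda>n l. (real n / real l) * real n powr (omega (log (real n) (real l)) + \<epsilon>))"
  define C' where "C' = 2 * report_factor * C * (1 + real (K * (4 * K + 5) + (4 * K + 20)))"
  \<comment> \<open>Translates between the real powers in the definition of the exponent and the
    integer powers that the program compares.\<close>
  have root: "real m \<le> real n powr (real i / real K) \<longleftrightarrow> m ^ K \<le> n ^ i" if "n \<ge> 1" for m n i
  proof -
    have e: "(real n powr (real i / real K)) ^ K = real (n ^ i)"
      using that Kpos by (simp add: powr_realpow[symmetric] powr_powr powr_power)
    have "real m \<le> real n powr (real i / real K) \<longleftrightarrow> real m ^ K \<le> (real n powr (real i / real K)) ^ K"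
      using K by (subst power_mono_iff) auto
    also have "\<dots> \<longleftrightarrow> m ^ K \<le> n ^ i" unfolding e by (simp only: of_nat_power[symmetric] of_nat_le_iff)
    finally show ?thesis .
  qed
  have "reports_witnesses (cascade K ps K) c n l (C' * (1 + ln (real n)) ^ 12 * F n l)"
    if n: "n \<ge> 1" and l: "l \<in> {1..n}" for n l
  proof (rule reports_witnessesI)
    fix A B and \<sigma> :: state
    assume A: "A \<in> carrier_mat n n" "B \<in> carrier_mat n n" and \<sigma>: "reg \<sigma> 0 = int n" "reg \<sigma> 1 = int l"
      "stored of_bool A (mem \<sigma> 0)" "stored of_bool B (mem \<sigma> 1)"
    have l1: "1 \<le> l" "l \<le> n" using l by auto
    show "wp ((int n + 1) ^ c) (cascade K ps K)
      (\<lambda>\<sigma>' t. real t \<le> C' * (1 + ln (real n)) ^ 12 * F n l \<and> outputs A B n l \<sigma>') \<sigma> 0"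
    proof (rule wp_cascade[where cs = cs and T = "\<lambda>i. Cs i * real n powr \<tau> i", OF l1 K order_refl cs _ A \<sigma>])
      show "K \<le> c" by (simp add: c_def)
      show "multiplies (ps i) (cs i) n m (Cs i * real n powr \<tau> i)" if "i \<le> K" "1 \<le> m" "m ^ K \<le> n ^ i" for i m
        using that n root[of n m i] by (intro mult) auto
      fix \<sigma>' t' i m
      assume i: "i \<le> K" "n ^ i \<le> l ^ K" "i = K \<or> l ^ K < n ^ Suc i" and m: "1 \<le> m" "m \<le> l" "m ^ K \<le> n ^ i"
        "m = l \<or> n ^ i < (m + 1) ^ K" and o: "outputs A B n m \<sigma>'"
        and t': "real t' \<le> real 0 + real (K * (4 * K + 5) + (l * (4 * K + 15) + 5)) + report_bound n m (Cs i * real n powr \<tau> i)"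
      define x where "x = real n"
      define R where "R = report_bound n m (Cs i * real n powr \<tau> i)"
      have x: "1 \<le> x" using n by (simp add: x_def)
      have ln0: "0 \<le> ln x" using x by simp
      have lowT: "real (n * n) \<le> Cs i * real n powr \<tau> i"
        using root[OF n, of m i] m n i(1) by (intro multiplies_lower_bound[OF mult]) auto
      \<comment> \<open>Rounding loses at most one grid step, a factor
        \<open>x powr (1 / real K)\<close>. The maximality of \<open>m\<close> costs a further
        factor 2, through m + 1 \<le> 2m.\<close>
      have nm: "real n / real m \<le> 2 * (real n / real l) * x powr (1 / real K)"
      proof -
        have "real l \<le> 2 * real m * x powr (1 / real K)"
        proof (cases "m = l")
          case True
          have "1 \<le> x powr (1 / real K)" using x Kpos by (intro ge_one_powr_ge_zero) auto
          then have "real l * 1 \<le> (2 * real l) * x powr (1 / real K)" by (intro mult_mono) auto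
          then show ?thesis using True by simp
        next
          case False
          \<comment> \<open>For \<open>i = K\<close> this comes from \<open>l \<le> n\<close>,
            otherwise from the maximality of \<open>i\<close>.\<close>
          have "l ^ K \<le> n ^ Suc i"
            using i(3)
          proof
            assume "i = K"
            have "l ^ K \<le> n ^ K" using l1(2) by (rule power_mono) simp
            also have "\<dots> \<le> n ^ Suc i" using n \<open>i = K\<close> by (intro power_increasing) auto
            finally show ?thesis .
          qed simp
          then have "real l \<le> x powr (real (Suc i) / real K)" using root[OF n, of l "Suc i"] by (simp add: x_def)
          also have "real (Suc i) / real K = real i / real K + 1 / real K" by (simp add: add_divide_distrib)
          also have "x powr (real i / real K + 1 / real K) = x powr (real i / real K) * x powr (1 / real K)" by (rule powr_add)
          also have "\<dots> \<le> (2 * real m) * x powr (1 / real K)"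
          proof (rule mult_right_mono)
            have "\<not> real (m + 1) \<le> real n powr (real i / real K)" using root[OF n, of "m + 1" i] m(4) False by simp
            then show "x powr (real i / real K) \<le> 2 * real m" using m(1) by (simp add: x_def)
          qed simp
          finally show ?thesis .
        qed
        then have "real n * real l \<le> real n * (2 * real m * x powr (1 / real K))" by (rule mult_left_mono) simp
        then show ?thesis using m(1) l1(1) by (simp add: field_simps)
      qed
      have expo: "x powr (1 / real K) * x powr \<tau> i \<le> x powr (omega (log x (real l)) + \<epsilon>)"
      \<comment> \<open>To the base 1 the logarithm is a division by zero, but then both sides are
        powers of 1.\<close>
      proof (cases "n = 1")
        case True
        then show ?thesis by (simp add: x_def)
      next
        case False
        then have x1: "1 < x" using n by (simp add: x_def)
        have "real n powr (real i / real K) \<le> real l"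
        proof -
          have "(x powr (real i / real K)) ^ K = real (n ^ i)"
            using x1 Kpos by (simp add: powr_realpow[symmetric] powr_powr powr_power x_def)
          also have "\<dots> \<le> real l ^ K" using i(2) by (simp only: of_nat_power[symmetric] of_nat_le_iff)
          finally have "(x powr (real i / real K)) ^ K \<le> real l ^ K" .
          then show ?thesis unfolding x_def using K by (subst (asm) power_mono_iff) auto
        qed
        then have rl: "real i / real K \<le> log x (real l)" using x1 l1(1) by (simp add: le_log_iff x_def)
        have "log x (real l) \<le> 1" using x1 l1 by (simp add: log_le_one_cancel_iff x_def)
        \<comment> \<open>This is why \<open>l\<close> is rounded down: the grid point must not
          exceed the true exponent for monotonicity to help.\<close>
        then have "omega (real i / real K) \<le> omega (log x (real l))" using rl by (intro omega_mono) auto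
        then have "1 / real K + \<tau> i \<le> omega (log x (real l)) + \<epsilon>" using \<tau>(2)[OF i(1)] Keps by linarith
        then show ?thesis unfolding powr_add[symmetric] using x by (intro powr_mono) auto
      qed
      have FF: "(real n / real m) * (Cs i * x powr \<tau> i) \<le> 2 * C * F n l"
      proof -
        have "(real n / real m) * (Cs i * x powr \<tau> i) \<le> (2 * (real n / real l) * x powr (1 / real K)) * (C * x powr \<tau> i)"
        proof (rule mult_mono[OF nm mult_right_mono[OF Cs[OF i(1)]]])
          show "0 \<le> Cs i * x powr \<tau> i" using lowT unfolding x_def by (rule order_trans[OF of_nat_0_le_iff])
        qed simp_all
        also have "\<dots> = 2 * C * ((real n / real l) * (x powr (1 / real K) * x powr \<tau> i))" by simp
        also have "\<dots> \<le> 2 * C * F n l"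
          unfolding F_def x_def[symmetric] using expo C0 by (intro mult_left_mono) (auto simp: x_def)
        finally show ?thesis .
      qed
      have R: "R \<le> report_factor * (1 + ln x) ^ 12 * (2 * C * F n l)"
        unfolding R_def report_bound_def x_def[symmetric] using FF ln0
        by (intro mult_left_mono) (auto simp: x_def report_factor_def)
      \<comment> \<open>The rounding itself takes linear time, which disappears in the bound for the
        reporting because a product costs at least \<open>n * n\<close>.\<close>
      have Rn: "real n \<le> R"
      proof -
        have "real n * 1 \<le> real n * real n" using n by (intro mult_left_mono) auto
        then have "real n \<le> Cs i * x powr \<tau> i" using lowT by (simp add: x_def)
        moreover have "0 \<le> Cs i * x powr \<tau> i" using calculation by (rule order_trans[OF of_nat_0_le_iff])
        ultimately have "1 * real n \<le> (real n / real m) * (Cs i * x powr \<tau> i)"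
          using m l1 by (intro mult_mono) auto
        moreover have "1 * ((real n / real m) * (Cs i * x powr \<tau> i)) \<le> (report_factor * (1 + ln x) ^ 12) * ((real n / real m) * (Cs i * x powr \<tau> i))"
        proof (rule mult_right_mono)
          have "1 * 1 \<le> report_factor * (1 + ln x) ^ 12"
            using ln0 by (intro mult_mono one_le_power) (auto simp: report_factor_def)
          then show "1 \<le> report_factor * (1 + ln x) ^ 12" by simp
          show "0 \<le> (real n / real m) * (Cs i * x powr \<tau> i)" using \<open>0 \<le> Cs i * x powr \<tau> i\<close> by simp
        qed
        ultimately show ?thesis unfolding R_def report_bound_def x_def by linarith
      qed
      define a where "a = K * (4 * K + 5) + (4 * K + 20)"
      have "K * (4 * K + 5) + (l * (4 * K + 15) + 5) \<le> a * n"
      proof -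
        have "l * (4 * K + 15) \<le> (4 * K + 15) * n" using l1 by simp
        moreover have "K * (4 * K + 5) \<le> K * (4 * K + 5) * n" "5 \<le> 5 * n" using n by simp_all
        ultimately show ?thesis unfolding a_def distrib_right by linarith
      qed
      then have "real (K * (4 * K + 5) + (l * (4 * K + 15) + 5)) \<le> real a * real n"
        by (simp only: of_nat_mult[symmetric] of_nat_le_iff)
      also have "\<dots> \<le> real a * R" using Rn by (rule mult_left_mono) simp
      finally have "real t' \<le> (1 + real a) * R" using t' unfolding R_def by (simp add: algebra_simps)
      also have "\<dots> \<le> (1 + real a) * (report_factor * (1 + ln x) ^ 12 * (2 * C * F n l))"
        using R by (rule mult_left_mono) simp
      also have "\<dots> = C' * (1 + ln (real n)) ^ 12 * F n l"
        unfolding C'_def a_def x_def by (simp only: mult_ac)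
      finally show "real t' \<le> C' * (1 + ln (real n)) ^ 12 * F n l \<and> outputs A B n l \<sigma>'"
        using outputs_mono[OF o m(2)] by simp
    qed auto
  qed
  moreover have "(\<lambda>n l. C' * (1 + ln (real n)) ^ 12 * F n l) \<in> soft_O F"
    unfolding soft_O_def by blast
  ultimately have "witnesses_reportable_in_time F"
    unfolding witnesses_reportable_in_time_def
    by (intro exI[of _ "cascade K ps K"] exI[of _ c] bexI[of _ "\<lambda>n l. C' * (1 + ln (real n)) ^ 12 * F n l"]) auto
  then show ?thesis by (simp add: F_def)
qed

theorem theorem7:
  shows "(\<forall>\<epsilon>>0. witnesses_reportable_in_time
            (\<lambda>n l. (real n / real l) * real n powr (omega (log (real n) (real l)) + \<epsilon>)))
       \<and> (multiplication_in_time (\<lambda>n l. real n powr omega (log (real n) (real l))) \<longrightarrow>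
          witnesses_reportable_in_time
            (\<lambda>n l. (real n / real l) * real n powr omega (log (real n) (real l))))"
  using reportable_above_omega reportable_if_multiplication_in_time by blast

end
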